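(* Let $n,m\ge 1$, let $t_0<T$ be real numbers, let $U\subseteq\mathbb{R}^m$ be a nonempty set, and let $f:\mathbb{R}^n\times U\times[t_0,T]\to\mathbb{R}^n$ and $F:\mathbb{R}^n\times U\times[t_0,T]\to\mathbb{R}$. Assume: (i) $f$ and $F$ are continuous, and there is a constant $M>0$ such that $\|f(0,u,t)\|\le M$ and $|F(0,u,t)|\le M$ for all $(u,t)\in U\times[t_0,T]$. (ii) There is a nondecreasing function $L:\mathbb{R}_+\to\mathbb{R}_+$ such that for every $R>0$, all $(x,t),(y,s)\in B_R(\mathbb{R}^n)\times[t_0,T]$ and all $u\in U$, $$\|f(x,u,t)-f(y,u,s)\|\le L(R)(|t-s|+\|x-y\|),\qquad |F(x,u,t)-F(y,u,s)|\le L(R)(|t-s|+\|x-y\|).$$ (iii) There is a modulus $\omega$ such that for every $R>0$, all $\lambda\in[0,1]$, $(x,t),(y,s)\in B_R(\mathbb{R}^n)\times[t_0,T]$ and $u\in U$, $$\|\lambda f(x,u,t)+(1-\lambda)f(y,u,s)-f(\lambda x+(1-\lambda)y,u,\lambda t+(1-\lambda)s)\|\le\lambda(1-\lambda)(|t-s|+\|x-y\|)\,\omega(R,|t-s|+\|x-y\|).$$ (iv) There is a modulus $\omega$ such that for every $R>0$, all $\lambda\in[0,1]$, $(x,t),(y,s)\in B_R(\mathbb{R}^n)\times[t_0,T]$ and $u\in U$, $$\lambda F(x,u,t)+(1-\lambda)F(y,u,s)-F(\lambda x+(1-\lambda)y,u,\lambda t+(1-\lambda)s)\le\lambda(1-\lambda)(|t-s|+\|x-y\|)\,\omega(R,|t-s|+\|x-y\|).$$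 If the control domain $U$ is compact, then the value function $V:\mathbb{R}^n\times[t_0,T]\to\mathbb{R}$ is an extended solution of the Hamilton-Jacobi-Bellman equation $$-v_\tau+\sup_{u\in U}\mathscr{H}(x,-v_x,u,\tau)=0,\quad (x,\tau)\in\mathbb{R}^n\times(t_0,T),\qquad v(x,T)=0.$$
   Context: Notation: $\mathbb{R}_+=[0,+\infty)$; $B_R(\mathbb{R}^n)$ is the open ball of radius $R$ centered at $0$ in $\mathbb{R}^n$. A modulus is a function $\omega:\mathbb{R}_+\times\mathbb{R}_+\to\mathbb{R}_+$ with $\omega(r,d)\le\omega(R,D)$ whenever $r\le R$, $d\le D$, and $\lim_{D\to0+}\omega(R,D)=0$ for every $R>0$. Control Hamiltonian: $\mathscr{H}(x,p,u,t):=\sum_{i=1}^n p_i f_i(x,u,t)-F(x,u,t)$ for $x,p\in\mathbb{R}^n$, $u\in U$, $t\in[t_0,T]$. Admissible controls: for $\tau\in[t_0,T]$, $\mathcal{U}(\tau)$ is the set of Lebesgue measurable functions $u(\cdot):[\tau,T]\to U$. Standing assumption: for every $(x^0,\tau)\in\mathbb{R}^n\times[t_0,T]$ and $u(\cdot)\in\mathcal{U}(\tau)$ there is a unique (absolutely continuous) solution $x(\cdot)$ on $[\tau,T]$ of $\dot x(t)=f(x(t),u(t),t)$, $x(\tau)=x^0$. Value function: $V(x^0,\tau):=\inf_{u(\cdot)\in\mathcal{U}(\tau)}\int_\tau^T F(x(t),u(t),t)\,dt$, where $x(\cdot)$ is that solution. Partial superdifferentials of a continuous $\varphi:\mathbb{R}^n\times[t_0,T]\to\mathbb{R}$: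 $$\partial_+\varphi_x(x,\tau):=\Big\{p\in\mathbb{R}^n:\limsup_{y\to x}\frac{\varphi(y,\tau)-\varphi(x,\tau)-\langle p,y-x\rangle}{\|y-x\|}\le0\Big\},$$ $$\partial_+\varphi_\tau(x,\tau):=\Big\{q\in\mathbb{R}:\limsup_{t\to\tau}\frac{\varphi(x,t)-\varphi(x,\tau)-q(t-\tau)}{|t-\tau|}\le0\Big\},$$ where $t$ ranges over $[t_0,T]$, so that at $\tau=t_0$ (resp. $\tau=T$) the second limsup is one-sided, taken over $t\downarrow t_0$ (resp. $t\uparrow T$). Extended solution: a continuous function $V:\mathbb{R}^n\times[t_0,T]\to\mathbb{R}$ is an extended solution of the Hamilton-Jacobi-Bellman equation with its boundary condition if for every $x\in\mathbb{R}^n$ and $\tau\in[t_0,T]$ there exist $p^*\in\mathbb{R}^n$ with $-p^*\in\partial_+V_x(x,\tau)$ and $u^*\in U$ such that $\mathscr{H}(x,p^*,u^*,\tau)\ge\mathscr{H}(x,p^*,u,\tau)$ for all $u\in U$ and $\mathscr{H}(x,p^*,u^*,\tau)\in\partial_+V_\tau(x,\tau)$, and moreover $V(x,T)=0$ for all $x\in\mathbb{R}^n$. *)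

theory Defs
  imports "HOL-Analysis.Analysis"
begin

definition modulus :: "(real \<Rightarrow> real \<Rightarrow> real) \<Rightarrow> bool" where
  "modulus \<omega> \<longleftrightarrow>
     (\<forall>r\<ge>0. \<forall>d\<ge>0. 0 \<le> \<omega> r d) \<and>
     (\<forall>r R d D. 0 \<le> r \<and> r \<le> R \<and> 0 \<le> d \<and> d \<le> D \<longrightarrow> \<omega> r d \<le> \<omega> R D) \<and>
     (\<forall>R>0. ((\<lambda>D. \<omega> R D) \<longlongrightarrow> 0) (at_right 0))"

(* The usual epsilon-delta definition for curves; not to be confused with the library's
   absolutely_continuous, which is about measures. *)
definition abs_continuous_on :: "real \<Rightarrow> real \<Rightarrow> (real \<Rightarrow> 'a::metric_space) \<Rightarrow> bool" where
  "abs_continuous_on c d x \<longleftrightarrow>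
     (\<forall>\<epsilon>>0. \<exists>\<delta>>0. \<forall>(N::nat) a b.
        (\<forall>i<N. c \<le> a i \<and> a i \<le> b i \<and> b i \<le> d) \<and>
        (\<forall>i<N. \<forall>j<N. i \<noteq> j \<longrightarrow> {a i<..<b i} \<inter> {a j<..<b j} = {}) \<and>
        (\<Sum>i<N. b i - a i) < \<delta> \<longrightarrow>
        (\<Sum>i<N. dist (x (a i)) (x (b i))) < \<epsilon>)"

(* Functions on [\<tau>, T], on U and on [t0, T] are represented by total functions; only their
   values on the stated domains matter. *)

definition hamiltonian ::
  "(real^'n \<Rightarrow> 'u \<Rightarrow> real \<Rightarrow> real^'n) \<Rightarrow> (real^'n \<Rightarrow> 'u \<Rightarrow> real \<Rightarrow> real)
     \<Rightarrow> real^'n \<Rightarrow> real^'n \<Rightarrow> 'u \<Rightarrow> real \<Rightarrow> real" where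
  "hamiltonian f F x p u t = (\<Sum>i\<in>UNIV. p $ i * f x u t $ i) - F x u t"

definition admissible_controls :: "(real^'m) set \<Rightarrow> real \<Rightarrow> real \<Rightarrow> (real \<Rightarrow> real^'m) set" where
  "admissible_controls U T \<tau> =
     {u. u \<in> borel_measurable (lebesgue_on {\<tau>..T}) \<and> (\<forall>t\<in>{\<tau>..T}. u t \<in> U)}"

(* Caratheodory solution: the equation holds almost everywhere on [\<tau>, T]. *)
definition trajectory ::
  "(real^'n \<Rightarrow> 'u \<Rightarrow> real \<Rightarrow> real^'n) \<Rightarrow> real \<Rightarrow> real^'n \<Rightarrow> real \<Rightarrow> (real \<Rightarrow> 'u)
     \<Rightarrow> (real \<Rightarrow> real^'n) \<Rightarrow> bool" where
  "trajectory f T x0 \<tau> u x \<longleftrightarrow>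
     abs_continuous_on \<tau> T x \<and> x \<tau> = x0 \<and>
     (AE t in lebesgue_on {\<tau>..T}.
        (x has_vector_derivative f (x t) (u t) t) (at t within {\<tau>..T}))"

definition costs ::
  "(real^'n \<Rightarrow> real^'m \<Rightarrow> real \<Rightarrow> real^'n) \<Rightarrow> (real^'n \<Rightarrow> real^'m \<Rightarrow> real \<Rightarrow> real)
     \<Rightarrow> (real^'m) set \<Rightarrow> real \<Rightarrow> real^'n \<Rightarrow> real \<Rightarrow> real set" where
  "costs f F U T x0 \<tau> =
     {LINT t|lebesgue_on {\<tau>..T}. F (x t) (u t) t | u x.
        u \<in> admissible_controls U T \<tau> \<and> trajectory f T x0 \<tau> u x}"

(* This real-valued infimum is meaningful only where the set of costs is nonempty and bounded
   below. *)
definition value_function ::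
  "(real^'n \<Rightarrow> real^'m \<Rightarrow> real \<Rightarrow> real^'n) \<Rightarrow> (real^'n \<Rightarrow> real^'m \<Rightarrow> real \<Rightarrow> real)
     \<Rightarrow> (real^'m) set \<Rightarrow> real \<Rightarrow> real^'n \<Rightarrow> real \<Rightarrow> real" where
  "value_function f F U T x0 \<tau> = Inf (costs f F U T x0 \<tau>)"

definition superdiff_x :: "(real^'n \<Rightarrow> real \<Rightarrow> real) \<Rightarrow> real^'n \<Rightarrow> real \<Rightarrow> (real^'n) set" where
  "superdiff_x \<phi> x \<tau> =
     {p. Limsup (at x) (\<lambda>y. ereal ((\<phi> y \<tau> - \<phi> x \<tau> - p \<bullet> (y - x)) / norm (y - x))) \<le> 0}"

(* The filter makes the limsup one-sided at the end points of [t0, T]. *)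
definition superdiff_t ::
  "real \<Rightarrow> real \<Rightarrow> (real^'n \<Rightarrow> real \<Rightarrow> real) \<Rightarrow> real^'n \<Rightarrow> real \<Rightarrow> real set" where
  "superdiff_t t0 T \<phi> x \<tau> =
     {q. Limsup (at \<tau> within {t0..T})
           (\<lambda>t. ereal ((\<phi> x t - \<phi> x \<tau> - q * (t - \<tau>)) / \<bar>t - \<tau>\<bar>)) \<le> 0}"

(* Extended solution of -v_t + sup_{u in U} H(x, -v_x, u, t) = 0 with v(x, T) = 0. *)
definition extended_solution ::
  "(real^'n \<Rightarrow> 'u \<Rightarrow> real \<Rightarrow> real^'n) \<Rightarrow> (real^'n \<Rightarrow> 'u \<Rightarrow> real \<Rightarrow> real)
     \<Rightarrow> 'u set \<Rightarrow> real \<Rightarrow> real \<Rightarrow> (real^'n \<Rightarrow> real \<Rightarrow> real) \<Rightarrow> bool" where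
  "extended_solution f F U t0 T V \<longleftrightarrow>
     continuous_on (UNIV \<times> {t0..T}) (\<lambda>(x, \<tau>). V x \<tau>) \<and>
     (\<forall>x. \<forall>\<tau>\<in>{t0..T}. \<exists>p. \<exists>u\<in>U.
        - p \<in> superdiff_x V x \<tau> \<and>
        (\<forall>v\<in>U. hamiltonian f F x p v \<tau> \<le> hamiltonian f F x p u \<tau>) \<and>
        hamiltonian f F x p u \<tau> \<in> superdiff_t t0 T V x \<tau>) \<and>
     (\<forall>x. V x T = 0)"

end

theory Submission
  imports Defs
begin

text \<open>The argument rests on one property of the value function \<open>V\<close>: locally, and away from the terminal time,
it is semiconcave jointly in \<open>(x, \<tau>)\<close> (\<open>V_semiconcave\<close>). For such a function a subgradient \<open>(p, q)\<close> at a
point \<open>(y, s)\<close> is automatically a supergradient, with a remainder controlled by the modulus of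
semiconcavity alone (\<open>proximal_subgradient_is_supergradient\<close>). Proximal subgradients exist on a dense set of
points, because \<open>V\<close> plus a steep quadratic attains its minimum near the centre of the quadratic
(\<open>proximal_subgradient_dense\<close>). At such a point dynamic programming can be tested from both sides:
the lower bound on \<open>V\<close> along nearly optimal trajectories gives \<open>q \<le> H(y, - p, u, s)\<close> for some \<open>u\<close>
(\<open>proximal_subgradient_supersolution\<close>), and the upper bound along constant controls gives
\<open>H(y, - p, v, s) \<le> q\<close> for all \<open>v\<close> (\<open>supergradient_subsolution\<close>). Every \<open>(x, \<tau>)\<close> with \<open>\<tau> < T\<close> is a limit of
such points. The subgradients stay bounded, \<open>U\<close> is compact, and the remainder in the supergradient
inequality is uniform, so both the equation and the inequality pass to the limit; this is the extended
solution property (\<open>extended_solution_before_terminal_time\<close>). At \<open>\<tau> = T\<close> the function \<open>V\<close> vanishes for all \<open>x\<close>, so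
\<open>p = 0\<close>, and a minimiser of \<open>F x \<cdot> T\<close> serves as control.

Semiconcavity is proved by comparing trajectories that start at different times. An affine change of time
with fixed point \<open>T\<close> brings all of them onto one interval, where they are driven by the same control; the
convex combination of two of them then solves the equation of the middle one up to an error of the
size allowed by the semiconcavity hypotheses on \<open>f\<close> and \<open>F\<close>, and Gronwall's inequality transfers this error to
trajectories and costs.

All constants in these estimates depend on a ball that contains the trajectories. The
right-hand side \<open>f\<close> may grow arbitrarily fast, so the existence of such a ball, uniform over all controls,
has to be derived from the mere fact that every single trajectory exists up to time \<open>T\<close>
(\<open>bounded_reach_always\<close>). If the set reachable from some point were unbounded, compactness
would provide a sequence of points with unbounded reachable sets that tends to infinity before \<open>T\<close>, each one being
a limit of points reachable from the previous one. A limit cannot in general be reached exactly, but since the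
flow of a fixed control is a homeomorphism that expands no more than a known factor in backward time, a whole ball around the
next point is hit from a small ball around the previous one. Nesting these balls yields one
initial point and one control whose trajectory leaves every bounded set before \<open>T\<close>, a contradiction.\<close>

section \<open>Absolutely continuous curves and Gronwall estimates\<close>

text \<open>Differential equations are used in this integral form. It is required on every subinterval, so that
it restricts to subintervals and survives time reversal without further argument.\<close>

definition primitive_on :: "real \<Rightarrow> real \<Rightarrow> (real \<Rightarrow> 'a::euclidean_space) \<Rightarrow> (real \<Rightarrow> 'a) \<Rightarrow> bool" where
  "primitive_on a b g y \<longleftrightarrow> (\<forall>s t. a \<le> s \<and> s \<le> t \<and> t \<le> b \<longrightarrow> (g has_integral (y t - y s)) {s..t})"

lemma abs_continuous_onE:
  assumes "abs_continuous_on a b x" "e > 0"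
  obtains d where "d > 0"
    "\<And>N::nat. \<And>p q. (\<forall>i<N. a \<le> p i \<and> p i \<le> q i \<and> q i \<le> b) \<Longrightarrow>
        (\<forall>i<N. \<forall>j<N. i \<noteq> j \<longrightarrow> {p i<..<q i} \<inter> {p j<..<q j} = {}) \<Longrightarrow>
        (\<Sum>i<N. q i - p i) < d \<Longrightarrow> (\<Sum>i<N. dist (x (p i)) (x (q i))) < e"
proof -
  obtain d where "d > 0" and d: "\<forall>(N::nat) p q. (\<forall>i<N. a \<le> p i \<and> p i \<le> q i \<and> q i \<le> b) \<and>
        (\<forall>i<N. \<forall>j<N. i \<noteq> j \<longrightarrow> {p i<..<q i} \<inter> {p j<..<q j} = {}) \<and>
        (\<Sum>i<N. q i - p i) < d \<longrightarrow> (\<Sum>i<N. dist (x (p i)) (x (q i))) < e"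
    by (rule exE[OF assms(1)[unfolded abs_continuous_on_def, THEN spec, THEN mp, OF assms(2)]], erule conjE)
  show thesis
    by (rule that[OF \<open>d > 0\<close>], rule d[THEN spec, THEN spec, THEN spec, THEN mp], intro conjI)
qed

lemma abs_continuous_on_subinterval:
  assumes "abs_continuous_on a b x" "a \<le> s" "t \<le> b"
  shows "abs_continuous_on s t x"
  unfolding abs_continuous_on_def
proof (intro allI impI)
  fix e :: real assume "e > 0"
  obtain d where "d > 0" and d: "\<And>N::nat. \<And>p q. (\<forall>i<N. a \<le> p i \<and> p i \<le> q i \<and> q i \<le> b) \<Longrightarrow>
        (\<forall>i<N. \<forall>j<N. i \<noteq> j \<longrightarrow> {p i<..<q i} \<inter> {p j<..<q j} = {}) \<Longrightarrow>
        (\<Sum>i<N. q i - p i) < d \<Longrightarrow> (\<Sum>i<N. dist (x (p i)) (x (q i))) < e"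
    using abs_continuous_onE[OF assms(1) \<open>e > 0\<close>] by blast
  show "\<exists>\<delta>>0. \<forall>(N::nat) a b. (\<forall>i<N. s \<le> a i \<and> a i \<le> b i \<and> b i \<le> t) \<and>
        (\<forall>i<N. \<forall>j<N. i \<noteq> j \<longrightarrow> {a i<..<b i} \<inter> {a j<..<b j} = {}) \<and>
        (\<Sum>i<N. b i - a i) < \<delta> \<longrightarrow> (\<Sum>i<N. dist (x (a i)) (x (b i))) < e"
  proof (intro exI[of _ d] conjI allI impI \<open>d > 0\<close>)
    fix N :: nat and p q
    assume H: "(\<forall>i<N. s \<le> p i \<and> p i \<le> q i \<and> q i \<le> t) \<and>
        (\<forall>i<N. \<forall>j<N. i \<noteq> j \<longrightarrow> {p i<..<q i} \<inter> {p j<..<q j} = {}) \<and> (\<Sum>i<N. q i - p i) < d"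
    show "(\<Sum>i<N. dist (x (p i)) (x (q i))) < e"
    proof (rule d)
      show "\<forall>i<N. a \<le> p i \<and> p i \<le> q i \<and> q i \<le> b" using H assms(2,3) by force
    qed (use H in auto)
  qed
qed

text \<open>The gauge for the Henstock-Kurzweil integral is chosen separately on the exceptional null set \<open>N\<close>. A tag
outside \<open>N\<close> is handled by differentiability, as in the fundamental theorem of calculus. A tag in \<open>N\<close> gets an interval
inside an open set of small measure around \<open>N\<close>; the total increment of \<open>x\<close> over such intervals is small by
absolute continuity.\<close>

lemma abs_continuous_has_integral:
  fixes x :: "real \<Rightarrow> 'a::euclidean_space"
  assumes "a \<le> b" and ac: "abs_continuous_on a b x"
    and der: "AE t in lebesgue_on {a..b}. (x has_vector_derivative g t) (at t within {a..b})"
  shows "(g has_integral (x b - x a)) {a..b}"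
proof -
  define N where "N = {t\<in>{a..b}. \<not> (x has_vector_derivative g t) (at t within {a..b})}"
  have "AE t in lebesgue. t \<in> {a..b} \<longrightarrow> (x has_vector_derivative g t) (at t within {a..b})"
    using der by (subst (asm) AE_restrict_space_iff) auto
  then have "{t. \<not> (t \<in> {a..b} \<longrightarrow> (x has_vector_derivative g t) (at t within {a..b}))} \<in> null_sets lebesgue"
    by (simp add: AE_iff_null_sets completion.AE_iff_null_sets)
  then have negN: "negligible N"
    by (simp add: negligible_iff_null_sets N_def conj_commute)
  define g' where "g' t = (if t \<in> N then 0 else g t)" for t
  have "(g' has_integral (x b - x a)) {a..b}"
    unfolding has_integral_real
  proof (intro allI impI)
    fix e :: real assume "e > 0"
    obtain \<delta> where "\<delta> > 0" and \<delta>: "\<And>n::nat. \<And>p q. (\<forall>i<n. a \<le> p i \<and> p i \<le> q i \<and> q i \<le> b) \<Longrightarrow>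
        (\<forall>i<n. \<forall>j<n. i \<noteq> j \<longrightarrow> {p i<..<q i} \<inter> {p j<..<q j} = {}) \<Longrightarrow>
        (\<Sum>i<n. q i - p i) < \<delta> \<Longrightarrow> (\<Sum>i<n. dist (x (p i)) (x (q i))) < e/2"
      using abs_continuous_onE[OF ac half_gt_zero[OF \<open>e > 0\<close>]] by blast
    have Nleb: "N \<in> sets lebesgue" using negN negligible_imp_sets by blast
    obtain G where G: "open G" "N \<subseteq> G" "G - N \<in> lmeasurable" "emeasure lebesgue (G - N) < ennreal \<delta>"
      using sets_lebesgue_outer_open[OF Nleb \<open>\<delta> > 0\<close>] by metis
    have Gm: "G \<in> lmeasurable"
      using fmeasurable.Un[OF G(3) negligible_imp_measurable[OF negN]] G(2) by (simp add: Un_absorb2)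
    have "measure lebesgue G \<le> measure lebesgue (G - N) + measure lebesgue N"
      using measure_Un_le[of "G - N" lebesgue N] G(3) Nleb G(2) by (auto simp: Un_absorb2)
    moreover have "measure lebesgue (G - N) < \<delta>"
      using G(3,4) \<open>\<delta> > 0\<close> by (simp add: emeasure_eq_measure2 ennreal_less_iff)
    ultimately have mG: "measure lebesgue G < \<delta>"
      using negligible_imp_measure0[OF negN] by simp
    define e' where "e' = e / (2 * (b - a + 1))"
    have "e' > 0" using \<open>e > 0\<close> \<open>a \<le> b\<close> by (simp add: e'_def)
    have "\<exists>d>0. (t \<in> N \<longrightarrow> ball t d \<subseteq> G) \<and>
        (t \<in> {a..b} - N \<longrightarrow> (\<forall>y\<in>{a..b}. norm (y - t) < d \<longrightarrow> norm (x y - x t - (y - t) *\<^sub>R g t) \<le> e' * norm (y - t)))" for t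
    proof (cases "t \<in> N")
      case True
      then show ?thesis using G(1,2) by (metis DiffD2 open_contains_ball subsetD)
    next
      case False
      show ?thesis
      proof (cases "t \<in> {a..b}")
        case True
        then have "(x has_vector_derivative g t) (at t within {a..b})" using False by (auto simp: N_def)
        then show ?thesis unfolding has_vector_derivative_def has_derivative_within_alt
          using \<open>e' > 0\<close> False by blast
      qed (use False in \<open>auto intro: exI[of _ 1]\<close>)
    qed
    then obtain d where d: "\<And>t. d t > 0" "\<And>t. t \<in> N \<Longrightarrow> ball t (d t) \<subseteq> G"
      "\<And>t y. t \<in> {a..b} - N \<Longrightarrow> y \<in> {a..b} \<Longrightarrow> norm (y - t) < d t \<Longrightarrow> norm (x y - x t - (y - t) *\<^sub>R g t) \<le> e' * norm (y - t)"
      by metis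
    show "\<exists>\<gamma>. gauge \<gamma> \<and> (\<forall>\<D>. \<D> tagged_division_of {a..b} \<and> \<gamma> fine \<D> \<longrightarrow>
        norm ((\<Sum>(x, k)\<in>\<D>. measure lborel k *\<^sub>R g' x) - (x b - x a)) < e)"
    proof (intro exI conjI allI impI)
      show "gauge (\<lambda>t. ball t (d t))" using d(1) gauge_ball_dependent by blast
      fix \<D> assume "\<D> tagged_division_of {a..b} \<and> (\<lambda>t. ball t (d t)) fine \<D>"
      then have D: "\<D> tagged_division_of {a..b}" and fine: "(\<lambda>t. ball t (d t)) fine \<D>" by auto
      have finD: "finite \<D>" using D by (rule tagged_division_of_finite)
      have K: "K = {Inf K..Sup K} \<and> a \<le> Inf K \<and> Inf K \<le> t \<and> t \<le> Sup K \<and> Sup K \<le> b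
             \<and> measure lborel K = Sup K - Inf K \<and> K \<subseteq> ball t (d t)" if tK: "(t, K) \<in> \<D>" for t K
      proof -
        have "t \<in> K" "K \<subseteq> {a..b}" "\<exists>u v. K = cbox u v"
          using tagged_division_ofD(2-4)[OF D tK] by auto
        then obtain u v where K': "K = {u..v}" "u \<le> v" by auto
        then have "Inf K = u" "Sup K = v" by auto
        with K' \<open>t \<in> K\<close> \<open>K \<subseteq> {a..b}\<close> fineD[OF fine tK] show ?thesis by (auto simp: content_real)
      qed
      define D1 where "D1 = {p\<in>\<D>. fst p \<in> N}"
      have D1: "finite D1" "D1 \<subseteq> \<D>" using finD by (auto simp: D1_def)
      let ?S = "\<lambda>p. Sup (snd p)" and ?I = "\<lambda>p. Inf (snd p)"
      let ?h = "\<lambda>p. measure lborel (snd p) *\<^sub>R g' (fst p) - (x (?S p) - x (?I p))"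
      have sumD: "(\<Sum>(t, k)\<in>\<D>. measure lborel k *\<^sub>R g' t) - (x b - x a) = sum ?h \<D>"
        using additive_tagged_division_1[OF \<open>a \<le> b\<close> D, of x]
        by (simp add: sum_subtractf split_def)
      have split: "sum ?h \<D> = sum ?h (\<D> - D1) + sum ?h D1"
        using sum.subset_diff[OF D1(2) finD] by blast
      have "norm (sum ?h (\<D> - D1)) \<le> (\<Sum>p\<in>\<D> - D1. e' * (?S p - ?I p))"
      proof (rule sum_norm_le, clarify)
        fix t K assume tK: "(t, K) \<in> \<D>" "(t, K) \<notin> D1"
        note KK = K[OF tK(1)]
        have KKc: "measure lborel K = Sup K - Inf K" using KK by blast
        have "Sup K \<in> K" "Inf K \<in> K" using KK by (metis atLeastAtMost_iff order.trans order_refl)+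
        then have bd: "norm (Sup K - t) < d t" "norm (Inf K - t) < d t"
          using KK by (auto simp: dist_norm norm_minus_commute subset_iff)
        have tN: "t \<in> {a..b} - N" using tK KK by (auto simp: D1_def)
        have "norm (x (Sup K) - x t - (Sup K - t) *\<^sub>R g t) \<le> e' * (Sup K - t)"
          using d(3)[OF tN _ bd(1)] KK by auto
        moreover have "norm (x (Inf K) - x t - (Inf K - t) *\<^sub>R g t) \<le> e' * (t - Inf K)"
          using d(3)[OF tN _ bd(2)] KK by auto
        moreover have "measure lborel K *\<^sub>R g' t - (x (Sup K) - x (Inf K)) =
            (x (Inf K) - x t - (Inf K - t) *\<^sub>R g t) - (x (Sup K) - x t - (Sup K - t) *\<^sub>R g t)"
          unfolding KKc using tN by (simp add: g'_def algebra_simps)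
        ultimately show "norm (measure lborel (snd (t, K)) *\<^sub>R g' (fst (t, K)) - (x (Sup (snd (t, K))) - x (Inf (snd (t, K))))) \<le> e' * (Sup (snd (t, K)) - Inf (snd (t, K)))"
          unfolding fst_conv snd_conv
          by (smt (verit) norm_triangle_ineq4 right_diff_distrib)
      qed
      also have "\<dots> \<le> (\<Sum>p\<in>\<D>. e' * (?S p - ?I p))"
        by (rule sum_mono2) (use finD \<open>e' > 0\<close> K in \<open>force intro!: mult_nonneg_nonneg\<close>)+
      also have "\<dots> = e' * (b - a)"
        using additive_tagged_division_1[OF \<open>a \<le> b\<close> D, of "\<lambda>x. x"]
        by (simp add: sum_distrib_left[symmetric] split_def)
      also have "\<dots> \<le> e / 2" using \<open>e > 0\<close> \<open>a \<le> b\<close> by (simp add: e'_def divide_simps)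
      finally have good: "norm (sum ?h (\<D> - D1)) \<le> e / 2" .
      obtain h where h: "bij_betw h {..<card D1} D1"
        using ex_bij_betw_nat_finite[OF D1(1)] by (auto simp: atLeast0LessThan)
      have hD: "(fst (h i), snd (h i)) \<in> \<D> \<and> fst (h i) \<in> N" if "i < card D1" for i
        using bij_betwE[OF h] that by (auto simp: D1_def)
      have disj: "{?I (h i)<..<?S (h i)} \<inter> {?I (h j)<..<?S (h j)} = {}"
        if ij: "i < card D1" "j < card D1" "i \<noteq> j" for i j
      proof -
        have "h i \<noteq> h j" using h ij by (auto simp: bij_betw_def inj_on_def)
        then have "interior (snd (h i)) \<inter> interior (snd (h j)) = {}"
          using tagged_division_ofD(5)[OF D, of "fst (h i)" "snd (h i)" "fst (h j)" "snd (h j)"] hD ij by auto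
        moreover have "interior (snd (h k)) = {?I (h k)<..<?S (h k)}" if "k < card D1" for k
          using K[of "fst (h k)" "snd (h k)"] hD[OF that] interior_atLeastAtMost_real by metis
        ultimately show ?thesis using ij by metis
      qed
      have le: "\<forall>i<card D1. a \<le> ?I (h i) \<and> ?I (h i) \<le> ?S (h i) \<and> ?S (h i) \<le> b"
        using K hD by (meson order.trans)
      have "(\<Sum>i<card D1. ?S (h i) - ?I (h i)) = (\<Sum>i<card D1. measure lebesgue {?I (h i)<..<?S (h i)})"
        by (rule sum.cong) (use le in auto)
      also have "\<dots> = measure lebesgue (\<Union>i<card D1. {?I (h i)<..<?S (h i)})"
        by (rule measure_finite_Union[symmetric]) (use disj le in \<open>auto simp: disjoint_family_on_def\<close>)
      also have "\<dots> \<le> measure lebesgue G"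
      proof (rule measure_mono_fmeasurable[OF _ _ Gm])
        show "(\<Union>i<card D1. {?I (h i)<..<?S (h i)}) \<subseteq> G"
        proof clarify
          fix r i assume i: "i < card D1" and r: "r \<in> {?I (h i)<..<?S (h i)}"
          have "snd (h i) \<subseteq> G" using K hD[OF i] d(2) by (meson order.trans)
          moreover have "r \<in> snd (h i)" using r K[of "fst (h i)" "snd (h i)"] hD[OF i]
            by (metis atLeastAtMost_iff greaterThanLessThan_iff less_imp_le)
          ultimately show "r \<in> G" by blast
        qed
      qed auto
      also note mG
      finally have "(\<Sum>i<card D1. dist (x (?I (h i))) (x (?S (h i)))) < e / 2"
        using \<delta>[of "card D1" "\<lambda>i. ?I (h i)" "\<lambda>i. ?S (h i)"] le disj by blast
      then have bad0: "(\<Sum>p\<in>D1. dist (x (?I p)) (x (?S p))) < e / 2"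
        using sum.reindex_bij_betw[OF h, of "\<lambda>p. dist (x (?I p)) (x (?S p))"] by simp
      have "norm (sum ?h D1) \<le> (\<Sum>p\<in>D1. dist (x (?I p)) (x (?S p)))"
        by (rule sum_norm_le) (auto simp: D1_def g'_def dist_norm norm_minus_commute)
      with bad0 have "norm (sum ?h D1) < e / 2" by simp
      with good show "norm ((\<Sum>(x, k)\<in>\<D>. measure lborel k *\<^sub>R g' x) - (x b - x a)) < e"
        unfolding sumD split using norm_triangle_ineq[of "sum ?h (\<D> - D1)" "sum ?h D1"] by simp
    qed
  qed
  then show ?thesis
    by (rule has_integral_spike[OF negN, rotated]) (auto simp: g'_def)
qed

lemma abs_continuous_primitive_on:
  fixes x :: "real \<Rightarrow> 'a::euclidean_space"
  assumes ac: "abs_continuous_on a b x"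
    and der: "AE t in lebesgue_on {a..b}. (x has_vector_derivative g t) (at t within {a..b})"
  shows "primitive_on a b g x"
  unfolding primitive_on_def
proof (intro allI impI, elim conjE)
  fix s t assume st: "a \<le> s" "s \<le> t" "t \<le> b"
  show "(g has_integral x t - x s) {s..t}"
  proof (rule abs_continuous_has_integral[OF st(2)])
    show "abs_continuous_on s t x" using abs_continuous_on_subinterval[OF ac st(1,3)] .
    have "AE r in lebesgue. r \<in> {a..b} \<longrightarrow> (x has_vector_derivative g r) (at r within {a..b})"
      using der by (subst (asm) AE_restrict_space_iff) auto
    then have "AE r in lebesgue. r \<in> {s..t} \<longrightarrow> (x has_vector_derivative g r) (at r within {s..t})"
      by eventually_elim (use st in \<open>auto intro: has_vector_derivative_within_subset\<close>)
    then show "AE r in lebesgue_on {s..t}. (x has_vector_derivative g r) (at r within {s..t})"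
      by (subst AE_restrict_space_iff) auto
  qed
qed

lemma primitive_onD:
  "primitive_on a b g y \<Longrightarrow> a \<le> s \<Longrightarrow> s \<le> t \<Longrightarrow> t \<le> b \<Longrightarrow> (g has_integral (y t - y s)) {s..t}"
  unfolding primitive_on_def by blast

lemma primitive_on_subinterval:
  "primitive_on a b g y \<Longrightarrow> a \<le> s \<Longrightarrow> t \<le> b \<Longrightarrow> primitive_on s t g y"
  unfolding primitive_on_def by auto

lemma primitive_on_cong_except_end:
  assumes "primitive_on a b g y" "\<And>r. a \<le> r \<Longrightarrow> r < b \<Longrightarrow> h r = g r"
  shows "primitive_on a b h y"
  unfolding primitive_on_def
proof (intro allI impI, elim conjE)
  fix s t assume "a \<le> s" "s \<le> t" "t \<le> b"
  then show "(h has_integral y t - y s) {s..t}"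
    using assms by (intro has_integral_spike_finite[of "{b}" _ h g]) (auto intro: primitive_onD)
qed

lemma primitive_on_continuous:
  assumes "primitive_on a b g y"
  shows "continuous_on {a..b} y"
proof (cases "a \<le> b")
  case True
  have g: "g integrable_on {a..b}" using primitive_onD[OF assms order_refl True order_refl] by blast
  have "continuous_on {a..b} (\<lambda>t. integral {a..t} g + y a)"
    by (intro continuous_intros indefinite_integral_continuous_1 g)
  moreover have "integral {a..t} g + y a = y t" if "t \<in> {a..b}" for t
    using primitive_onD[OF assms order_refl, of t] that by (auto dest: integral_unique)
  ultimately show ?thesis by (metis (no_types, lifting) continuous_on_cong)
qed auto

lemma primitive_on_norm_diff_le:
  assumes "primitive_on a b g y" "\<And>r. r \<in> {s..t} \<Longrightarrow> norm (g r) \<le> C" "a \<le> s" "s \<le> t" "t \<le> b"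
  shows "norm (y t - y s) \<le> C * (t - s)"
proof -
  have "norm (y t - y s) \<le> C * measure lborel (cbox s t)"
  proof (rule has_integral_bound)
    show "0 \<le> C" using assms(2)[of s] assms(4) norm_ge_zero order_trans by (metis atLeastAtMost_iff order_refl)
    show "(g has_integral y t - y s) (cbox s t)" using primitive_onD[OF assms(1,3-5)] by simp
  qed (use assms in auto)
  then show ?thesis using assms(4) by (simp add: content_real)
qed

text \<open>The function \<open>exp (- B (r - a)) (A + B \<integral>\<phi>)\<close> is nonincreasing.\<close>

lemma gronwall:
  fixes \<phi> :: "real \<Rightarrow> real"
  assumes cont: "continuous_on {a..b} \<phi>"
    and le: "\<And>t. t \<in> {a..b} \<Longrightarrow> \<phi> t \<le> A + B * integral {a..t} \<phi>"
    and "0 \<le> B" "t \<in> {a..b}"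
  shows "\<phi> t \<le> A * exp (B * (t - a))"
proof -
  define G where "G r = A + B * integral {a..r} \<phi>" for r
  define h where "h r = - exp (- B * (r - a)) * G r" for r
  have "((\<lambda>r. exp (- B * (r - a)) * B * (G r - \<phi> r)) has_integral (h t - h a)) {a..t}"
  proof (rule fundamental_theorem_of_calculus)
    show "a \<le> t" using assms by auto
    fix r assume r: "r \<in> {a..t}"
    have "((\<lambda>r. integral {a..r} \<phi>) has_real_derivative \<phi> r) (at r within {a..t})"
      using integral_has_real_derivative[of a t \<phi> r] r assms(4) continuous_on_subset[OF cont, of "{a..t}"] by auto
    then have "(G has_real_derivative B * \<phi> r) (at r within {a..t})"
      unfolding G_def by (auto intro!: derivative_eq_intros)
    then have "(h has_real_derivative (exp (- B * (r - a)) * B * (G r - \<phi> r))) (at r within {a..t})"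
      unfolding h_def by (auto intro!: derivative_eq_intros simp: algebra_simps)
    then show "(h has_vector_derivative (exp (- B * (r - a)) * B * (G r - \<phi> r))) (at r within {a..t})"
      by (simp add: has_real_derivative_iff_has_vector_derivative)
  qed
  then have "0 \<le> h t - h a"
    by (rule has_integral_nonneg) (use le assms in \<open>auto simp: G_def intro!: mult_nonneg_nonneg\<close>)
  then have "exp (- (B * (t - a))) * G t \<le> A" by (simp add: h_def G_def)
  then have "exp (B * (t - a)) * (exp (- (B * (t - a))) * G t) \<le> exp (B * (t - a)) * A"
    by (rule mult_left_mono) simp
  then have "G t \<le> A * exp (B * (t - a))"
    by (simp only: mult.assoc[symmetric] mult_exp_exp) (simp add: mult.commute)
  with le[OF assms(4)] show ?thesis by (simp add: G_def)
qed

text \<open>The form in which Gronwall's inequality is applied throughout: two curves whose velocities differ by at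
most \<open>A\<close> plus a Lipschitz term.\<close>

lemma gronwall_difference:
  fixes y0 y1 :: "real \<Rightarrow> 'a::euclidean_space"
  assumes y0: "primitive_on a b g0 y0" and y1: "primitive_on a b g1 y1"
    and le: "\<And>r. r \<in> {a..b} \<Longrightarrow> norm (g0 r - g1 r) \<le> A + B * norm (y0 r - y1 r)"
    and "0 \<le> A" "0 \<le> B" "t \<in> {a..b}"
  shows "norm (y0 t - y1 t) \<le> (norm (y0 a - y1 a) + A * (b - a)) * exp (B * (b - a))"
proof -
  let ?\<phi> = "\<lambda>r. norm (y0 r - y1 r)"
  have cont: "continuous_on {a..b} ?\<phi>"
    by (intro continuous_intros primitive_on_continuous[OF y0] primitive_on_continuous[OF y1])
  have "?\<phi> t \<le> (?\<phi> a + A * (b - a)) * exp (B * (t - a))"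
  proof (rule gronwall[OF cont _ \<open>0 \<le> B\<close> \<open>t \<in> {a..b}\<close>])
    fix s assume s: "s \<in> {a..b}"
    have int: "?\<phi> integrable_on {a..s}"
      by (rule integrable_continuous_real) (rule continuous_on_subset[OF cont], use s in auto)
    have d: "((\<lambda>r. g0 r - g1 r) has_integral ((y0 s - y0 a) - (y1 s - y1 a))) {a..s}"
      by (intro has_integral_diff primitive_onD[OF y0] primitive_onD[OF y1]) (use s in auto)
    have "norm (integral {a..s} (\<lambda>r. g0 r - g1 r)) \<le> integral {a..s} (\<lambda>r. A + B * ?\<phi> r)"
    proof (rule integral_norm_bound_integral)
      show "(\<lambda>r. g0 r - g1 r) integrable_on {a..s}" using d by blast
      show "(\<lambda>r. A + B * ?\<phi> r) integrable_on {a..s}"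
        using integrable_add[OF integrable_const_ivl[of A a s] integrable_cmul[OF int, of B]] by simp
    qed (use le s in auto)
    also have "\<dots> = A * (s - a) + B * integral {a..s} ?\<phi>"
      using s int integrable_cmul[OF int, of B] by (subst integral_add) auto
    also have "A * (s - a) \<le> A * (b - a)" using s \<open>0 \<le> A\<close> by (intro mult_left_mono) auto
    finally have "norm ((y0 s - y0 a) - (y1 s - y1 a)) \<le> A * (b - a) + B * integral {a..s} ?\<phi>"
      using integral_unique[OF d] by simp
    moreover have "y0 s - y1 s = (y0 a - y1 a) + ((y0 s - y0 a) - (y1 s - y1 a))" by simp
    ultimately show "?\<phi> s \<le> ?\<phi> a + A * (b - a) + B * integral {a..s} ?\<phi>"
      by (smt (verit) norm_triangle_ineq)
  qed
  also have "\<dots> \<le> (?\<phi> a + A * (b - a)) * exp (B * (b - a))"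
    using assms by (intro mult_left_mono) (auto intro!: mult_left_mono add_nonneg_nonneg mult_nonneg_nonneg)
  finally show ?thesis .
qed

lemma primitive_on_reflect:
  assumes "primitive_on a b g y"
  shows "primitive_on (- b) (- a) (\<lambda>r. - g (- r)) (\<lambda>r. y (- r))"
  unfolding primitive_on_def
proof (intro allI impI, elim conjE)
  fix s t assume "- b \<le> s" "s \<le> t" "t \<le> - a"
  then have "(g has_integral (y (- s) - y (- t))) {- t..- s}"
    by (intro primitive_onD[OF assms]) auto
  then have "((\<lambda>r. g (- r)) has_integral (y (- s) - y (- t))) {s..t}"
    using has_integral_reflect_real[of g "y (- s) - y (- t)" "- s" "- t"] by simp
  from has_integral_neg[OF this] show "((\<lambda>r. - g (- r)) has_integral y (- t) - y (- s)) {s..t}" by simp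
qed

lemma gronwall_difference_backward:
  fixes y0 y1 :: "real \<Rightarrow> 'a::euclidean_space"
  assumes y0: "primitive_on a b g0 y0" and y1: "primitive_on a b g1 y1" and "a \<le> b"
    and le: "\<And>r. r \<in> {a..b} \<Longrightarrow> norm (g0 r - g1 r) \<le> B * norm (y0 r - y1 r)" and "0 \<le> B"
  shows "norm (y0 a - y1 a) \<le> norm (y0 b - y1 b) * exp (B * (b - a))"
  using gronwall_difference[OF primitive_on_reflect[OF y0] primitive_on_reflect[OF y1], of 0 B "- a"] assms
  by (simp add: norm_minus_commute)

text \<open>Estimates that are available only as long as \<open>\<phi> \<le> c\<close> hold for all times if they improve the bound to
\<open>\<phi> < c\<close>: at the first time with \<open>\<phi> \<ge> c\<close> there would be a contradiction.\<close>

lemma first_exit: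
  fixes \<phi> :: "real \<Rightarrow> real"
  assumes cont: "continuous_on {a..b} \<phi>"
    and step: "\<And>t. t \<in> {a..b} \<Longrightarrow> (\<And>r. r \<in> {a..t} \<Longrightarrow> \<phi> r \<le> c) \<Longrightarrow> \<phi> t < c"
    and "\<phi> a < c" "t \<in> {a..b}"
  shows "\<phi> t < c"
proof (rule ccontr)
  assume "\<not> \<phi> t < c"
  define S where "S = {r\<in>{a..b}. c \<le> \<phi> r}"
  have "closed S" unfolding S_def
    using continuous_closed_preimage[OF cont, of "{c..}"] by (simp add: vimage_def Int_def)
  moreover have "bounded S" by (rule bounded_subset[of "{a..b}"]) (auto simp: S_def)
  ultimately have "compact S" by (simp add: compact_eq_bounded_closed)
  moreover have "S \<noteq> {}" using \<open>\<not> \<phi> t < c\<close> assms(4) by (auto simp: S_def)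
  ultimately obtain m where m: "m \<in> S" "\<And>r. r \<in> S \<Longrightarrow> m \<le> r"
    using compact_attains_inf by metis
  have mab: "m \<in> {a..b}" "c \<le> \<phi> m" using m by (auto simp: S_def)
  have "a < m" using mab \<open>\<phi> a < c\<close> by (metis atLeastAtMost_iff linorder_not_less order_le_less)
  have less: "\<phi> r < c" if "r \<in> {a..<m}" for r
    using m(2)[of r] that mab by (force simp: S_def)
  have "\<phi> m \<le> c"
    using continuous_le_on_closure[of "{a..<m}" \<phi> m c] \<open>a < m\<close> mab less
      continuous_on_subset[OF cont, of "{a..m}"] by (auto simp: less_imp_le)
  then have "\<phi> m < c" using step[OF mab(1)] less by (metis atLeastAtMost_iff atLeastLessThan_iff less_eq_real_def)
  with mab show False by simp
qed

section \<open>Controlled flows\<close>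

text \<open>The setting for trajectories, costs and dynamic programming; the semiconcavity conditions are added in an
extension of this locale.\<close>

locale control_system =
  fixes t0 T :: real
    and U :: "(real^'m) set"
    and f :: "real^'n \<Rightarrow> real^'m \<Rightarrow> real \<Rightarrow> real^'n"
    and F :: "real^'n \<Rightarrow> real^'m \<Rightarrow> real \<Rightarrow> real"
    and L :: "real \<Rightarrow> real"
  assumes t0_less_T: "t0 < T"
    and U_nonempty: "U \<noteq> {}"
    and compact_U: "compact U"
    and trajectory_exists: "\<And>x0 \<tau> u. \<tau> \<in> {t0..T} \<Longrightarrow> u \<in> admissible_controls U T \<tau> \<Longrightarrow>
          \<exists>x. trajectory f T x0 \<tau> u x"
    and continuous_f: "continuous_on (UNIV \<times> U \<times> {t0..T}) (\<lambda>(x, u, t). f x u t)"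
    and continuous_F: "continuous_on (UNIV \<times> U \<times> {t0..T}) (\<lambda>(x, u, t). F x u t)"
    and L_nonneg: "\<And>R. R \<ge> 0 \<Longrightarrow> 0 \<le> L R"
    and lipschitz: "\<And>R x y t s u. R > 0 \<Longrightarrow> norm x < R \<Longrightarrow> norm y < R \<Longrightarrow> t \<in> {t0..T} \<Longrightarrow> s \<in> {t0..T} \<Longrightarrow> u \<in> U \<Longrightarrow>
             norm (f x u t - f y u s) \<le> L R * (\<bar>t - s\<bar> + norm (x - y)) \<and>
             \<bar>F x u t - F y u s\<bar> \<le> L R * (\<bar>t - s\<bar> + norm (x - y))"
begin

text \<open>Controls are taken on the whole real line, so that they can be restarted, concatenated and stretched
without regard to the initial time; \<open>costs_eq\<close> shows that this does not change the set of costs.\<close>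

definition controls :: "(real \<Rightarrow> real^'m) set" where
  "controls = {u. u \<in> borel_measurable lebesgue \<and> (\<forall>t. u t \<in> U)}"

definition flow :: "real \<Rightarrow> (real \<Rightarrow> real^'m) \<Rightarrow> real^'n \<Rightarrow> real \<Rightarrow> real^'n" where
  "flow \<tau> u x0 = (SOME x. trajectory f T x0 \<tau> u x)"

abbreviation solves :: "real \<Rightarrow> real \<Rightarrow> (real \<Rightarrow> real^'m) \<Rightarrow> (real \<Rightarrow> real^'n) \<Rightarrow> bool" where
  "solves a b u x \<equiv> primitive_on a b (\<lambda>r. f (x r) (u r) r) x"

text \<open>A Lipschitz constant on the closed ball of radius \<open>R\<close>; the hypotheses give constants on open balls.\<close>

definition lip :: "real \<Rightarrow> real" where "lip R = L (R + 1)"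

text \<open>The factor by which distances between trajectories inside the ball of radius \<open>R\<close> can change over the
whole time interval, forwards or backwards.\<close>

definition growth :: "real \<Rightarrow> real" where "growth R = exp (lip R * (T - t0))"

lemma controlsD: "u \<in> controls \<Longrightarrow> u t \<in> U" "u \<in> controls \<Longrightarrow> u \<in> borel_measurable lebesgue"
  by (auto simp: controls_def)

lemma const_control: "v \<in> U \<Longrightarrow> (\<lambda>_. v) \<in> controls"
  by (simp add: controls_def)

lemma controls_admissible: "u \<in> controls \<Longrightarrow> u \<in> admissible_controls U T \<tau>"
  by (auto simp: controls_def admissible_controls_def intro: measurable_restrict_space1)

lemma lip_nonneg: "R \<ge> 0 \<Longrightarrow> 0 \<le> lip R"
  by (simp add: lip_def L_nonneg)

lemma lip_f:
  assumes "norm x \<le> R" "norm y \<le> R" "t \<in> {t0..T}" "s \<in> {t0..T}" "u \<in> U"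
  shows "norm (f x u t - f y u s) \<le> lip R * (\<bar>t - s\<bar> + norm (x - y))"
  unfolding lip_def using assms norm_ge_zero[of x] by (intro lipschitz[THEN conjunct1]) linarith+

lemma lip_F:
  assumes "norm x \<le> R" "norm y \<le> R" "t \<in> {t0..T}" "s \<in> {t0..T}" "u \<in> U"
  shows "\<bar>F x u t - F y u s\<bar> \<le> lip R * (\<bar>t - s\<bar> + norm (x - y))"
  unfolding lip_def using assms norm_ge_zero[of x] by (intro lipschitz[THEN conjunct2]) linarith+

lemma data_bounded:
  obtains C where "C > 0"
    "\<And>x u t. norm x \<le> R \<Longrightarrow> u \<in> U \<Longrightarrow> t \<in> {t0..T} \<Longrightarrow> norm (f x u t) \<le> C \<and> \<bar>F x u t\<bar> \<le> C"
proof -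
  let ?S = "cball (0 :: real^'n) R \<times> U \<times> {t0..T}"
  have S: "compact ?S" by (intro compact_Times compact_cball compact_U compact_Icc)
  have "bounded ((\<lambda>(x, u, t). f x u t) ` ?S)" "bounded ((\<lambda>(x, u, t). F x u t) ` ?S)"
    by (intro compact_imp_bounded compact_continuous_image S
        continuous_on_subset[OF continuous_f] continuous_on_subset[OF continuous_F], auto)+
  then obtain B1 B2 where "B1 > 0" "\<And>z. z \<in> ?S \<Longrightarrow> norm ((\<lambda>(x, u, t). f x u t) z) \<le> B1"
    and "\<And>z. z \<in> ?S \<Longrightarrow> norm ((\<lambda>(x, u, t). F x u t) z) \<le> B2"
    unfolding bounded_pos by (metis (no_types, lifting) image_eqI)
  then show thesis
    by (intro that[of "max B1 B2"]) (force simp: le_max_iff_disj)+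
qed

lemma flow_trajectory:
  "\<tau> \<in> {t0..T} \<Longrightarrow> u \<in> controls \<Longrightarrow> trajectory f T x0 \<tau> u (flow \<tau> u x0)"
  unfolding flow_def using trajectory_exists controls_admissible by (metis someI_ex)

lemma trajectory_solves: "trajectory f T x0 \<tau> u x \<Longrightarrow> solves \<tau> T u x"
  unfolding trajectory_def by (auto intro: abs_continuous_primitive_on)

lemma flow_start: "\<tau> \<in> {t0..T} \<Longrightarrow> u \<in> controls \<Longrightarrow> flow \<tau> u x0 \<tau> = x0"
  using flow_trajectory unfolding trajectory_def by blast

lemma flow_solves:
  "\<tau> \<in> {t0..T} \<Longrightarrow> u \<in> controls \<Longrightarrow> \<tau> \<le> a \<Longrightarrow> b \<le> T \<Longrightarrow> solves a b u (flow \<tau> u x0)"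
  using trajectory_solves[OF flow_trajectory] by (meson primitive_on_subinterval)

lemma flow_continuous:
  "\<tau> \<in> {t0..T} \<Longrightarrow> u \<in> controls \<Longrightarrow> continuous_on {\<tau>..T} (flow \<tau> u x0)"
  using flow_solves[of \<tau> u \<tau> T] by (auto intro: primitive_on_continuous)

lemma growth_ge: "0 \<le> B \<Longrightarrow> B \<le> lip R \<Longrightarrow> t0 \<le> a \<Longrightarrow> b \<le> T \<Longrightarrow> a \<le> b \<Longrightarrow> exp (B * (b - a)) \<le> growth R"
  unfolding growth_def by (auto intro!: mult_mono)

lemma growth_ge_1: "R \<ge> 0 \<Longrightarrow> 1 \<le> growth R"
  unfolding growth_def using lip_nonneg t0_less_T by simp

lemma solutions_forward:
  assumes x: "solves a b u x" and y: "solves a b u y" and ab: "t0 \<le> a" "b \<le> T" and u: "\<And>r. u r \<in> U"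
    and R: "\<And>r. r \<in> {a..b} \<Longrightarrow> norm (x r) \<le> R" "\<And>r. r \<in> {a..b} \<Longrightarrow> norm (y r) \<le> R" and t: "t \<in> {a..b}"
  shows "norm (x t - y t) \<le> norm (x a - y a) * growth R"
proof -
  have "0 \<le> R" using R(1)[OF t] norm_ge_zero order_trans by blast
  have "norm (x t - y t) \<le> (norm (x a - y a) + 0 * (b - a)) * exp (lip R * (b - a))"
  proof (rule gronwall_difference[OF x y _ _ lip_nonneg[OF \<open>0 \<le> R\<close>] t])
    fix r assume r: "r \<in> {a..b}"
    then show "norm (f (x r) (u r) r - f (y r) (u r) r) \<le> 0 + lip R * norm (x r - y r)"
      using lip_f[OF R(1)[OF r] R(2)[OF r], of r r "u r"] u ab by auto
  qed simp
  also have "\<dots> \<le> norm (x a - y a) * growth R"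
    using growth_ge[OF lip_nonneg[OF \<open>0 \<le> R\<close>], of R a b] ab t by (auto intro!: mult_left_mono)
  finally show ?thesis .
qed

lemma solutions_backward:
  assumes x: "solves a b u x" and y: "solves a b u y" and ab: "t0 \<le> a" "b \<le> T" "a \<le> b" and u: "\<And>r. u r \<in> U"
    and R: "\<And>r. r \<in> {a..b} \<Longrightarrow> norm (x r) \<le> R" "\<And>r. r \<in> {a..b} \<Longrightarrow> norm (y r) \<le> R"
  shows "norm (x a - y a) \<le> norm (x b - y b) * growth R"
proof -
  have "0 \<le> R" using R(1)[of a] ab norm_ge_zero order_trans by (metis atLeastAtMost_iff order_refl)
  have "norm (x a - y a) \<le> norm (x b - y b) * exp (lip R * (b - a))"
  proof (rule gronwall_difference_backward[OF x y ab(3) _ lip_nonneg[OF \<open>0 \<le> R\<close>]])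
    fix r assume r: "r \<in> {a..b}"
    then show "norm (f (x r) (u r) r - f (y r) (u r) r) \<le> lip R * norm (x r - y r)"
      using lip_f[OF R(1)[OF r] R(2)[OF r], of r r "u r"] u ab by auto
  qed
  also have "\<dots> \<le> norm (x b - y b) * growth R"
    using growth_ge[OF lip_nonneg[OF \<open>0 \<le> R\<close>], of R a b] ab by (auto intro!: mult_left_mono)
  finally show ?thesis .
qed

lemma bounded_on_Icc:
  fixes x :: "real \<Rightarrow> 'b::real_normed_vector"
  assumes "continuous_on {a..b::real} x"
  obtains R where "R \<ge> 0" "\<And>r. r \<in> {a..b} \<Longrightarrow> norm (x r) \<le> R"
proof -
  have "bounded (x ` {a..b})"
    using assms by (intro compact_imp_bounded compact_continuous_image) auto
  then obtain B where "B > 0" "\<forall>z\<in>x ` {a..b}. norm z \<le> B" unfolding bounded_pos by blast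
  then show thesis by (intro that[of B]) auto
qed

lemma solution_unique:
  assumes x: "solves a b u x" and y: "solves a b u y" and ab: "t0 \<le> a" "b \<le> T" and u: "\<And>r. u r \<in> U"
    and "x a = y a" "t \<in> {a..b}"
  shows "x t = y t"
proof -
  obtain R1 where R1: "R1 \<ge> 0" "\<And>r. r \<in> {a..b} \<Longrightarrow> norm (x r) \<le> R1"
    using bounded_on_Icc[OF primitive_on_continuous[OF x]] by blast
  obtain R2 where R2: "R2 \<ge> 0" "\<And>r. r \<in> {a..b} \<Longrightarrow> norm (y r) \<le> R2"
    using bounded_on_Icc[OF primitive_on_continuous[OF y]] by blast
  have "norm (x t - y t) \<le> norm (x a - y a) * growth (max R1 R2)"
    by (rule solutions_forward[OF x y ab u _ _ \<open>t \<in> {a..b}\<close>]) (use R1 R2 in \<open>auto simp: le_max_iff_disj\<close>)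
  then show ?thesis using assms by simp
qed

lemma flow_eqI:
  assumes "\<tau> \<in> {t0..T}" "u \<in> controls" "solves \<tau> b u y" "y \<tau> = x0" "t \<in> {\<tau>..b}" "b \<le> T"
  shows "y t = flow \<tau> u x0 t"
  using solution_unique[OF assms(3) flow_solves[OF assms(1,2), of \<tau> b x0] _ _ _ _ assms(5)]
    assms flow_start controlsD by auto

lemma flow_restart:
  assumes "\<tau> \<in> {t0..T}" "u \<in> controls" "\<tau> \<le> s" "s \<le> t" "t \<le> T"
  shows "flow s u (flow \<tau> u x0 s) t = flow \<tau> u x0 t"
  by (rule sym, rule flow_eqI[where b = T])
    (use assms in \<open>auto intro!: flow_solves\<close>)

lemma flow_cong:
  assumes "\<tau> \<in> {t0..T}" "u \<in> controls" "v \<in> controls" "\<And>r. \<tau> \<le> r \<Longrightarrow> r < b \<Longrightarrow> u r = v r"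
    "t \<in> {\<tau>..b}" "b \<le> T"
  shows "flow \<tau> u x0 t = flow \<tau> v x0 t"
proof (rule flow_eqI[OF assms(1,3) _ _ assms(5,6)])
  show "solves \<tau> b v (flow \<tau> u x0)"
    by (rule primitive_on_cong_except_end[OF flow_solves[OF assms(1,2) order_refl assms(6)]])
      (use assms(4) in auto)
qed (use assms flow_start in auto)

text \<open>The Lipschitz constant on the larger ball may be used as long as the two trajectories are at distance
at most \<open>1\<close>, and the resulting estimate keeps them closer than that.\<close>

lemma flow_near:
  assumes s: "s \<in> {t0..T}" and u: "u \<in> controls" and tT: "t \<le> T"
    and R: "\<And>r. r \<in> {s..t} \<Longrightarrow> norm (flow s u x r) \<le> R"
    and close: "norm (y - x) * growth (R + 1) < 1" and r: "r \<in> {s..t}"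
  shows "norm (flow s u y r - flow s u x r) \<le> norm (y - x) * growth (R + 1)"
    and "norm (flow s u y r) \<le> R + 1"
proof -
  have "0 \<le> R" using R[OF r] norm_ge_zero order_trans by blast
  let ?\<phi> = "\<lambda>r. norm (flow s u y r - flow s u x r)"
  have est: "?\<phi> t' \<le> norm (y - x) * growth (R + 1)"
    if t': "t' \<in> {s..t}" and le: "\<And>r. r \<in> {s..t'} \<Longrightarrow> ?\<phi> r \<le> 1" for t'
  proof -
    have "?\<phi> t' \<le> norm (flow s u y s - flow s u x s) * growth (R + 1)"
    proof (rule solutions_forward[where b = t' and u = u])
      show "solves s t' u (flow s u y)" "solves s t' u (flow s u x)"
        using t' tT by (auto intro: flow_solves[OF s u])
      fix r assume r: "r \<in> {s..t'}"
      show "norm (flow s u x r) \<le> R + 1" using R[of r] r t' by auto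
      have "norm (flow s u y r) \<le> norm (flow s u x r) + ?\<phi> r"
        by (metis add_diff_cancel_left' diff_add_cancel norm_triangle_ineq)
      then show "norm (flow s u y r) \<le> R + 1" using R[of r] le[OF r] r t' by auto
    qed (use s t' tT controlsD[OF u] in auto)
    then show ?thesis by (simp add: flow_start[OF s u])
  qed
  have small: "?\<phi> r < 1" if r: "r \<in> {s..t}" for r
  proof (rule first_exit[OF _ _ _ r])
    show "continuous_on {s..t} ?\<phi>"
      using tT by (intro continuous_intros continuous_on_subset[OF flow_continuous[OF s u]]) auto
    show "?\<phi> t' < 1" if "t' \<in> {s..t}" "\<And>r. r \<in> {s..t'} \<Longrightarrow> ?\<phi> r \<le> 1" for t'
      using est[OF that] close by simp
    have "norm (y - x) * 1 \<le> norm (y - x) * growth (R + 1)"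
      using growth_ge_1[of "R + 1"] \<open>0 \<le> R\<close> by (intro mult_left_mono) auto
    then show "?\<phi> s < 1" using close by (simp add: flow_start[OF s u])
  qed
  show "?\<phi> r \<le> norm (y - x) * growth (R + 1)"
    using est[OF r] small r by (smt (verit) atLeastAtMost_iff)
  have "norm (flow s u y r) \<le> norm (flow s u x r) + ?\<phi> r"
    by (metis add_diff_cancel_left' diff_add_cancel norm_triangle_ineq)
  then show "norm (flow s u y r) \<le> R + 1" using R[OF r] small[OF r] by simp
qed

text \<open>The speed is at most \<open>C\<close> as long as the trajectory stays in the larger ball, so it cannot cover the
distance \<open>1\<close> to the boundary in time less than \<open>1 / C\<close>.\<close>

lemma flow_short_time:
  assumes s: "s \<in> {t0..T}" and u: "u \<in> controls" and tT: "t \<le> T" and x: "norm x \<le> N"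
    and C: "\<And>x u t. norm x \<le> N + 1 \<Longrightarrow> u \<in> U \<Longrightarrow> t \<in> {t0..T} \<Longrightarrow> norm (f x u t) \<le> C"
    and short: "(t - s) * C < 1" and r: "r \<in> {s..t}"
  shows "norm (flow s u x r) \<le> N + 1"
proof -
  have "0 \<le> N" using x norm_ge_zero order_trans by blast
  have "C \<ge> 0"
    using C[of 0 "u s" s] \<open>0 \<le> N\<close> controlsD[OF u] s norm_ge_zero order_trans by (metis add_nonneg_nonneg norm_zero zero_le_one)
  let ?\<phi> = "\<lambda>r. norm (flow s u x r - x)"
  have tri: "norm (flow s u x r) \<le> N + ?\<phi> r" for r
    using norm_triangle_ineq[of x "flow s u x r - x"] x by simp
  have "?\<phi> r < 1"
  proof (rule first_exit[OF _ _ _ r])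
    show "continuous_on {s..t} ?\<phi>"
      using tT by (intro continuous_intros continuous_on_subset[OF flow_continuous[OF s u]]) auto
    show "?\<phi> s < 1" by (simp add: flow_start[OF s u])
    show "?\<phi> t' < 1" if t': "t' \<in> {s..t}" and le: "\<And>r. r \<in> {s..t'} \<Longrightarrow> ?\<phi> r \<le> 1" for t'
    proof -
      have "norm (flow s u x t' - flow s u x s) \<le> C * (t' - s)"
      proof (rule primitive_on_norm_diff_le[OF flow_solves[OF s u order_refl tT]])
        fix r assume r: "r \<in> {s..t'}"
        show "norm (f (flow s u x r) (u r) r) \<le> C"
          using tri[of r] le[OF r] r t' s tT controlsD[OF u] by (intro C) auto
      qed (use t' in auto)
      also have "\<dots> \<le> (t - s) * C" using t' \<open>C \<ge> 0\<close> by (simp add: mult.commute mult_left_mono)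
      finally show ?thesis using short by (simp add: flow_start[OF s u])
    qed
  qed
  then show ?thesis using tri[of r] by simp
qed

section \<open>Reachable sets are bounded\<close>

definition bounded_reach :: "real^'n \<Rightarrow> real \<Rightarrow> real \<Rightarrow> bool" where
  "bounded_reach x s t \<longleftrightarrow> (\<exists>R. \<forall>u\<in>controls. \<forall>r\<in>{s..t}. norm (flow s u x r) \<le> R)"

text \<open>Boundedness of reachable sets is an open condition on the initial point, with a common bound nearby. This makes the
compactness arguments below possible.\<close>

lemma bounded_reach_near:
  assumes s: "s \<in> {t0..T}" and tT: "t \<le> T" and "bounded_reach x s t"
  obtains R \<eta> where "\<eta> > 0"
    "\<And>y u r. norm (y - x) \<le> \<eta> \<Longrightarrow> u \<in> controls \<Longrightarrow> r \<in> {s..t} \<Longrightarrow> norm (flow s u y r) \<le> R"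
proof -
  obtain R where R: "\<And>u r. u \<in> controls \<Longrightarrow> r \<in> {s..t} \<Longrightarrow> norm (flow s u x r) \<le> R"
    using assms(3) unfolding bounded_reach_def by blast
  define \<eta> where "\<eta> = 1 / (2 * growth (R + 1))"
  have g: "growth (R + 1) > 0" by (simp add: growth_def)
  show thesis
  proof (rule that)
    show "\<eta> > 0" using g by (simp add: \<eta>_def)
    fix y u r assume y: "norm (y - x) \<le> \<eta>" and u: "u \<in> controls" and r: "r \<in> {s..t}"
    have "norm (y - x) * growth (R + 1) \<le> \<eta> * growth (R + 1)" using y g by (intro mult_right_mono) auto
    also have "\<dots> < 1" using g by (simp add: \<eta>_def)
    finally show "norm (flow s u y r) \<le> R + 1"
      using flow_near(2)[OF s u tT R[OF u] _ r] by blast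
  qed
qed

lemma bounded_reach_compact:
  assumes s: "s \<in> {t0..T}" and tT: "t \<le> T" and K: "compact K" "\<And>x. x \<in> K \<Longrightarrow> bounded_reach x s t"
  obtains R where "\<And>x u r. x \<in> K \<Longrightarrow> u \<in> controls \<Longrightarrow> r \<in> {s..t} \<Longrightarrow> norm (flow s u x r) \<le> R"
proof -
  have "\<exists>R \<eta>. \<eta> > 0 \<and> (\<forall>y u r. norm (y - x) \<le> \<eta> \<longrightarrow> u \<in> controls \<longrightarrow> r \<in> {s..t} \<longrightarrow> norm (flow s u y r) \<le> R)"
    if "x \<in> K" for x
    using bounded_reach_near[OF s tT K(2)[OF that]] by metis
  then obtain R \<eta> where R: "\<And>x. x \<in> K \<Longrightarrow> \<eta> x > 0"
    "\<And>x y u r. x \<in> K \<Longrightarrow> norm (y - x) \<le> \<eta> x \<Longrightarrow> u \<in> controls \<Longrightarrow> r \<in> {s..t} \<Longrightarrow> norm (flow s u y r) \<le> R x"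
    by metis
  obtain C where C: "C \<subseteq> K" "finite C" "K \<subseteq> (\<Union>x\<in>C. ball x (\<eta> x))"
    using compactE_image[OF K(1), of K "\<lambda>x. ball x (\<eta> x)"] R(1) by force
  show thesis
  proof (rule that)
    fix x u r assume x: "x \<in> K" and ur: "u \<in> controls" "r \<in> {s..t}"
    then obtain c where c: "c \<in> C" "norm (x - c) \<le> \<eta> c"
      using C(3) by (force simp: dist_norm norm_minus_commute)
    then have "norm (flow s u x r) \<le> R c" using R(2)[of c x u r] C(1) ur by auto
    also have "\<dots> \<le> (\<Sum>c\<in>C. \<bar>R c\<bar>)"
      using member_le_sum[of c C "\<lambda>c. \<bar>R c\<bar>"] c C(2) by auto
    finally show "norm (flow s u x r) \<le> (\<Sum>c\<in>C. \<bar>R c\<bar>)" .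
  qed
qed

lemma bounded_reach_mono:
  "bounded_reach x s t \<Longrightarrow> t' \<le> t \<Longrightarrow> bounded_reach x s t'"
  unfolding bounded_reach_def by (meson atLeastAtMost_iff order_trans)

text \<open>The closure of the set reachable at the intermediate time is needed in order to have a bound that is uniform
over this set.\<close>

lemma bounded_reach_trans:
  assumes s: "s \<in> {t0..T}" and s': "s \<le> s'" "s' \<le> t" "t \<le> T" and x: "bounded_reach x s s'"
    and y: "\<And>y. y \<in> closure ((\<lambda>u. flow s u x s') ` controls) \<Longrightarrow> bounded_reach y s' t"
  shows "bounded_reach x s t"
proof -
  let ?K = "closure ((\<lambda>u. flow s u x s') ` controls)"
  obtain R where R: "\<And>u r. u \<in> controls \<Longrightarrow> r \<in> {s..s'} \<Longrightarrow> norm (flow s u x r) \<le> R"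
    using x unfolding bounded_reach_def by blast
  have "bounded ((\<lambda>u. flow s u x s') ` controls)"
    unfolding bounded_iff using R[of _ s'] s' by (auto intro!: exI[of _ R])
  then have "compact ?K" by simp
  then obtain R' where R': "\<And>x u r. x \<in> ?K \<Longrightarrow> u \<in> controls \<Longrightarrow> r \<in> {s'..t} \<Longrightarrow> norm (flow s' u x r) \<le> R'"
    using bounded_reach_compact[of s' t ?K] y s s' by auto
  show ?thesis unfolding bounded_reach_def
  proof (intro exI ballI)
    fix u r assume u: "u \<in> controls" and r: "r \<in> {s..t}"
    show "norm (flow s u x r) \<le> max R R'"
    proof (cases "r \<le> s'")
      case False
      have "flow s u x s' \<in> ?K" using u closure_subset by fast
      from R'[OF this u, of r] have "norm (flow s' u (flow s u x s') r) \<le> R'" using False r by auto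
      then show ?thesis using flow_restart[OF s u, of s' r] False r s' by (simp add: le_max_iff_disj)
    qed (use R[OF u] r in \<open>auto simp: le_max_iff_disj\<close>)
  qed
qed

text \<open>Divide the remaining time into steps so short that no trajectory leaves the ball of radius \<open>N + 1\<close> when it
starts a step in the ball of radius \<open>N\<close>. The reachable set becomes unbounded during some step, and a
point \<open>y\<close> responsible for this must lie outside the ball of radius \<open>N\<close>.\<close>

lemma unbounded_reach_escape:
  assumes s: "s \<in> {t0..T}" and x: "\<not> bounded_reach x s T"
  obtains s' y where "s' \<in> {s..T}" "bounded_reach x s s'"
    "y \<in> closure ((\<lambda>u. flow s u x s') ` controls)" "\<not> bounded_reach y s' T" "norm y > N"
proof -
  obtain C where C: "C > 0" "\<And>x u t. norm x \<le> N + 1 \<Longrightarrow> u \<in> U \<Longrightarrow> t \<in> {t0..T} \<Longrightarrow> norm (f x u t) \<le> C"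
    using data_bounded by metis
  obtain n :: nat where n: "n > 0" "(T - s) / n * C < 1"
  proof -
    obtain n :: nat where "real n > (T - s) * C" using reals_Archimedean2 by blast
    then show thesis by (intro that[of "Suc n"]) (auto simp: divide_simps)
  qed
  define t where "t i = s + real i * ((T - s) / n)" for i :: nat
  have t0: "t 0 = s" "t n = T" using n by (auto simp: t_def)
  have "bounded_reach x s (t 0)" using s flow_start by (auto simp: t_def bounded_reach_def)
  moreover have "\<not> bounded_reach x s (t n)" using x by (simp add: t0)
  ultimately obtain i where i: "i < n" "bounded_reach x s (t i)" "\<not> bounded_reach x s (t (Suc i))"
    using inc_induct[of 0 n "\<lambda>i. \<not> bounded_reach x s (t i)"] by (metis dec_induct le0 order_less_le_trans)
  have tS: "t (Suc i) - t i = (T - s) / n" by (simp add: t_def algebra_simps add_divide_distrib diff_divide_distrib)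
  have mono: "t i \<le> t j" if "i \<le> j" for i j using that s by (auto simp: t_def intro!: mult_right_mono divide_right_mono)
  have ti: "s \<le> t i" "t i \<le> t (Suc i)" "t (Suc i) \<le> T"
    using mono[of 0 i] mono[of i "Suc i"] mono[of "Suc i" n] i(1) t0 by auto
  obtain y where y: "y \<in> closure ((\<lambda>u. flow s u x (t i)) ` controls)" "\<not> bounded_reach y (t i) (t (Suc i))"
    using bounded_reach_trans[OF s ti i(2)] i(3) by blast
  show thesis
  proof (rule that[OF _ i(2) y(1)])
    show "t i \<in> {s..T}" using ti by auto
    show "\<not> bounded_reach y (t i) T" using y(2) bounded_reach_mono ti by blast
    show "N < norm y"
    proof (rule ccontr)
      assume "\<not> N < norm y"
      then have N: "norm y \<le> N" by simp
      have "\<forall>u\<in>controls. \<forall>r\<in>{t i..t (Suc i)}. norm (flow (t i) u y r) \<le> N + 1"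
        using flow_short_time[of "t i" _ "t (Suc i)" y N C] N C(2) ti s n(2) tS by auto
      then show False using y(2) unfolding bounded_reach_def by blast
    qed
  qed
qed

text \<open>By invariance of domain the image of the open ball is open, and the expansion estimate keeps the image of the
boundary away from \<open>\<Phi> x\<close>. Connectedness of the small ball does the rest.\<close>

lemma open_image_ball_subset:
  fixes \<Phi> :: "real^'n \<Rightarrow> real^'n"
  assumes cont: "continuous_on (cball x \<eta>) \<Phi>" and "\<eta> > 0" "G > 0"
    and expand: "\<And>v w. v \<in> cball x \<eta> \<Longrightarrow> w \<in> cball x \<eta> \<Longrightarrow> norm (v - w) \<le> norm (\<Phi> v - \<Phi> w) * G"
  shows "ball (\<Phi> x) (\<eta> / G) \<subseteq> \<Phi> ` cball x \<eta>"
proof -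
  let ?B = "ball (\<Phi> x) (\<eta> / G)"
  have inj: "inj_on \<Phi> (cball x \<eta>)"
    by (rule inj_onI) (use expand in force)
  have "open (\<Phi> ` ball x \<eta>)"
    by (rule invariance_of_domain) (auto intro: continuous_on_subset[OF cont] inj_on_subset[OF inj])
  moreover have "closed (\<Phi> ` cball x \<eta>)"
    by (intro compact_imp_closed compact_continuous_image cont) simp
  moreover have "\<Phi> ` cball x \<eta> \<inter> ?B \<subseteq> \<Phi> ` ball x \<eta>"
  proof clarify
    fix v assume v: "v \<in> cball x \<eta>" "\<Phi> v \<in> ?B"
    have "norm (x - v) \<le> norm (\<Phi> x - \<Phi> v) * G" using v \<open>\<eta> > 0\<close> by (intro expand) auto
    also have "\<dots> < \<eta> / G * G" using v \<open>G > 0\<close> by (intro mult_strict_right_mono) (auto simp: dist_norm)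
    finally show "\<Phi> v \<in> \<Phi> ` ball x \<eta>" using \<open>G > 0\<close> by (auto simp: dist_norm)
  qed
  moreover have "\<Phi> x \<in> \<Phi> ` ball x \<eta> \<inter> ?B" using \<open>\<eta> > 0\<close> \<open>G > 0\<close> by auto
  moreover have "connected ?B" by simp
  moreover have "\<Phi> ` ball x \<eta> \<subseteq> \<Phi> ` cball x \<eta>" by auto
  ultimately show ?thesis
    using connectedD[of ?B "\<Phi> ` ball x \<eta>" "- (\<Phi> ` cball x \<eta>)"] by blast
qed

text \<open>The point \<open>y\<close> of the previous lemma is only a limit of reachable points. After moving the starting point by at most
\<open>\<eta>\<close>, however, it is reached exactly, and so is every point near it, with one and the same control. The size \<open>\<eta>'\<close> of
this neighbourhood is fixed before the control is chosen; this works since the expansion factor \<open>G\<close> depends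
only on the bound for the set reachable from \<open>x\<close>.\<close>

lemma controlled_escape:
  assumes s: "s \<in> {t0..T}" and x: "\<not> bounded_reach x s T" and "\<eta> > 0"
  obtains s' y \<eta>' u where "s' \<in> {s..T}" "\<not> bounded_reach y s' T" "norm y > N" "0 < \<eta>'" "\<eta>' \<le> 1" "u \<in> controls"
    "\<And>z. z \<in> cball y \<eta>' \<Longrightarrow> \<exists>w\<in>cball x \<eta>. flow s u w s' = z"
proof -
  obtain s' y where s': "s' \<in> {s..T}" "bounded_reach x s s'"
    and y: "y \<in> closure ((\<lambda>u. flow s u x s') ` controls)" "\<not> bounded_reach y s' T" "norm y > N"
    using unbounded_reach_escape[OF s x] by metis
  obtain R where R: "\<And>u r. u \<in> controls \<Longrightarrow> r \<in> {s..s'} \<Longrightarrow> norm (flow s u x r) \<le> R"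
    using s'(2) unfolding bounded_reach_def by blast
  define G where "G = growth (R + 1)"
  have "G > 0" by (simp add: G_def growth_def)
  \<comment> \<open>The bound \<open>1 / (2 G)\<close> keeps all trajectories considered within distance \<open>1\<close> of that from \<open>x\<close>, where \<open>G\<close> is valid.\<close>
  define \<eta>1 where "\<eta>1 = min \<eta> (1 / (2 * G))"
  have \<eta>1: "\<eta>1 > 0" "\<eta>1 \<le> \<eta>" using \<open>\<eta> > 0\<close> \<open>G > 0\<close> by (auto simp: \<eta>1_def)
  have close: "norm (w - x) * G < 1" if "w \<in> cball x \<eta>1" for w
  proof -
    have "norm (w - x) \<le> 1 / (2 * G)" using that by (simp add: \<eta>1_def dist_norm norm_minus_commute)
    then show ?thesis using \<open>G > 0\<close> by (simp add: divide_simps split: if_splits)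
  qed
  define \<eta>' where "\<eta>' = min 1 (\<eta>1 / (2 * G))"
  have \<eta>': "0 < \<eta>'" "\<eta>' \<le> 1" "2 * \<eta>' \<le> \<eta>1 / G" using \<eta>1 \<open>G > 0\<close> by (auto simp: \<eta>'_def min_def divide_simps)
  obtain u where u: "u \<in> controls" "dist (flow s u x s') y < \<eta>'"
    using y(1) \<eta>'(1) unfolding closure_approachable by blast
  have bd: "norm (flow s u w r) \<le> R + 1" if "w \<in> cball x \<eta>1" "r \<in> {s..s'}" for w r
    using flow_near(2)[OF s u(1) _ R[OF u(1)] _ that(2)] close[OF that(1)] s'(1) by (auto simp: G_def)
  have "0 \<le> R" using R[OF u(1), of s] s' norm_ge_zero order_trans by (metis atLeastAtMost_iff order_refl)
  have lipc: "norm (flow s u v s' - flow s u w s') \<le> norm (v - w) * G"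
    "norm (v - w) \<le> norm (flow s u v s' - flow s u w s') * G"
    if "v \<in> cball x \<eta>1" "w \<in> cball x \<eta>1" for v w
    using solutions_forward[of s s' "flow s u v" u "flow s u w" "R + 1" s']
      solutions_backward[of s s' "flow s u v" u "flow s u w" "R + 1"]
      bd that s s'(1) controlsD[OF u(1)] flow_solves[OF s u(1)] flow_start[OF s u(1)]
    by (auto simp: G_def)
  have "ball (flow s u x s') (\<eta>1 / G) \<subseteq> (\<lambda>w. flow s u w s') ` cball x \<eta>1"
  proof (rule open_image_ball_subset[OF _ \<eta>1(1) \<open>G > 0\<close> lipc(2)])
    show "continuous_on (cball x \<eta>1) (\<lambda>w. flow s u w s')"
      by (rule lipschitz_on_continuous_on[of G], rule lipschitz_onI)
        (use lipc(1) \<open>G > 0\<close> in \<open>auto simp: dist_norm mult.commute\<close>)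
  qed
  moreover have "cball y \<eta>' \<subseteq> ball (flow s u x s') (\<eta>1 / G)"
  proof
    fix z assume "z \<in> cball y \<eta>'"
    then have "dist (flow s u x s') z < 2 * \<eta>'"
      using dist_triangle[of "flow s u x s'" z y] u(2) by simp
    then show "z \<in> ball (flow s u x s') (\<eta>1 / G)" using \<eta>'(3) by simp
  qed
  moreover have "cball x \<eta>1 \<subseteq> cball x \<eta>" using \<eta>1(2) by auto
  ultimately have "\<exists>w\<in>cball x \<eta>. flow s u w s' = z" if "z \<in> cball y \<eta>'" for z
    using that by blast
  then show thesis using that s'(1) y(2,3) \<eta>'(1,2) u(1) by blast
qed

text \<open>The control that follows \<open>v 0\<close> up to time \<open>s 0\<close>, then \<open>v 1\<close> up to \<open>s 1\<close>, and so on. At times beyond all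
switching times the index is some arbitrary fixed number.\<close>

lemma switching_control:
  fixes s :: "nat \<Rightarrow> real"
  assumes "\<And>k. v k \<in> controls"
  shows "(\<lambda>r. v (LEAST k. r < s k) r) \<in> controls"
proof -
  have v: "v k \<in> borel_measurable lebesgue" for k using assms controlsD by blast
  have "{r. r < s k} \<in> sets lebesgue" for k
    by (simp add: lessThan_def[symmetric])
  then have "Measurable.pred lebesgue (\<lambda>r. r < s k)" for k by (simp add: pred_def)
  then have "(\<lambda>r. LEAST k. r < s k) \<in> lebesgue \<rightarrow>\<^sub>M count_space UNIV"
    by (rule measurable_Least)
  then have "(\<lambda>r. v (LEAST k. r < s k) r) \<in> borel_measurable lebesgue"
    by (rule measurable_compose_countable[of v, OF v])
  then show ?thesis using assms by (simp add: controls_def)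
qed

lemma flow_continuous_initial:
  assumes s: "s \<in> {t0..T}" and u: "u \<in> controls" and t: "t \<in> {s..T}"
  shows "continuous_on UNIV (\<lambda>x. flow s u x t)"
  unfolding continuous_on_iff
proof (intro ballI allI impI)
  fix x :: "real^'n" and e :: real assume "e > 0"
  obtain R where R: "R \<ge> 0" "\<And>r. r \<in> {s..T} \<Longrightarrow> norm (flow s u x r) \<le> R"
    using bounded_on_Icc[OF flow_continuous[OF s u]] by blast
  let ?G = "growth (R + 1)"
  have G: "?G > 0" by (simp add: growth_def)
  show "\<exists>d>0. \<forall>y\<in>UNIV. dist y x < d \<longrightarrow> dist (flow s u y t) (flow s u x t) < e"
  proof (intro exI conjI ballI impI)
    show "min 1 e / ?G > 0" using G \<open>e > 0\<close> by simp
    fix y assume "dist y x < min 1 e / ?G"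
    then have "norm (y - x) * ?G < min 1 e" using G by (simp add: dist_norm pos_less_divide_eq)
    with flow_near(1)[OF s u order_refl R(2) _ t, of y]
    show "dist (flow s u y t) (flow s u x t) < e" by (simp add: dist_norm)
  qed
qed

text \<open>Iterating \<open>controlled_escape\<close> gives points \<open>x n\<close> of norm greater than \<open>n\<close> and controls that carry a small ball
around \<open>x n\<close> onto a small ball around \<open>x (n + 1)\<close>. With the concatenated control, for every \<open>n\<close> there is an
initial point whose trajectory passes through the first \<open>n\<close> balls. A limit of these initial points has a trajectory
through all of them, which is therefore unbounded on a compact time interval.\<close>

theorem bounded_reach_always:
  assumes "s0 \<in> {t0..T}"
  shows "bounded_reach x0 s0 T"
proof (rule ccontr)
  assume unb: "\<not> bounded_reach x0 s0 T"
  obtain u0 where u0: "u0 \<in> controls" using U_nonempty const_control by blast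
  define P where "P n = (\<lambda>(s, x, \<eta> :: real, u). s \<in> {t0..T} \<and> \<not> bounded_reach x s T \<and> 0 < \<eta> \<and> \<eta> \<le> 1 \<and> u \<in> controls \<and>
      (n > 0 \<longrightarrow> norm x > real n))" for n :: nat
  define Q where "Q = (\<lambda>(s, x, \<eta> :: real, u :: real \<Rightarrow> real^'m) (s', x', \<eta>' :: real, u').
     s \<le> s' \<and> (\<forall>z\<in>cball x' \<eta>'. \<exists>w\<in>cball x \<eta>. flow s u' w s' = z))"
  have "\<exists>c. \<forall>n. P n (c n) \<and> Q (c n) (c (Suc n))"
  proof (rule dependent_nat_choice)
    show "\<exists>c. P 0 c" using unb assms u0 by (intro exI[of _ "(s0, x0, 1, u0)"]) (auto simp: P_def)
    show "\<exists>d. P (Suc n) d \<and> Q c d" if "P n c" for n c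
    proof -
      obtain s x \<eta> u where c: "c = (s, x, \<eta>, u)" by (cases c) auto
      have s: "s \<in> {t0..T}" "\<not> bounded_reach x s T" "\<eta> > 0" using that by (auto simp: P_def c)
      obtain s' y \<eta>' u' where "s' \<in> {s..T}" "\<not> bounded_reach y s' T" "norm y > real (Suc n)" "0 < \<eta>'" "\<eta>' \<le> 1" "u' \<in> controls"
        "\<And>z. z \<in> cball y \<eta>' \<Longrightarrow> \<exists>w\<in>cball x \<eta>. flow s u' w s' = z"
        using controlled_escape[OF s] by metis
      then show ?thesis
        using s by (intro exI[of _ "(s', y, \<eta>', u')"]) (auto simp: P_def Q_def c)
    qed
  qed
  then obtain c where c: "\<And>n. P n (c n)" "\<And>n. Q (c n) (c (Suc n))" by blast
  define s where "s n = fst (c n)" for n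
  define x where "x n = fst (snd (c n))" for n
  define \<eta> where "\<eta> n = fst (snd (snd (c n)))" for n
  define v where "v n = snd (snd (snd (c n)))" for n
  have cn: "c n = (s n, x n, \<eta> n, v n)" for n by (simp add: s_def x_def \<eta>_def v_def)
  have s: "s n \<in> {t0..T}" "0 < \<eta> n" "\<eta> n \<le> 1" "v n \<in> controls" "n > 0 \<longrightarrow> norm (x n) > real n" for n
    using c(1)[of n] by (auto simp: P_def cn)
  have Q: "s n \<le> s (Suc n)" "\<And>z. z \<in> cball (x (Suc n)) (\<eta> (Suc n)) \<Longrightarrow> \<exists>w\<in>cball (x n) (\<eta> n). flow (s n) (v (Suc n)) w (s (Suc n)) = z" for n
    using c(2)[of n] by (auto simp: Q_def cn)
  have mono: "s m \<le> s n" if "m \<le> n" for m n using lift_Suc_mono_le[of s, OF Q(1) that] .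
  define u where "u r = v (LEAST k. r < s k) r" for r
  have u: "u \<in> controls" unfolding u_def by (rule switching_control[OF s(4)])
  have uv: "u r = v (Suc n) r" if "s n \<le> r" "r < s (Suc n)" for n r
  proof -
    have "(LEAST k. r < s k) = Suc n"
    proof (rule Least_equality[where P = "\<lambda>k. r < s k", OF that(2)])
      fix k assume "r < s k"
      then show "Suc n \<le> k" using mono[of k n] that(1) by (cases "k \<le> n") auto
    qed
    then show ?thesis by (simp add: u_def)
  qed
  have hit: "\<exists>w\<in>cball (x 0) (\<eta> 0). flow (s 0) u w (s n) = z \<and> (\<forall>k\<le>n. flow (s 0) u w (s k) \<in> cball (x k) (\<eta> k))"
    if "z \<in> cball (x n) (\<eta> n)" for n z
    using that
  proof (induction n arbitrary: z)
    case 0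
    then show ?case using flow_start[OF s(1) u] by auto
  next
    case (Suc n)
    obtain w' where w': "w' \<in> cball (x n) (\<eta> n)" "flow (s n) (v (Suc n)) w' (s (Suc n)) = z"
      using Q(2)[OF Suc.prems] by blast
    obtain w where w: "w \<in> cball (x 0) (\<eta> 0)" "flow (s 0) u w (s n) = w'"
      "\<forall>k\<le>n. flow (s 0) u w (s k) \<in> cball (x k) (\<eta> k)" using Suc.IH[OF w'(1)] by blast
    have "flow (s 0) u w (s (Suc n)) = flow (s n) u w' (s (Suc n))"
      using flow_restart[OF s(1)[of 0] u, of "s n" "s (Suc n)" w] mono[of 0 n] Q(1)[of n] s(1)[of "Suc n"] w(2) by auto
    also have "\<dots> = flow (s n) (v (Suc n)) w' (s (Suc n))"
      by (rule flow_cong[OF s(1) u s(4), where b = "s (Suc n)"]) (use uv Q(1)[of n] s(1)[of "Suc n"] in auto)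
    finally show ?case using w w'(2) Suc.prems by (auto simp: le_Suc_eq intro!: bexI[of _ w])
  qed
  have "\<exists>w\<in>cball (x 0) (\<eta> 0). \<forall>k\<le>n. flow (s 0) u w (s k) \<in> cball (x k) (\<eta> k)" for n
    using hit[of "x n" n] s(2)[of n] by auto
  then obtain w where w: "\<And>n. w n \<in> cball (x 0) (\<eta> 0)" "\<And>n k. k \<le> n \<Longrightarrow> flow (s 0) u (w n) (s k) \<in> cball (x k) (\<eta> k)"
    by metis
  obtain l \<rho> where l: "strict_mono (\<rho> :: nat \<Rightarrow> nat)" "(w \<circ> \<rho>) \<longlonglongrightarrow> l"
    using compact_cball[unfolded compact_def, rule_format, of w "x 0" "\<eta> 0"] w(1) by blast
  have "flow (s 0) u l (s k) \<in> cball (x k) (\<eta> k)" for k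
  proof (rule closed_sequentially[OF closed_cball])
    have "continuous_on UNIV (\<lambda>x. flow (s 0) u x (s k))"
      by (rule flow_continuous_initial[OF s(1) u]) (use mono[of 0 k] s(1)[of k] in auto)
    then have "(\<lambda>n. flow (s 0) u ((w \<circ> \<rho>) n) (s k)) \<longlonglongrightarrow> flow (s 0) u l (s k)"
      by (rule continuous_on_tendsto_compose[OF _ l(2)]) auto
    then show "(\<lambda>n. flow (s 0) u ((w \<circ> \<rho>) (n + k)) (s k)) \<longlonglongrightarrow> flow (s 0) u l (s k)"
      by (rule LIMSEQ_ignore_initial_segment)
    show "flow (s 0) u ((w \<circ> \<rho>) (n + k)) (s k) \<in> cball (x k) (\<eta> k)" for n
      using w(2)[of k "\<rho> (n + k)"] seq_suble[OF l(1), of "n + k"] by auto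
  qed
  then have big: "real k \<le> norm (flow (s 0) u l (s k)) + 1" if "k > 0" for k
    using norm_triangle_sub[of "x k" "flow (s 0) u l (s k)"] s(3)[of k] s(5)[of k] that
    by (smt (verit) dist_norm mem_cball)
  obtain R where R: "\<And>r. r \<in> {s 0..T} \<Longrightarrow> norm (flow (s 0) u l r) \<le> R"
    using bounded_on_Icc[OF flow_continuous[OF s(1) u]] by blast
  obtain k :: nat where "real k > max 0 (R + 1)" using reals_Archimedean2 by blast
  then show False using big[of k] R[of "s k"] mono[of 0 k] s(1)[of k] by (auto split: if_splits)
qed

text \<open>Boundedness for a fixed initial time extends to compact sets of initial points. For initial times a finite
grid suffices, since no trajectory from the ball of radius \<open>N\<close> leaves the ball of radius \<open>N + 1\<close> before the next grid point.\<close>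

theorem flow_uniformly_bounded:
  obtains R where "R \<ge> 0"
    "\<And>x \<tau> u t. norm x \<le> N \<Longrightarrow> t0 \<le> \<tau> \<Longrightarrow> u \<in> controls \<Longrightarrow> t \<in> {\<tau>..T} \<Longrightarrow> norm (flow \<tau> u x t) \<le> R"
proof -
  obtain C where C: "C > 0" "\<And>x u t. norm x \<le> N + 1 \<Longrightarrow> u \<in> U \<Longrightarrow> t \<in> {t0..T} \<Longrightarrow> norm (f x u t) \<le> C"
    using data_bounded by metis
  \<comment> \<open>In this time a speed of at most \<open>C\<close> covers only half of the distance \<open>1\<close>.\<close>
  define h where "h = 1 / (2 * C)"
  have "h > 0" using C by (simp add: h_def)
  define s where "s i = min T (t0 + real i * h)" for i :: nat
  have s: "s i \<in> {t0..T}" for i using t0_less_T \<open>h > 0\<close> by (auto simp: s_def)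
  have "\<exists>R. \<forall>x u r. norm x \<le> N + 1 \<longrightarrow> u \<in> controls \<longrightarrow> r \<in> {s i..T} \<longrightarrow> norm (flow (s i) u x r) \<le> R" for i
    using bounded_reach_compact[OF s order_refl compact_cball bounded_reach_always[OF s], of 0 "N + 1" i]
    unfolding mem_cball_0 by meson
  then obtain R where R: "\<And>i x u r. norm x \<le> N + 1 \<Longrightarrow> u \<in> controls \<Longrightarrow> r \<in> {s i..T} \<Longrightarrow> norm (flow (s i) u x r) \<le> R i"
    by metis
  obtain n :: nat where n: "(T - t0) / h < real n" using reals_Archimedean2 by blast
  define R' where "R' = \<bar>N + 1\<bar> + (\<Sum>i\<le>n. \<bar>R i\<bar>)"
  have R'_ge: "\<bar>R i\<bar> \<le> R'" if "i \<le> n" for i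
    using member_le_sum[of i "{..n}" "\<lambda>i. \<bar>R i\<bar>"] that by (auto simp: R'_def)
  have "R' \<ge> \<bar>N + 1\<bar>" by (auto simp: R'_def intro: sum_nonneg)
  show thesis
  proof (rule that)
    show "R' \<ge> 0" using \<open>R' \<ge> \<bar>N + 1\<bar>\<close> by simp
    fix x :: "real^'n" and \<tau> u t assume x: "norm x \<le> N" and \<tau>: "t0 \<le> \<tau>" and u: "u \<in> controls" and t: "t \<in> {\<tau>..T}"
    define i where "i = nat \<lfloor>(\<tau> - t0) / h\<rfloor>"
    have i1: "real i \<le> (\<tau> - t0) / h" "(\<tau> - t0) / h < real i + 1"
      using \<tau> \<open>h > 0\<close> by (auto simp: i_def)
    have "(\<tau> - t0) / h \<le> (T - t0) / h" using t \<open>h > 0\<close> by (intro divide_right_mono) auto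
    then have "Suc i \<le> n" using i1 n by linarith
    have i2: "t0 + real i * h \<le> \<tau>" "\<tau> < t0 + real (Suc i) * h"
      using i1 \<open>h > 0\<close> by (simp_all add: field_simps)
    have \<tau>': "\<tau> \<in> {t0..T}" using \<tau> t by auto
    have sS: "\<tau> \<le> s (Suc i)" "s (Suc i) - \<tau> \<le> h"
      using i2 t by (auto simp: s_def algebra_simps)
    have "(s (Suc i) - \<tau>) * C \<le> h * C" using sS C by (intro mult_right_mono) auto
    then have short: "(s (Suc i) - \<tau>) * C < 1" using C by (simp add: h_def)
    have first: "norm (flow \<tau> u x r) \<le> N + 1" if "r \<in> {\<tau>..s (Suc i)}" for r
      by (rule flow_short_time[OF \<tau>' u _ x C(2) short that]) (use s[of "Suc i"] in auto)
    show "norm (flow \<tau> u x t) \<le> R'"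
    proof (cases "t \<le> s (Suc i)")
      case True
      then show ?thesis using first[of t] t \<open>R' \<ge> \<bar>N + 1\<bar>\<close> by auto
    next
      case False
      then have "norm (flow (s (Suc i)) u (flow \<tau> u x (s (Suc i))) t) \<le> R (Suc i)"
        using t first[of "s (Suc i)"] sS by (intro R[OF _ u]) auto
      then show ?thesis
        using flow_restart[OF \<tau>' u sS(1), of t x] False t R'_ge[OF \<open>Suc i \<le> n\<close>] by auto
    qed
  qed
qed

text \<open>Naming one ball that contains all trajectories from the ball of radius \<open>N\<close> lets different estimates share their constants.\<close>

definition radius :: "real \<Rightarrow> real" where
  "radius N = (SOME R. R \<ge> 0 \<and> (\<forall>x \<tau> u t. norm x \<le> N \<longrightarrow> t0 \<le> \<tau> \<longrightarrow> u \<in> controls \<longrightarrow> t \<in> {\<tau>..T} \<longrightarrow>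
     norm (flow \<tau> u x t) \<le> R))"

lemma radius:
  shows "radius N \<ge> 0"
    and "norm x \<le> N \<Longrightarrow> t0 \<le> \<tau> \<Longrightarrow> u \<in> controls \<Longrightarrow> t \<in> {\<tau>..T} \<Longrightarrow> norm (flow \<tau> u x t) \<le> radius N"
proof -
  let ?P = "\<lambda>R. R \<ge> 0 \<and> (\<forall>x \<tau> u t. norm x \<le> N \<longrightarrow> t0 \<le> \<tau> \<longrightarrow> u \<in> controls \<longrightarrow> t \<in> {\<tau>..T} \<longrightarrow> norm (flow \<tau> u x t) \<le> R)"
  have "\<exists>R. ?P R" by (rule flow_uniformly_bounded[of N]) blast
  then have "?P (radius N)" unfolding radius_def by (rule someI_ex)
  then show "radius N \<ge> 0"
    "norm x \<le> N \<Longrightarrow> t0 \<le> \<tau> \<Longrightarrow> u \<in> controls \<Longrightarrow> t \<in> {\<tau>..T} \<Longrightarrow> norm (flow \<tau> u x t) \<le> radius N" by blast+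
qed

end

section \<open>The value function and dynamic programming\<close>

context control_system
begin

abbreviation H :: "real^'n \<Rightarrow> real^'n \<Rightarrow> real^'m \<Rightarrow> real \<Rightarrow> real" where
  "H \<equiv> hamiltonian f F"

definition cost :: "real \<Rightarrow> (real \<Rightarrow> real^'m) \<Rightarrow> real^'n \<Rightarrow> real" where
  "cost \<tau> u x = integral {\<tau>..T} (\<lambda>r. F (flow \<tau> u x r) (u r) r)"

abbreviation V :: "real^'n \<Rightarrow> real \<Rightarrow> real" where
  "V \<equiv> value_function f F U T"

lemma running_cost_lebesgue_integrable:
  assumes y: "continuous_on {a..b} y" and u: "u \<in> controls" and ab: "t0 \<le> a" "b \<le> T"
  shows "integrable (lebesgue_on {a..b}) (\<lambda>r. F (y r) (u r) r)"
proof -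
  let ?S = "(UNIV :: (real^'n) set) \<times> U \<times> {t0..T}"
  let ?g = "\<lambda>(x, u, t). F x u t"
  have S: "?S \<in> sets borel"
    by (intro borel_closed closed_Times closed_UNIV compact_imp_closed[OF compact_U] closed_atLeastAtMost)
  have "(\<lambda>r. (y r, u r, r)) \<in> borel_measurable (lebesgue_on {a..b})"
  proof (intro borel_measurable_Pair)
    show "y \<in> borel_measurable (lebesgue_on {a..b})"
      by (intro continuous_imp_measurable_on_sets_lebesgue y) simp
    show "u \<in> borel_measurable (lebesgue_on {a..b})"
      using controlsD(2)[OF u] by (rule measurable_restrict_space1)
    show "(\<lambda>r. r) \<in> borel_measurable (lebesgue_on {a..b})"
      by (intro continuous_imp_measurable_on_sets_lebesgue continuous_intros) simp
  qed
  from measurable_compose[OF this borel_measurable_continuous_on_indicator[OF S continuous_F]]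
  have "(\<lambda>r. indicator ?S (y r, u r, r) *\<^sub>R ?g (y r, u r, r)) \<in> borel_measurable (lebesgue_on {a..b})" .
  then have meas: "(\<lambda>r. F (y r) (u r) r) \<in> borel_measurable (lebesgue_on {a..b})"
    by (rule measurable_cong[THEN iffD1, rotated]) (use controlsD[OF u] ab in \<open>auto simp: indicator_def\<close>)
  obtain R where R: "R \<ge> 0" "\<And>r. r \<in> {a..b} \<Longrightarrow> norm (y r) \<le> R"
    using bounded_on_Icc[OF y] by blast
  obtain C where C: "\<And>x u t. norm x \<le> R \<Longrightarrow> u \<in> U \<Longrightarrow> t \<in> {t0..T} \<Longrightarrow> \<bar>F x u t\<bar> \<le> C"
    using data_bounded[of R] by metis
  show ?thesis
  proof (rule measurable_bounded_by_integrable_imp_lebesgue_integrable[OF meas])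
    show "integrable (lebesgue_on {a..b}) (\<lambda>_. C)"
      using finite_measure.integrable_const[OF finite_measure_lebesgue_on, of "{a..b}" C] by simp
    show "norm (F (y r) (u r) r) \<le> C" if "r \<in> {a..b}" for r
      using C[OF R(2)[OF that]] controlsD[OF u] that ab by auto
  qed simp
qed

lemma running_cost_integrable:
  assumes "continuous_on {a..b} y" "u \<in> controls" "t0 \<le> a" "b \<le> T"
  shows "(\<lambda>r. F (y r) (u r) r) integrable_on {a..b}"
  using running_cost_lebesgue_integrable[OF assms] by (auto intro: integrable_on_lebesgue_on)

lemma flow_cost_integrable:
  assumes "\<tau> \<in> {t0..T}" "u \<in> controls" "\<tau> \<le> a" "b \<le> T"
  shows "(\<lambda>r. F (flow \<tau> u x r) (u r) r) integrable_on {a..b}"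
  using assms by (intro running_cost_integrable continuous_on_subset[OF flow_continuous[of \<tau> u]]) auto

text \<open>From here on costs are Henstock-Kurzweil integrals along the trajectories selected by \<open>flow\<close>.\<close>

lemma costs_eq:
  assumes \<tau>: "\<tau> \<in> {t0..T}"
  shows "costs f F U T x0 \<tau> = (\<lambda>u. cost \<tau> u x0) ` controls"
proof (intro equalityI subsetI)
  have LINT: "(LINT t|lebesgue_on {\<tau>..T}. F (flow \<tau> u x0 t) (u t) t) = cost \<tau> u x0" if "u \<in> controls" for u
    unfolding cost_def using \<tau> that
    by (intro lebesgue_integral_eq_integral running_cost_lebesgue_integrable flow_continuous) auto
  fix J assume "J \<in> (\<lambda>u. cost \<tau> u x0) ` controls"
  then obtain u where u: "u \<in> controls" "J = cost \<tau> u x0" by blast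
  then show "J \<in> costs f F U T x0 \<tau>"
    unfolding costs_def using LINT[OF u(1)] controls_admissible[OF u(1)] flow_trajectory[OF \<tau> u(1)]
    by (intro CollectI exI[of _ u] exI[of _ "flow \<tau> u x0"] conjI) auto
next
  fix J assume "J \<in> costs f F U T x0 \<tau>"
  then obtain u x where J: "J = (LINT t|lebesgue_on {\<tau>..T}. F (x t) (u t) t)"
    and u: "u \<in> borel_measurable (lebesgue_on {\<tau>..T})" "\<And>t. t \<in> {\<tau>..T} \<Longrightarrow> u t \<in> U"
    and x: "trajectory f T x0 \<tau> u x"
    unfolding costs_def admissible_controls_def by blast
  obtain v where v: "v \<in> U" using U_nonempty by blast
  \<comment> \<open>Extending the control by a constant changes nothing on the interval.\<close>
  define w where "w t = (if t \<in> {\<tau>..T} then u t else v)" for t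
  have "(\<lambda>t. if t \<in> {\<tau>..T} then u t - v else 0) \<in> borel_measurable lebesgue"
    using u(1) by (subst borel_measurable_if) auto
  then have "(\<lambda>t. (if t \<in> {\<tau>..T} then u t - v else 0) + v) \<in> borel_measurable lebesgue"
    by simp
  also have "(\<lambda>t. (if t \<in> {\<tau>..T} then u t - v else 0) + v) = w" by (auto simp: w_def)
  finally have "w \<in> borel_measurable lebesgue" .
  moreover have "w t \<in> U" for t using u(2) v by (simp add: w_def)
  ultimately have w: "w \<in> controls" by (simp add: controls_def)
  have "AE t in lebesgue_on {\<tau>..T}. (x has_vector_derivative f (x t) (u t) t) (at t within {\<tau>..T})"
    using x unfolding trajectory_def by blast
  then have "AE t in lebesgue_on {\<tau>..T}. (x has_vector_derivative f (x t) (w t) t) (at t within {\<tau>..T})"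
    by (rule AE_mp) (auto intro!: AE_I2 simp: w_def)
  then have x': "trajectory f T x0 \<tau> w x" using x unfolding trajectory_def by blast
  have eq: "x t = flow \<tau> w x0 t" if "t \<in> {\<tau>..T}" for t
    by (rule flow_eqI[OF \<tau> w trajectory_solves[OF x'] _ that order_refl])
      (use x in \<open>auto simp: trajectory_def\<close>)
  have "J = (LINT t|lebesgue_on {\<tau>..T}. F (flow \<tau> w x0 t) (w t) t)"
    unfolding J by (rule Bochner_Integration.integral_cong) (auto simp: eq w_def)
  also have "\<dots> = cost \<tau> w x0" unfolding cost_def using \<tau> w
    by (intro lebesgue_integral_eq_integral running_cost_lebesgue_integrable flow_continuous) auto
  finally show "J \<in> (\<lambda>u. cost \<tau> u x0) ` controls" using w by blast
qed

lemma cost_bound: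
  obtains C where "C \<ge> 0"
    "\<And>x \<tau> u. norm x \<le> N \<Longrightarrow> \<tau> \<in> {t0..T} \<Longrightarrow> u \<in> controls \<Longrightarrow> \<bar>cost \<tau> u x\<bar> \<le> C * (T - \<tau>)"
proof -
  obtain C where C: "C > 0" "\<And>x u t. norm x \<le> radius N \<Longrightarrow> u \<in> U \<Longrightarrow> t \<in> {t0..T} \<Longrightarrow> \<bar>F x u t\<bar> \<le> C"
    using data_bounded[of "radius N"] by metis
  show thesis
  proof (rule that[of C])
    fix x :: "real^'n" and \<tau> u assume x: "norm x \<le> N" and \<tau>: "\<tau> \<in> {t0..T}" and u: "u \<in> controls"
    have "norm (cost \<tau> u x) \<le> integral {\<tau>..T} (\<lambda>_. C)"
      unfolding cost_def
    proof (rule integral_norm_bound_integral)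
      show "(\<lambda>r. F (flow \<tau> u x r) (u r) r) integrable_on {\<tau>..T}"
        using flow_cost_integrable[OF \<tau> u] by simp
      show "norm (F (flow \<tau> u x r) (u r) r) \<le> C" if "r \<in> {\<tau>..T}" for r
        using C(2)[OF radius(2)[OF x _ u that]] controlsD[OF u] \<tau> that by auto
    qed auto
    then show "\<bar>cost \<tau> u x\<bar> \<le> C * (T - \<tau>)" using \<tau> by (simp add: mult.commute)
  qed (use C in simp)
qed

lemma costs_bdd_below: "\<tau> \<in> {t0..T} \<Longrightarrow> bdd_below (costs f F U T x \<tau>)"
proof -
  assume \<tau>: "\<tau> \<in> {t0..T}"
  obtain C where "\<And>u. u \<in> controls \<Longrightarrow> \<bar>cost \<tau> u x\<bar> \<le> C * (T - \<tau>)"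
    using cost_bound[of "norm x"] \<tau> by (metis order_refl)
  then show ?thesis unfolding costs_eq[OF \<tau>] by (intro bdd_belowI2[of _ "- (C * (T - \<tau>))"]) (auto simp: abs_le_iff minus_le_iff)
qed

lemma controls_nonempty: "controls \<noteq> {}"
  using U_nonempty const_control by blast

lemma V_le_cost: "\<tau> \<in> {t0..T} \<Longrightarrow> u \<in> controls \<Longrightarrow> V x \<tau> \<le> cost \<tau> u x"
  unfolding value_function_def using costs_bdd_below by (intro cInf_lower) (auto simp: costs_eq)

lemma near_optimal_control:
  assumes "\<tau> \<in> {t0..T}" "e > 0"
  obtains u where "u \<in> controls" "cost \<tau> u x < V x \<tau> + e"
proof -
  have "Inf (costs f F U T x \<tau>) < V x \<tau> + e" using assms by (simp add: value_function_def)
  then show thesis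
    using cInf_lessD[of "costs f F U T x \<tau>"] that controls_nonempty unfolding costs_eq[OF assms(1)] by blast
qed

lemma V_bound:
  obtains C where "C \<ge> 0" "\<And>x \<tau>. norm x \<le> N \<Longrightarrow> \<tau> \<in> {t0..T} \<Longrightarrow> \<bar>V x \<tau>\<bar> \<le> C * (T - \<tau>)"
proof -
  obtain C where C: "C \<ge> 0"
    "\<And>x \<tau> u. norm x \<le> N \<Longrightarrow> \<tau> \<in> {t0..T} \<Longrightarrow> u \<in> controls \<Longrightarrow> \<bar>cost \<tau> u x\<bar> \<le> C * (T - \<tau>)"
    using cost_bound by metis
  show thesis
  proof (rule that[OF C(1)])
    fix x :: "real^'n" and \<tau> assume x: "norm x \<le> N" and \<tau>: "\<tau> \<in> {t0..T}"
    show "\<bar>V x \<tau>\<bar> \<le> C * (T - \<tau>)"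
      unfolding value_function_def costs_eq[OF \<tau>]
      by (rule cInf_abs_ge) (use C(2)[OF x \<tau>] controls_nonempty in auto)
  qed
qed

lemma V_terminal: "V x T = 0"
  using V_bound[of "norm x"] t0_less_T by (metis abs_le_zero_iff atLeastAtMost_iff diff_self less_imp_le mult_zero_right order_refl)

lemma cost_split:
  assumes \<tau>: "\<tau> \<in> {t0..T}" and u: "u \<in> controls" and s: "\<tau> \<le> s" "s \<le> T"
  shows "cost \<tau> u x = integral {\<tau>..s} (\<lambda>r. F (flow \<tau> u x r) (u r) r) + cost s u (flow \<tau> u x s)"
proof -
  have "cost s u (flow \<tau> u x s) = integral {s..T} (\<lambda>r. F (flow \<tau> u x r) (u r) r)"
    unfolding cost_def by (rule integral_cong) (use flow_restart[OF \<tau> u] s in auto)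
  then show ?thesis
    unfolding cost_def[of \<tau>] using Henstock_Kurzweil_Integration.integral_combine[OF s flow_cost_integrable[OF \<tau> u]] by simp
qed

lemma V_dynamic_lower:
  assumes "\<tau> \<in> {t0..T}" "u \<in> controls" "\<tau> \<le> s" "s \<le> T"
  shows "integral {\<tau>..s} (\<lambda>r. F (flow \<tau> u x r) (u r) r) + V (flow \<tau> u x s) s \<le> cost \<tau> u x"
  unfolding cost_split[OF assms] using V_le_cost[of s u "flow \<tau> u x s"] assms by auto

text \<open>Follow \<open>u\<close> up to time \<open>s\<close> and a nearly optimal control afterwards.\<close>

lemma V_dynamic_upper:
  assumes \<tau>: "\<tau> \<in> {t0..T}" and u: "u \<in> controls" and s: "\<tau> \<le> s" "s \<le> T"
  shows "V x \<tau> \<le> integral {\<tau>..s} (\<lambda>r. F (flow \<tau> u x r) (u r) r) + V (flow \<tau> u x s) s"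
proof (rule field_le_epsilon)
  fix e :: real assume "e > 0"
  have s': "s \<in> {t0..T}" using \<tau> s by auto
  obtain v where v: "v \<in> controls" "cost s v (flow \<tau> u x s) < V (flow \<tau> u x s) s + e"
    using near_optimal_control[OF s' \<open>e > 0\<close>] by metis
  define w where "w r = (if r < s then u r else v r)" for r
  have "{r. r < s} \<in> sets lebesgue" by (simp add: lessThan_def[symmetric])
  then have "w \<in> borel_measurable lebesgue"
    unfolding w_def using controlsD(2)[OF u] controlsD(2)[OF v(1)] by (intro measurable_If) auto
  then have w: "w \<in> controls" using controlsD(1)[OF u] controlsD(1)[OF v(1)] by (simp add: controls_def w_def)
  have wu: "flow \<tau> w x r = flow \<tau> u x r" if "r \<in> {\<tau>..s}" for r
    by (rule flow_cong[OF \<tau> w u _ that s(2)]) (simp add: w_def)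
  have wv: "flow s w y r = flow s v y r" if "r \<in> {s..T}" for y r
    by (rule flow_cong[OF s' w v(1) _ that order_refl]) (simp add: w_def)
  have "V x \<tau> \<le> cost \<tau> w x" using V_le_cost[OF \<tau> w] .
  also have "\<dots> = integral {\<tau>..s} (\<lambda>r. F (flow \<tau> w x r) (w r) r) + cost s w (flow \<tau> w x s)"
    by (rule cost_split[OF \<tau> w s])
  also have "flow \<tau> w x s = flow \<tau> u x s" using wu s by simp
  also have "cost s w (flow \<tau> u x s) = cost s v (flow \<tau> u x s)"
    unfolding cost_def by (rule integral_cong) (auto simp: wv, simp add: w_def)
  also have "integral {\<tau>..s} (\<lambda>r. F (flow \<tau> w x r) (w r) r) = integral {\<tau>..s} (\<lambda>r. F (flow \<tau> u x r) (u r) r)"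
    by (rule integral_spike[of "{s}"]) (auto simp: wu w_def)
  finally show "V x \<tau> \<le> integral {\<tau>..s} (\<lambda>r. F (flow \<tau> u x r) (u r) r) + V (flow \<tau> u x s) s + e"
    using v(2) by simp
qed

section \<open>Stretching time\<close>

abbreviation gap :: "real \<Rightarrow> 'a::real_normed_vector \<Rightarrow> real \<Rightarrow> 'a \<Rightarrow> real" where
  "gap s x t y \<equiv> \<bar>s - t\<bar> + norm (x - y)"

text \<open>The map \<open>stretch \<sigma> \<tau>\<close> defined next is the affine bijection of \<open>[\<sigma>, T]\<close> onto \<open>[\<tau>, T]\<close> that fixes \<open>T\<close>, and \<open>rate \<sigma> \<tau>\<close> is
its slope; its inverse is \<open>stretch \<tau> \<sigma>\<close>.\<close>

definition rate :: "real \<Rightarrow> real \<Rightarrow> real" where "rate \<sigma> \<tau> = (T - \<tau>) / (T - \<sigma>)"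

definition stretch :: "real \<Rightarrow> real \<Rightarrow> real \<Rightarrow> real" where "stretch \<sigma> \<tau> r = T - rate \<sigma> \<tau> * (T - r)"

text \<open>The trajectory with initial time \<open>\<tau>\<close>, read on the interval \<open>[\<sigma>, T]\<close>. Its control is transported in the
opposite direction, so that in the new time variable it is \<open>u\<close> for every \<open>\<tau>\<close>.\<close>

definition stretched_flow :: "real \<Rightarrow> real \<Rightarrow> (real \<Rightarrow> real^'m) \<Rightarrow> real^'n \<Rightarrow> real \<Rightarrow> real^'n" where
  "stretched_flow \<sigma> \<tau> u x r = flow \<tau> (u \<circ> stretch \<tau> \<sigma>) x (stretch \<sigma> \<tau> r)"

lemma rate_pos: "\<sigma> < T \<Longrightarrow> \<tau> < T \<Longrightarrow> 0 < rate \<sigma> \<tau>"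
  by (simp add: rate_def)

lemma stretch_inverse: "\<sigma> < T \<Longrightarrow> \<tau> < T \<Longrightarrow> stretch \<tau> \<sigma> (stretch \<sigma> \<tau> r) = r"
  by (simp add: stretch_def rate_def)

lemma stretch_self: "\<sigma> < T \<Longrightarrow> stretch \<sigma> \<sigma> r = r"
  by (simp add: stretch_def rate_def)

lemma stretch_start: "\<sigma> < T \<Longrightarrow> stretch \<sigma> \<tau> \<sigma> = \<tau>"
  by (simp add: stretch_def rate_def)

lemma stretch_end: "stretch \<sigma> \<tau> T = T"
  by (simp add: stretch_def)

lemma stretch_mono: "\<sigma> < T \<Longrightarrow> \<tau> < T \<Longrightarrow> r \<le> s \<Longrightarrow> stretch \<sigma> \<tau> r \<le> stretch \<sigma> \<tau> s"
  using rate_pos[of \<sigma> \<tau>] by (simp add: stretch_def)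

lemma stretch_in: "\<sigma> < T \<Longrightarrow> \<tau> < T \<Longrightarrow> r \<in> {\<sigma>..T} \<Longrightarrow> stretch \<sigma> \<tau> r \<in> {\<tau>..T}"
  using stretch_mono[of \<sigma> \<tau> \<sigma> r] stretch_mono[of \<sigma> \<tau> r T] stretch_start stretch_end by auto

lemma stretched_control:
  assumes "\<sigma> < T" "\<tau> < T" "u \<in> controls"
  shows "u \<circ> stretch \<sigma> \<tau> \<in> controls"
proof -
  have "(\<lambda>r. (T - rate \<sigma> \<tau> * T) + rate \<sigma> \<tau> * r) \<in> lebesgue \<rightarrow>\<^sub>M lebesgue"
    using lebesgue_affine_measurable[where c = "\<lambda>_::real. rate \<sigma> \<tau>"] rate_pos[OF assms(1,2)] by simp
  also have "(\<lambda>r. (T - rate \<sigma> \<tau> * T) + rate \<sigma> \<tau> * r) = stretch \<sigma> \<tau>"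
    by (auto simp: stretch_def algebra_simps)
  finally show ?thesis
    using assms(3) measurable_comp[of "stretch \<sigma> \<tau>" lebesgue lebesgue u borel] by (simp add: controls_def)
qed

lemma stretched_has_integral:
  fixes g :: "real \<Rightarrow> 'b::euclidean_space"
  assumes "\<sigma> < T" "\<tau> < T" and g: "(g has_integral I) {stretch \<sigma> \<tau> a..stretch \<sigma> \<tau> b}"
  shows "((\<lambda>r. rate \<sigma> \<tau> *\<^sub>R g (stretch \<sigma> \<tau> r)) has_integral I) {a..b}"
proof -
  let ?c = "rate \<sigma> \<tau>" and ?d = "T - rate \<sigma> \<tau> * T"
  have c: "?c > 0" using rate_pos[OF assms(1,2)] .
  have e: "?c * r + ?d = stretch \<sigma> \<tau> r" for r by (simp add: stretch_def algebra_simps)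
  have i': "(stretch \<sigma> \<tau> r - ?d) /\<^sub>R ?c = r" for r using c by (simp add: e[symmetric] field_simps)
  have "((\<lambda>r. g (?c *\<^sub>R r + ?d)) has_integral (I /\<^sub>R ?c ^ DIM(real)))
     (cbox ((stretch \<sigma> \<tau> a - ?d) /\<^sub>R ?c) ((stretch \<sigma> \<tau> b - ?d) /\<^sub>R ?c))"
    by (rule has_integral_affinity'[OF _ c]) (use g in simp)
  then have "((\<lambda>r. g (stretch \<sigma> \<tau> r)) has_integral (I /\<^sub>R ?c)) {a..b}"
    by (simp only: i' cbox_interval) (simp add: e)
  from has_integral_cmul[OF this, of ?c] show ?thesis using c by simp
qed

lemma stretched_flow_start:
  "\<sigma> < T \<Longrightarrow> \<tau> \<in> {t0..<T} \<Longrightarrow> u \<in> controls \<Longrightarrow> stretched_flow \<sigma> \<tau> u x \<sigma> = x"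
  unfolding stretched_flow_def using flow_start[of \<tau> "u \<circ> stretch \<tau> \<sigma>"] stretched_control[of \<tau> \<sigma> u] by (auto simp: stretch_start)

lemma stretched_flow_primitive:
  assumes \<sigma>: "\<sigma> \<in> {t0..<T}" and \<tau>: "\<tau> \<in> {t0..<T}" and u: "u \<in> controls"
  shows "primitive_on \<sigma> T (\<lambda>r. rate \<sigma> \<tau> *\<^sub>R f (stretched_flow \<sigma> \<tau> u x r) (u r) (stretch \<sigma> \<tau> r)) (stretched_flow \<sigma> \<tau> u x)"
  unfolding primitive_on_def
proof (intro allI impI, elim conjE)
  fix s t assume st: "\<sigma> \<le> s" "s \<le> t" "t \<le> T"
  let ?v = "u \<circ> stretch \<tau> \<sigma>"
  have v: "?v \<in> controls" using stretched_control[of \<tau> \<sigma> u] \<sigma> \<tau> u by auto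
  have \<sigma>\<tau>: "\<sigma> < T" "\<tau> < T" using \<sigma> \<tau> by auto
  have "((\<lambda>r. f (flow \<tau> ?v x r) (?v r) r) has_integral
      (flow \<tau> ?v x (stretch \<sigma> \<tau> t) - flow \<tau> ?v x (stretch \<sigma> \<tau> s))) {stretch \<sigma> \<tau> s..stretch \<sigma> \<tau> t}"
    using stretch_mono[OF \<sigma>\<tau>, of \<sigma> s] stretch_mono[OF \<sigma>\<tau>, of s t] stretch_mono[OF \<sigma>\<tau>, of t T] st \<tau> \<sigma>\<tau>
    by (intro primitive_onD[OF flow_solves[OF _ v order_refl order_refl]]) (auto simp: stretch_start stretch_end)
  from stretched_has_integral[OF \<sigma>\<tau> this]
  show "((\<lambda>r. rate \<sigma> \<tau> *\<^sub>R f (stretched_flow \<sigma> \<tau> u x r) (u r) (stretch \<sigma> \<tau> r)) has_integral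
      stretched_flow \<sigma> \<tau> u x t - stretched_flow \<sigma> \<tau> u x s) {s..t}"
    by (simp add: stretched_flow_def stretch_inverse[OF \<sigma>\<tau>])
qed

lemma stretched_cost_has_integral:
  assumes \<sigma>: "\<sigma> \<in> {t0..<T}" and \<tau>: "\<tau> \<in> {t0..<T}" and u: "u \<in> controls"
  shows "((\<lambda>r. rate \<sigma> \<tau> * F (stretched_flow \<sigma> \<tau> u x r) (u r) (stretch \<sigma> \<tau> r)) has_integral
      cost \<tau> (u \<circ> stretch \<tau> \<sigma>) x) {\<sigma>..T}"
proof -
  let ?v = "u \<circ> stretch \<tau> \<sigma>"
  have v: "?v \<in> controls" using stretched_control[of \<tau> \<sigma> u] \<sigma> \<tau> u by auto
  have \<sigma>\<tau>: "\<sigma> < T" "\<tau> < T" using \<sigma> \<tau> by auto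
  have "((\<lambda>r. F (flow \<tau> ?v x r) (?v r) r) has_integral cost \<tau> ?v x) {stretch \<sigma> \<tau> \<sigma>..stretch \<sigma> \<tau> T}"
    unfolding cost_def stretch_end stretch_start[OF \<sigma>\<tau>(1)]
    using flow_cost_integrable[OF _ v, of \<tau> \<tau> T] \<tau> by (intro integrable_integral) auto
  from stretched_has_integral[OF \<sigma>\<tau> this]
  show ?thesis by (simp add: stretched_flow_def stretch_inverse[OF \<sigma>\<tau>])
qed

lemma stretched_flow_self: "\<sigma> < T \<Longrightarrow> stretched_flow \<sigma> \<sigma> u x = flow \<sigma> u x"
  by (auto simp: stretched_flow_def stretch_self comp_def)

text \<open>The slope of a time change has \<open>T - \<sigma>\<close> in its denominator, so \<open>\<sigma>\<close> is kept at distance \<open>\<delta>\<close> from \<open>T\<close>, and all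
constants below depend on \<open>\<delta>\<close>.\<close>

lemma stretch_difference:
  assumes "\<sigma> \<le> T - \<delta>" "\<delta> > 0" "r \<in> {\<sigma>..T}"
  shows "\<bar>rate \<sigma> \<tau>0 - rate \<sigma> \<tau>1\<bar> \<le> \<bar>\<tau>0 - \<tau>1\<bar> / \<delta>"
    and "\<bar>stretch \<sigma> \<tau>0 r - stretch \<sigma> \<tau>1 r\<bar> \<le> \<bar>\<tau>0 - \<tau>1\<bar>"
proof -
  have pos: "T - \<sigma> > 0" using assms by simp
  have r: "\<bar>rate \<sigma> \<tau>0 - rate \<sigma> \<tau>1\<bar> = \<bar>\<tau>0 - \<tau>1\<bar> / (T - \<sigma>)"
    using pos by (simp add: rate_def diff_divide_distrib[symmetric] abs_minus_commute)
  also have "\<dots> \<le> \<bar>\<tau>0 - \<tau>1\<bar> / \<delta>" using assms by (intro divide_left_mono) auto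
  finally show "\<bar>rate \<sigma> \<tau>0 - rate \<sigma> \<tau>1\<bar> \<le> \<bar>\<tau>0 - \<tau>1\<bar> / \<delta>" .
  have "stretch \<sigma> \<tau>0 r - stretch \<sigma> \<tau>1 r = (rate \<sigma> \<tau>1 - rate \<sigma> \<tau>0) * (T - r)"
    by (simp add: stretch_def algebra_simps)
  then have "\<bar>stretch \<sigma> \<tau>0 r - stretch \<sigma> \<tau>1 r\<bar> = \<bar>\<tau>0 - \<tau>1\<bar> / (T - \<sigma>) * \<bar>T - r\<bar>"
    using r by (simp add: abs_mult abs_minus_commute)
  also have "\<dots> \<le> \<bar>\<tau>0 - \<tau>1\<bar> / (T - \<sigma>) * (T - \<sigma>)"
    using assms pos by (intro mult_left_mono) auto
  finally show "\<bar>stretch \<sigma> \<tau>0 r - stretch \<sigma> \<tau>1 r\<bar> \<le> \<bar>\<tau>0 - \<tau>1\<bar>" using pos by simp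
qed

lemma rate_bound: "\<sigma> \<le> T - \<delta> \<Longrightarrow> \<delta> > 0 \<Longrightarrow> t0 \<le> \<tau> \<Longrightarrow> \<tau> < T \<Longrightarrow> 0 \<le> rate \<sigma> \<tau> \<and> rate \<sigma> \<tau> \<le> (T - t0) / \<delta>"
  unfolding rate_def by (auto intro!: frac_le divide_nonneg_nonneg)

lemma stretched_flow_bounded:
  assumes "norm x \<le> N" "\<sigma> < T" "\<tau> \<in> {t0..<T}" "u \<in> controls" "r \<in> {\<sigma>..T}"
  shows "norm (stretched_flow \<sigma> \<tau> u x r) \<le> radius N"
  unfolding stretched_flow_def
  using assms stretched_control[of \<tau> \<sigma> u] stretch_in[of \<sigma> \<tau> r] by (intro radius(2)) auto

lemma scaled_difference_bound:
  fixes v w :: "'b::real_normed_vector"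
  assumes "norm (v - w) \<le> l * D" "norm v \<le> C" "\<bar>c - c'\<bar> \<le> e" "0 \<le> c'" "c' \<le> k" "0 \<le> l * D"
  shows "norm (c *\<^sub>R v - c' *\<^sub>R w) \<le> e * C + k * (l * D)"
proof -
  have "c *\<^sub>R v - c' *\<^sub>R w = (c - c') *\<^sub>R v + c' *\<^sub>R (v - w)" by (simp add: algebra_simps)
  then have "norm (c *\<^sub>R v - c' *\<^sub>R w) \<le> \<bar>c - c'\<bar> * norm v + \<bar>c'\<bar> * norm (v - w)"
    by (metis norm_triangle_ineq norm_scaleR)
  also have "\<dots> \<le> e * C + k * (l * D)"
    using assms by (intro add_mono mult_mono) auto
  finally show ?thesis .
qed

lemma stretched_flow_lipschitz:
  assumes \<delta>: "\<delta> > 0"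
  obtains K where "K \<ge> 0" "\<And>\<sigma> \<tau>0 \<tau>1 u x0 x1 r. \<sigma> \<in> {t0..T - \<delta>} \<Longrightarrow> \<tau>0 \<in> {t0..T - \<delta>} \<Longrightarrow> \<tau>1 \<in> {t0..T - \<delta>} \<Longrightarrow>
     u \<in> controls \<Longrightarrow> norm x0 \<le> N \<Longrightarrow> norm x1 \<le> N \<Longrightarrow> r \<in> {\<sigma>..T} \<Longrightarrow>
     norm (stretched_flow \<sigma> \<tau>0 u x0 r - stretched_flow \<sigma> \<tau>1 u x1 r) \<le> K * gap \<tau>0 x0 \<tau>1 x1"
    "\<And>\<sigma> \<tau>0 \<tau>1 u x0 x1. \<sigma> \<in> {t0..T - \<delta>} \<Longrightarrow> \<tau>0 \<in> {t0..T - \<delta>} \<Longrightarrow> \<tau>1 \<in> {t0..T - \<delta>} \<Longrightarrow>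
     u \<in> controls \<Longrightarrow> norm x0 \<le> N \<Longrightarrow> norm x1 \<le> N \<Longrightarrow>
     \<bar>cost \<tau>0 (u \<circ> stretch \<tau>0 \<sigma>) x0 - cost \<tau>1 (u \<circ> stretch \<tau>1 \<sigma>) x1\<bar> \<le> K * gap \<tau>0 x0 \<tau>1 x1"
proof -
  define R where "R = radius N"
  note R = radius(1)[of N, folded R_def] stretched_flow_bounded[of _ N, folded R_def]
  obtain C where C: "C > 0" "\<And>x u t. norm x \<le> R \<Longrightarrow> u \<in> U \<Longrightarrow> t \<in> {t0..T} \<Longrightarrow> norm (f x u t) \<le> C \<and> \<bar>F x u t\<bar> \<le> C"
    using data_bounded by metis
  define l where "l = lip R"
  define k where "k = (T - t0) / \<delta>"
  define D where "D = T - t0"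
  define K1 where "K1 = (1 + (C / \<delta> + k * l) * D) * exp (k * l * D)"
  define K2 where "K2 = (C / \<delta> + k * l * (1 + K1)) * D"
  have nn: "l \<ge> 0" "k \<ge> 0" "D \<ge> 0" using lip_nonneg[OF R(1)] t0_less_T \<delta> by (auto simp: l_def k_def D_def)
  then have K1: "K1 \<ge> 0" unfolding K1_def using C(1) \<delta> by (intro mult_nonneg_nonneg add_nonneg_nonneg) auto
  then have K2: "K2 \<ge> 0" unfolding K2_def using C(1) \<delta> nn by (intro mult_nonneg_nonneg add_nonneg_nonneg) auto
  have main: "norm (stretched_flow \<sigma> \<tau>0 u x0 r - stretched_flow \<sigma> \<tau>1 u x1 r) \<le> K1 * gap \<tau>0 x0 \<tau>1 x1"
    "\<bar>rate \<sigma> \<tau>0 * F (stretched_flow \<sigma> \<tau>0 u x0 r) (u r) (stretch \<sigma> \<tau>0 r) - rate \<sigma> \<tau>1 * F (stretched_flow \<sigma> \<tau>1 u x1 r) (u r) (stretch \<sigma> \<tau>1 r)\<bar>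
       \<le> (C / \<delta> + k * l * (1 + K1)) * gap \<tau>0 x0 \<tau>1 x1"
    if \<sigma>: "\<sigma> \<in> {t0..T - \<delta>}" and \<tau>: "\<tau>0 \<in> {t0..T - \<delta>}" "\<tau>1 \<in> {t0..T - \<delta>}"
      and u: "u \<in> controls" and x: "norm x0 \<le> N" "norm x1 \<le> N" and r: "r \<in> {\<sigma>..T}" for \<sigma> \<tau>0 \<tau>1 u x0 x1 r
  proof -
    let ?y0 = "stretched_flow \<sigma> \<tau>0 u x0" and ?y1 = "stretched_flow \<sigma> \<tau>1 u x1"
    let ?d = "\<bar>\<tau>0 - \<tau>1\<bar>"
    let ?f0 = "\<lambda>r. f (?y0 r) (u r) (stretch \<sigma> \<tau>0 r)" and ?f1 = "\<lambda>r. f (?y1 r) (u r) (stretch \<sigma> \<tau>1 r)"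
    let ?F0 = "\<lambda>r. F (?y0 r) (u r) (stretch \<sigma> \<tau>0 r)" and ?F1 = "\<lambda>r. F (?y1 r) (u r) (stretch \<sigma> \<tau>1 r)"
    let ?E = "\<lambda>r. ?d / \<delta> * C + k * (l * (?d + norm (?y0 r - ?y1 r)))"
    have \<sigma>': "\<sigma> \<in> {t0..<T}" and \<tau>': "\<tau>0 \<in> {t0..<T}" "\<tau>1 \<in> {t0..<T}" using \<sigma> \<tau> \<delta> by auto
    have rates: "\<bar>rate \<sigma> \<tau>0 - rate \<sigma> \<tau>1\<bar> \<le> ?d / \<delta>" "0 \<le> rate \<sigma> \<tau>1" "rate \<sigma> \<tau>1 \<le> k"
      using stretch_difference(1)[of \<sigma> \<delta> T] rate_bound[of \<sigma> \<delta> \<tau>1] \<sigma> \<tau>' \<delta> by (auto simp: k_def)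
    have pt: "norm (rate \<sigma> \<tau>0 *\<^sub>R ?f0 r - rate \<sigma> \<tau>1 *\<^sub>R ?f1 r)
        \<le> ?E r"
      "norm (rate \<sigma> \<tau>0 *\<^sub>R ?F0 r - rate \<sigma> \<tau>1 *\<^sub>R ?F1 r)
        \<le> ?E r"
      if r: "r \<in> {\<sigma>..T}" for r
    proof -
      have in0: "stretch \<sigma> \<tau>0 r \<in> {t0..T}" "stretch \<sigma> \<tau>1 r \<in> {t0..T}"
        using stretch_in[of \<sigma> \<tau>0 r] stretch_in[of \<sigma> \<tau>1 r] r \<sigma>' \<tau>' by auto
      have y: "norm (?y0 r) \<le> R" "norm (?y1 r) \<le> R" using R(2) x \<sigma>' \<tau>' u r by auto
      have st: "\<bar>stretch \<sigma> \<tau>0 r - stretch \<sigma> \<tau>1 r\<bar> \<le> ?d"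
        using stretch_difference(2)[of \<sigma> \<delta> r] \<sigma> r \<delta> by auto
      have l: "l * (\<bar>stretch \<sigma> \<tau>0 r - stretch \<sigma> \<tau>1 r\<bar> + norm (?y0 r - ?y1 r)) \<le> l * (?d + norm (?y0 r - ?y1 r))"
        using st nn by (intro mult_left_mono) auto
      have "norm (?f0 r - ?f1 r) \<le> l * (?d + norm (?y0 r - ?y1 r))"
        using lip_f[OF y in0 controlsD(1)[OF u]] l unfolding l_def by (rule order_trans)
      then show "norm (rate \<sigma> \<tau>0 *\<^sub>R ?f0 r - rate \<sigma> \<tau>1 *\<^sub>R ?f1 r)
        \<le> ?E r"
        using C(2)[OF y(1) controlsD(1)[OF u] in0(1)] rates nn by (intro scaled_difference_bound) auto
      have "norm (?F0 r - ?F1 r) \<le> l * (?d + norm (?y0 r - ?y1 r))"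
        using order_trans[OF lip_F[OF y in0 controlsD(1)[OF u]] l[unfolded l_def]] unfolding l_def by simp
      then show "norm (rate \<sigma> \<tau>0 *\<^sub>R ?F0 r - rate \<sigma> \<tau>1 *\<^sub>R ?F1 r)
        \<le> ?E r"
        using C(2)[OF y(1) controlsD(1)[OF u] in0(1)] rates nn by (intro scaled_difference_bound) auto
    qed
    have "norm (?y0 r - ?y1 r) \<le> (norm (?y0 \<sigma> - ?y1 \<sigma>) + ((C / \<delta> + k * l) * ?d) * (T - \<sigma>)) * exp (k * l * (T - \<sigma>))"
    proof (rule gronwall_difference[OF stretched_flow_primitive[OF \<sigma>' \<tau>'(1) u] stretched_flow_primitive[OF \<sigma>' \<tau>'(2) u] _ _ _ r])
      show "0 \<le> (C / \<delta> + k * l) * ?d" "0 \<le> k * l" using nn C(1) \<delta> by auto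
    qed (use pt(1) in \<open>auto simp: algebra_simps\<close>)
    also have "\<dots> \<le> (norm (x0 - x1) + ((C / \<delta> + k * l) * ?d) * D) * exp (k * l * D)"
      using nn C(1) \<delta> \<sigma> \<sigma>' \<tau>' u by (intro mult_mono add_mono) (auto simp: stretched_flow_start D_def intro!: mult_left_mono mult_nonneg_nonneg add_nonneg_nonneg)
    also have "\<dots> \<le> ((?d + norm (x0 - x1)) + ((C / \<delta> + k * l) * D) * (?d + norm (x0 - x1))) * exp (k * l * D)"
    proof (intro mult_right_mono add_mono)
      show "(C / \<delta> + k * l) * ?d * D \<le> (C / \<delta> + k * l) * D * (?d + norm (x0 - x1))"
        using nn C(1) \<delta> mult_left_mono[of ?d "?d + norm (x0 - x1)" "(C / \<delta> + k * l) * D"] by (simp add: mult_ac)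
    qed auto
    also have "\<dots> = K1 * (?d + norm (x0 - x1))" by (simp add: K1_def algebra_simps add_divide_distrib)
    finally show y: "norm (?y0 r - ?y1 r) \<le> K1 * (?d + norm (x0 - x1))" .
    have "?E r \<le>
        (?d + norm (x0 - x1)) / \<delta> * C + k * (l * ((?d + norm (x0 - x1)) + K1 * (?d + norm (x0 - x1))))"
      using nn C(1) \<delta> y by (intro add_mono mult_left_mono mult_right_mono divide_right_mono) auto
    also have "\<dots> = (C / \<delta> + k * l * (1 + K1)) * (?d + norm (x0 - x1))"
      by (simp add: algebra_simps add_divide_distrib)
    finally show "\<bar>rate \<sigma> \<tau>0 * ?F0 r - rate \<sigma> \<tau>1 * ?F1 r\<bar>
       \<le> (C / \<delta> + k * l * (1 + K1)) * gap \<tau>0 x0 \<tau>1 x1"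
      using pt(2)[OF r] by simp
  qed
  show thesis
  proof (rule that[of "max K1 K2"])
    show "max K1 K2 \<ge> 0" using K1 by simp
    fix \<sigma> \<tau>0 \<tau>1 u and x0 x1 :: "real^'n"
    assume *: "\<sigma> \<in> {t0..T - \<delta>}" "\<tau>0 \<in> {t0..T - \<delta>}" "\<tau>1 \<in> {t0..T - \<delta>}" "u \<in> controls" "norm x0 \<le> N" "norm x1 \<le> N"
    let ?e = "gap \<tau>0 x0 \<tau>1 x1"
    have le: "K1 * ?e \<le> max K1 K2 * ?e" "K2 * ?e \<le> max K1 K2 * ?e" by (auto intro!: mult_right_mono)
    show "norm (stretched_flow \<sigma> \<tau>0 u x0 r - stretched_flow \<sigma> \<tau>1 u x1 r) \<le> max K1 K2 * ?e" if "r \<in> {\<sigma>..T}" for r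
      using main(1)[OF * that] le(1) by (rule order_trans)
    have i: "((\<lambda>r. rate \<sigma> \<tau>0 * F (stretched_flow \<sigma> \<tau>0 u x0 r) (u r) (stretch \<sigma> \<tau>0 r)
            - rate \<sigma> \<tau>1 * F (stretched_flow \<sigma> \<tau>1 u x1 r) (u r) (stretch \<sigma> \<tau>1 r)) has_integral
          (cost \<tau>0 (u \<circ> stretch \<tau>0 \<sigma>) x0 - cost \<tau>1 (u \<circ> stretch \<tau>1 \<sigma>) x1)) (cbox \<sigma> T)"
      using * \<delta> unfolding cbox_interval by (intro has_integral_diff stretched_cost_has_integral) auto
    have "norm (cost \<tau>0 (u \<circ> stretch \<tau>0 \<sigma>) x0 - cost \<tau>1 (u \<circ> stretch \<tau>1 \<sigma>) x1)
        \<le> (C / \<delta> + k * l * (1 + K1)) * ?e * measure lborel (cbox \<sigma> T)"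
      by (rule has_integral_bound[OF _ i])
        (use main(2)[OF *] nn K1 C(1) \<delta> in \<open>auto intro!: mult_nonneg_nonneg add_nonneg_nonneg\<close>)
    also have "\<dots> \<le> (C / \<delta> + k * l * (1 + K1)) * ?e * D"
      using * \<delta> nn K1 C(1) by (intro mult_left_mono mult_nonneg_nonneg add_nonneg_nonneg) (auto simp: D_def)
    also have "\<dots> = K2 * ?e" by (simp add: K2_def)
    also note le(2)
    finally show "\<bar>cost \<tau>0 (u \<circ> stretch \<tau>0 \<sigma>) x0 - cost \<tau>1 (u \<circ> stretch \<tau>1 \<sigma>) x1\<bar> \<le> max K1 K2 * ?e" by simp
  qed
qed

text \<open>A nearly optimal control for one initial condition, stretched to the other initial time, is nearly as good there.\<close>

theorem V_lipschitz:
  assumes \<delta>: "\<delta> > 0"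
  obtains K where "K \<ge> 0" "\<And>\<tau>0 \<tau>1 x0 x1. \<tau>0 \<in> {t0..T - \<delta>} \<Longrightarrow> \<tau>1 \<in> {t0..T - \<delta>} \<Longrightarrow>
     norm x0 \<le> N \<Longrightarrow> norm x1 \<le> N \<Longrightarrow> \<bar>V x0 \<tau>0 - V x1 \<tau>1\<bar> \<le> K * gap \<tau>0 x0 \<tau>1 x1"
proof -
  obtain K where K: "K \<ge> 0" "\<And>\<sigma> \<tau>0 \<tau>1 u x0 x1. \<sigma> \<in> {t0..T - \<delta>} \<Longrightarrow> \<tau>0 \<in> {t0..T - \<delta>} \<Longrightarrow> \<tau>1 \<in> {t0..T - \<delta>} \<Longrightarrow>
     u \<in> controls \<Longrightarrow> norm x0 \<le> N \<Longrightarrow> norm x1 \<le> N \<Longrightarrow>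
     \<bar>cost \<tau>0 (u \<circ> stretch \<tau>0 \<sigma>) x0 - cost \<tau>1 (u \<circ> stretch \<tau>1 \<sigma>) x1\<bar> \<le> K * gap \<tau>0 x0 \<tau>1 x1"
    using stretched_flow_lipschitz[OF assms, of N] by metis
  have le: "V x1 \<tau>1 \<le> V x0 \<tau>0 + K * gap \<tau>0 x0 \<tau>1 x1"
    if \<tau>: "\<tau>0 \<in> {t0..T - \<delta>}" "\<tau>1 \<in> {t0..T - \<delta>}" and x: "norm x0 \<le> N" "norm x1 \<le> N" for \<tau>0 \<tau>1 x0 x1
  proof (rule field_le_epsilon)
    fix e :: real assume "e > 0"
    have \<tau>': "\<tau>0 < T" "\<tau>1 < T" "\<tau>0 \<in> {t0..T}" "\<tau>1 \<in> {t0..T}" using \<tau> \<delta> by auto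
    obtain u where u: "u \<in> controls" "cost \<tau>0 u x0 < V x0 \<tau>0 + e"
      using near_optimal_control[OF \<tau>'(3) \<open>e > 0\<close>] by metis
    have "u \<circ> stretch \<tau>0 \<tau>0 = u" using \<tau>' by (auto simp: stretch_self)
    then have "cost \<tau>1 (u \<circ> stretch \<tau>1 \<tau>0) x1 \<le> cost \<tau>0 u x0 + K * gap \<tau>0 x0 \<tau>1 x1"
      using K(2)[OF \<tau>(1) \<tau> u(1) x] by simp
    moreover have "V x1 \<tau>1 \<le> cost \<tau>1 (u \<circ> stretch \<tau>1 \<tau>0) x1"
      by (intro V_le_cost stretched_control \<tau>' u)
    ultimately show "V x1 \<tau>1 \<le> V x0 \<tau>0 + K * gap \<tau>0 x0 \<tau>1 x1 + e" using u(2) by simp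
  qed
  show thesis
  proof (rule that[OF K(1)])
    fix \<tau>0 \<tau>1 and x0 x1 :: "real^'n"
    assume *: "\<tau>0 \<in> {t0..T - \<delta>}" "\<tau>1 \<in> {t0..T - \<delta>}" "norm x0 \<le> N" "norm x1 \<le> N"
    show "\<bar>V x0 \<tau>0 - V x1 \<tau>1\<bar> \<le> K * gap \<tau>0 x0 \<tau>1 x1"
      using le[OF *] le[OF *(2,1,4,3)] by (simp add: abs_le_iff norm_minus_commute abs_minus_commute)
  qed
qed

end

section \<open>Semiconcavity of the value function\<close>

lemma primitive_on_linear_combination:
  assumes "primitive_on a b g x" "primitive_on a b h y"
  shows "primitive_on a b (\<lambda>r. p *\<^sub>R g r + q *\<^sub>R h r) (\<lambda>r. p *\<^sub>R x r + q *\<^sub>R y r)"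
  unfolding primitive_on_def
proof (intro allI impI, elim conjE)
  fix s t assume "a \<le> s" "s \<le> t" "t \<le> b"
  then have "((\<lambda>r. p *\<^sub>R g r + q *\<^sub>R h r) has_integral (p *\<^sub>R (x t - x s) + q *\<^sub>R (y t - y s))) {s..t}"
    by (intro has_integral_add has_integral_cmul primitive_onD[OF assms(1)] primitive_onD[OF assms(2)])
  then show "((\<lambda>r. p *\<^sub>R g r + q *\<^sub>R h r) has_integral p *\<^sub>R x t + q *\<^sub>R y t - (p *\<^sub>R x s + q *\<^sub>R y s)) {s..t}"
    by (simp add: algebra_simps)
qed

lemma filterlim_scale_at_right_0:
  fixes k :: real
  assumes "k > 0"
  shows "filterlim (\<lambda>d. k * d) (at_right 0) (at_right 0)"
  unfolding filterlim_at
proof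
  show "((\<lambda>d. k * d) \<longlongrightarrow> 0) (at_right 0)" by (auto intro!: tendsto_eq_intros)
  show "\<forall>\<^sub>F d in at_right 0. k * d \<in> {0<..} \<and> k * d \<noteq> 0"
    using eventually_at_right_less[of 0] by eventually_elim (use assms in auto)
qed

lemma modulus_scaled_tendsto:
  assumes "modulus \<omega>" "R > 0" "k > 0"
  shows "((\<lambda>d. \<omega> R (k * d)) \<longlongrightarrow> 0) (at_right 0)"
proof -
  have lim: "((\<lambda>D. \<omega> R D) \<longlongrightarrow> 0) (at_right 0)" using assms(1,2) unfolding modulus_def by blast
  from filterlim_compose[OF lim filterlim_scale_at_right_0[OF assms(3)]] show ?thesis by simp
qed

text \<open>The condition on \<open>f\<close> is two-sided, that on \<open>F\<close> one-sided: trajectories are compared in norm, costs only from above.\<close>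

locale semiconcave_control_system = control_system t0 T U f F L
  for t0 T :: real
    and U :: "(real^'m) set"
    and f :: "real^'n \<Rightarrow> real^'m \<Rightarrow> real \<Rightarrow> real^'n"
    and F :: "real^'n \<Rightarrow> real^'m \<Rightarrow> real \<Rightarrow> real"
    and L :: "real \<Rightarrow> real" +
  fixes \<omega>f \<omega>F :: "real \<Rightarrow> real \<Rightarrow> real"
  assumes modulus_f: "modulus \<omega>f" and modulus_F: "modulus \<omega>F"
    and semiconcave_f: "\<And>R c x y t s u. R > 0 \<Longrightarrow> c \<in> {0..1} \<Longrightarrow> norm x < R \<Longrightarrow> norm y < R \<Longrightarrow>
      t \<in> {t0..T} \<Longrightarrow> s \<in> {t0..T} \<Longrightarrow> u \<in> U \<Longrightarrow>
      norm (c *\<^sub>R f x u t + (1 - c) *\<^sub>R f y u s - f (c *\<^sub>R x + (1 - c) *\<^sub>R y) u (c * t + (1 - c) * s))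
       \<le> c * (1 - c) * (\<bar>t - s\<bar> + norm (x - y)) * \<omega>f R (\<bar>t - s\<bar> + norm (x - y))"
    and semiconcave_F: "\<And>R c x y t s u. R > 0 \<Longrightarrow> c \<in> {0..1} \<Longrightarrow> norm x < R \<Longrightarrow> norm y < R \<Longrightarrow>
      t \<in> {t0..T} \<Longrightarrow> s \<in> {t0..T} \<Longrightarrow> u \<in> U \<Longrightarrow>
      c * F x u t + (1 - c) * F y u s - F (c *\<^sub>R x + (1 - c) *\<^sub>R y) u (c * t + (1 - c) * s)
       \<le> c * (1 - c) * (\<bar>t - s\<bar> + norm (x - y)) * \<omega>F R (\<bar>t - s\<bar> + norm (x - y))"
begin

text \<open>One modulus \<open>\<Omega>\<close> serves for all points of the ball and all times up to \<open>T'\<close>; this allows the passage to the limit.\<close>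

definition semiconcave_V :: "real \<Rightarrow> real \<Rightarrow> (real \<Rightarrow> real) \<Rightarrow> bool" where
  "semiconcave_V N T' \<Omega> \<longleftrightarrow>
     (\<forall>d\<ge>0. 0 \<le> \<Omega> d) \<and> (\<forall>d D. 0 \<le> d \<longrightarrow> d \<le> D \<longrightarrow> \<Omega> d \<le> \<Omega> D) \<and> (\<Omega> \<longlongrightarrow> 0) (at_right 0) \<and>
     (\<forall>a\<in>{0..1}. \<forall>\<tau>0\<in>{t0..T'}. \<forall>\<tau>1\<in>{t0..T'}. \<forall>x0 x1. norm x0 \<le> N \<longrightarrow> norm x1 \<le> N \<longrightarrow>
      a * V x0 \<tau>0 + (1 - a) * V x1 \<tau>1 - V (a *\<^sub>R x0 + (1 - a) *\<^sub>R x1) (a * \<tau>0 + (1 - a) * \<tau>1)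
      \<le> a * (1 - a) * gap \<tau>0 x0 \<tau>1 x1 * \<Omega> (gap \<tau>0 x0 \<tau>1 x1))"

lemma modulus_term_mono:
  assumes "modulus \<omega>" "R > 0" "c \<in> {0..1}" "0 \<le> e" "e \<le> k * d" "0 \<le> k" "0 \<le> d"
  shows "c * (1 - c) * e * \<omega> R e \<le> c * (1 - c) * d * (k * \<omega> R (k * d))"
proof -
  have "0 \<le> \<omega> R e" "\<omega> R e \<le> \<omega> R (k * d)" using assms unfolding modulus_def by auto
  then have "c * (1 - c) * (e * \<omega> R e) \<le> c * (1 - c) * (k * d * \<omega> R (k * d))"
    using assms by (intro mult_left_mono mult_mono) auto
  then show ?thesis by (simp add: mult_ac)
qed

text \<open>Let \<open>u\<close> be nearly optimal for the convex combination \<open>(x, \<sigma>)\<close>, and let \<open>y0\<close>, \<open>y1\<close> be the trajectories from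
\<open>(x0, \<tau>0)\<close> and \<open>(x1, \<tau>1)\<close>, stretched to \<open>[\<sigma>, T]\<close>. Their combination \<open>y\<close> starts at \<open>x\<close>, and its velocity differs from
that prescribed by \<open>f\<close> by three terms: the semiconcavity defect of \<open>f\<close>, a Lipschitz term in the distance of \<open>y\<close> to the true
trajectory \<open>z\<close>, and a term from the slopes of the two time changes. The slopes \<open>c0\<close>, \<open>c1\<close> satisfy
\<open>a c0 + (1 - a) c1 = 1\<close>, so that they contribute only \<open>m (f0 - f1)\<close> with \<open>m = a (c0 - 1)\<close>; both factors are of first order in the
distance \<open>d\<close> of the two initial conditions, and \<open>m\<close> contains the factor \<open>a (1 - a)\<close>. The costs are
compared in the same way.\<close>

theorem V_semiconcave:
  assumes \<delta>: "\<delta> > 0"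
  obtains \<Omega> where "semiconcave_V N (T - \<delta>) \<Omega>"
proof -
  define R where "R = radius N"
  note R = radius(1)[of N, folded R_def] stretched_flow_bounded[of _ N, folded R_def]
  obtain K where K: "K \<ge> 0" "\<And>\<sigma> \<tau>0 \<tau>1 u x0 x1 r. \<sigma> \<in> {t0..T - \<delta>} \<Longrightarrow> \<tau>0 \<in> {t0..T - \<delta>} \<Longrightarrow> \<tau>1 \<in> {t0..T - \<delta>} \<Longrightarrow>
     u \<in> controls \<Longrightarrow> norm x0 \<le> N \<Longrightarrow> norm x1 \<le> N \<Longrightarrow> r \<in> {\<sigma>..T} \<Longrightarrow>
     norm (stretched_flow \<sigma> \<tau>0 u x0 r - stretched_flow \<sigma> \<tau>1 u x1 r) \<le> K * gap \<tau>0 x0 \<tau>1 x1"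
    using stretched_flow_lipschitz[OF assms, of N] by metis
  define l where "l = lip R"
  define D where "D = T - t0"
  define k where "k = 1 + K"
  define E where "E = exp (l * D)"
  define W where "W \<omega> d = k * \<omega> (R + 1) (k * d) + l * k / \<delta> * d" for \<omega> :: "real \<Rightarrow> real \<Rightarrow> real" and d
  define \<Omega> where "\<Omega> d = (W \<omega>F d + l * (W \<omega>f d * D * E)) * D" for d
  have nn: "l \<ge> 0" "D \<ge> 0" "k > 0" "E \<ge> 0" "l * k / \<delta> \<ge> 0"
    using lip_nonneg[OF R(1)] t0_less_T K(1) \<delta> by (auto simp: l_def D_def k_def E_def)
  have W: "0 \<le> d \<Longrightarrow> 0 \<le> W \<omega> d" "0 \<le> d \<Longrightarrow> d \<le> d' \<Longrightarrow> W \<omega> d \<le> W \<omega> d'" "(W \<omega> \<longlongrightarrow> 0) (at_right 0)"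
    if \<omega>: "modulus \<omega>" for \<omega> d d'
  proof -
    show "0 \<le> W \<omega> d" if "0 \<le> d"
    proof -
      have "0 \<le> \<omega> (R + 1) (k * d)" using \<omega> R(1) that nn unfolding modulus_def by auto
      then show ?thesis unfolding W_def using nn that by (intro add_nonneg_nonneg mult_nonneg_nonneg) auto
    qed
    show "W \<omega> d \<le> W \<omega> d'" if "0 \<le> d" "d \<le> d'"
    proof -
      have "\<omega> (R + 1) (k * d) \<le> \<omega> (R + 1) (k * d')"
        using \<omega> R(1) that nn unfolding modulus_def by (auto intro!: mult_left_mono)
      then show ?thesis unfolding W_def using nn that by (intro add_mono mult_left_mono) auto
    qed
    have "((\<lambda>d. \<omega> (R + 1) (k * d)) \<longlongrightarrow> 0) (at_right 0)"
      by (rule modulus_scaled_tendsto[OF \<omega>]) (use R(1) nn in auto)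
    then show "(W \<omega> \<longlongrightarrow> 0) (at_right 0)" unfolding W_def using \<delta> by (auto intro!: tendsto_eq_intros)
  qed
  show thesis
  proof (rule that[of \<Omega>], unfold semiconcave_V_def, intro conjI allI impI ballI)
    show "0 \<le> \<Omega> d" if "0 \<le> d" for d
      unfolding \<Omega>_def using W(1)[OF modulus_f that] W(1)[OF modulus_F that] nn
      by (intro mult_nonneg_nonneg add_nonneg_nonneg)
    show "\<Omega> d \<le> \<Omega> d'" if "0 \<le> d" "d \<le> d'" for d d'
      unfolding \<Omega>_def using W(2)[OF modulus_f that] W(2)[OF modulus_F that] nn
      by (intro mult_right_mono add_mono mult_left_mono)
    show "(\<Omega> \<longlongrightarrow> 0) (at_right 0)"
      unfolding \<Omega>_def using W(3)[OF modulus_f] W(3)[OF modulus_F] by (auto intro!: tendsto_eq_intros)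
    fix a \<tau>0 \<tau>1 :: real and x0 x1 :: "real^'n"
    assume a: "a \<in> {0..1}" and \<tau>: "\<tau>0 \<in> {t0..T - \<delta>}" "\<tau>1 \<in> {t0..T - \<delta>}" and x01: "norm x0 \<le> N" "norm x1 \<le> N"
    define \<sigma> where "\<sigma> = a * \<tau>0 + (1 - a) * \<tau>1"
    define x where "x = a *\<^sub>R x0 + (1 - a) *\<^sub>R x1"
    define d where "d = gap \<tau>0 x0 \<tau>1 x1"
    define q where "q = a * (1 - a)"
    have q: "q \<ge> 0" and d: "d \<ge> 0" using a by (auto simp: q_def d_def)
    have \<sigma>: "\<sigma> \<in> {t0..T - \<delta>}"
      using convexD[of "{t0..T - \<delta>}" \<tau>0 \<tau>1 a "1 - a"] a \<tau> by (auto simp: \<sigma>_def)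
    have xN: "norm x \<le> N"
      using convexD[of "cball 0 N" x0 x1 a "1 - a"] a x01 by (auto simp: x_def)
    have \<sigma>': "\<sigma> \<in> {t0..<T}" and \<tau>': "\<tau>0 \<in> {t0..<T}" "\<tau>1 \<in> {t0..<T}" using \<sigma> \<tau> \<delta> by auto
    have \<sigma>T: "\<sigma> \<in> {t0..T}" using \<sigma>' by auto
    have pos: "T - \<sigma> > 0" using \<sigma>' by auto
    let ?c0 = "rate \<sigma> \<tau>0" and ?c1 = "rate \<sigma> \<tau>1"
    define m where "m = a * (?c0 - 1)"
    have m1: "a * ?c0 = a + m" by (simp add: m_def algebra_simps)
    have m2: "(1 - a) * ?c1 = (1 - a) - m"
    proof -
      have "a * (T - \<tau>0) + (1 - a) * (T - \<tau>1) = T - \<sigma>" by (simp add: \<sigma>_def algebra_simps)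
      then have "a * ?c0 + (1 - a) * ?c1 = 1"
        using pos by (simp add: rate_def add_divide_distrib[symmetric])
      then show ?thesis using m1 by simp
    qed
    have m: "\<bar>m\<bar> \<le> q * d / \<delta>"
    proof -
      have "m = a * ((\<sigma> - \<tau>0) / (T - \<sigma>))" using pos by (simp add: m_def rate_def field_simps)
      also have "\<sigma> - \<tau>0 = (1 - a) * (\<tau>1 - \<tau>0)" by (simp add: \<sigma>_def algebra_simps)
      finally have "\<bar>m\<bar> = q * \<bar>\<tau>0 - \<tau>1\<bar> / (T - \<sigma>)"
        using a pos by (simp add: q_def abs_mult abs_minus_commute)
      also have "\<dots> \<le> q * d / \<delta>"
        using q \<sigma> \<delta> by (intro frac_le mult_left_mono mult_nonneg_nonneg) (auto simp: d_def)
      finally show ?thesis .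
    qed
    have "V x0 \<tau>0 * a + V x1 \<tau>1 * (1 - a) \<le> V x \<sigma> + q * d * \<Omega> d"
    proof (rule field_le_epsilon)
      fix e :: real assume "e > 0"
      obtain u where u: "u \<in> controls" "cost \<sigma> u x < V x \<sigma> + e"
        using near_optimal_control[OF \<sigma>T \<open>e > 0\<close>] by metis
      let ?y0 = "stretched_flow \<sigma> \<tau>0 u x0" and ?y1 = "stretched_flow \<sigma> \<tau>1 u x1" and ?z = "flow \<sigma> u x"
      define y where "y r = a *\<^sub>R ?y0 r + (1 - a) *\<^sub>R ?y1 r" for r
      let ?\<theta>0 = "stretch \<sigma> \<tau>0" and ?\<theta>1 = "stretch \<sigma> \<tau>1"
      let ?f0 = "\<lambda>r. f (?y0 r) (u r) (?\<theta>0 r)" and ?f1 = "\<lambda>r. f (?y1 r) (u r) (?\<theta>1 r)"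
      let ?F0 = "\<lambda>r. F (?y0 r) (u r) (?\<theta>0 r)" and ?F1 = "\<lambda>r. F (?y1 r) (u r) (?\<theta>1 r)"
      let ?fy = "\<lambda>r. f (y r) (u r) r" and ?fz = "\<lambda>r. f (?z r) (u r) r"
      let ?Fy = "\<lambda>r. F (y r) (u r) r" and ?Fz = "\<lambda>r. F (?z r) (u r) r"
      let ?g = "\<lambda>r. a *\<^sub>R (?c0 *\<^sub>R ?f0 r) + (1 - a) *\<^sub>R (?c1 *\<^sub>R ?f1 r)"
      let ?G = "\<lambda>r. a * (?c0 * ?F0 r) + (1 - a) * (?c1 * ?F1 r)"
      have z: "norm (?z r) \<le> R" if "r \<in> {\<sigma>..T}" for r
        using R(2)[OF xN _ \<sigma>' u(1) that] \<sigma>' stretched_flow_self[of \<sigma> u x] by auto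
      have pt: "norm (a *\<^sub>R ?f0 r + (1 - a) *\<^sub>R ?f1 r - ?fy r) \<le> q * d * (k * \<omega>f (R + 1) (k * d))"
        "a * ?F0 r + (1 - a) * ?F1 r - ?Fy r \<le> q * d * (k * \<omega>F (R + 1) (k * d))"
        "norm (?f0 r - ?f1 r) \<le> l * (k * d)" "\<bar>?F0 r - ?F1 r\<bar> \<le> l * (k * d)"
        "norm (?fy r - ?fz r) \<le> l * norm (y r - ?z r)"
        "\<bar>?Fy r - ?Fz r\<bar> \<le> l * norm (y r - ?z r)"
        if r: "r \<in> {\<sigma>..T}" for r
      proof -
        have \<theta>: "?\<theta>0 r \<in> {t0..T}" "?\<theta>1 r \<in> {t0..T}"
          using stretch_in[of \<sigma> \<tau>0 r] stretch_in[of \<sigma> \<tau>1 r] r \<sigma>' \<tau>' by auto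
        have rT: "r \<in> {t0..T}" using r \<sigma>' by auto
        have yR: "norm (?y0 r) \<le> R" "norm (?y1 r) \<le> R" using R(2) x01 \<sigma>' \<tau>' u(1) r by auto
        have yy: "norm (y r) \<le> R"
          using convexD[of "cball 0 R" "?y0 r" "?y1 r" a "1 - a"] a yR by (auto simp: y_def)
        let ?e = "\<bar>?\<theta>0 r - ?\<theta>1 r\<bar> + norm (?y0 r - ?y1 r)"
        have "\<bar>?\<theta>0 r - ?\<theta>1 r\<bar> \<le> d"
          using stretch_difference(2)[of \<sigma> \<delta> r \<tau>0 \<tau>1] \<sigma> r \<delta> norm_ge_zero[of "x0 - x1"]
          unfolding d_def by (smt (verit) atLeastAtMost_iff)
        moreover have "norm (?y0 r - ?y1 r) \<le> K * d"
          using K(2)[OF \<sigma> \<tau> u(1) x01 r] by (simp add: d_def)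
        ultimately have e: "?e \<le> k * d" by (simp add: k_def algebra_simps)
        have comb: "a * ?\<theta>0 r + (1 - a) * ?\<theta>1 r = r"
        proof -
          have "a * ?\<theta>0 r + (1 - a) * ?\<theta>1 r = T - (a * ?c0 + (1 - a) * ?c1) * (T - r)"
            by (simp add: stretch_def algebra_simps)
          then show ?thesis by (simp add: m1 m2)
        qed
        show "norm (a *\<^sub>R ?f0 r + (1 - a) *\<^sub>R ?f1 r - ?fy r) \<le> q * d * (k * \<omega>f (R + 1) (k * d))"
          using order_trans[OF semiconcave_f[of "R + 1" a "?y0 r" "?y1 r" "?\<theta>0 r" "?\<theta>1 r" "u r"]
              modulus_term_mono[OF modulus_f _ a _ e]] R(1) yR \<theta> a d nn controlsD(1)[OF u(1)]
          by (simp add: comb y_def q_def)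
        show "a * ?F0 r + (1 - a) * ?F1 r - ?Fy r \<le> q * d * (k * \<omega>F (R + 1) (k * d))"
          using order_trans[OF semiconcave_F[of "R + 1" a "?y0 r" "?y1 r" "?\<theta>0 r" "?\<theta>1 r" "u r"]
              modulus_term_mono[OF modulus_F _ a _ e]] R(1) yR \<theta> a d nn controlsD(1)[OF u(1)]
          by (simp add: comb y_def q_def)
        have "l * ?e \<le> l * (k * d)" using e nn by (intro mult_left_mono)
        then show "norm (?f0 r - ?f1 r) \<le> l * (k * d)" "\<bar>?F0 r - ?F1 r\<bar> \<le> l * (k * d)"
          using lip_f[OF yR \<theta> controlsD(1)[OF u(1)], of r] lip_F[OF yR \<theta> controlsD(1)[OF u(1)], of r]
          unfolding l_def by linarith+
        show "norm (?fy r - ?fz r) \<le> l * norm (y r - ?z r)"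
          "\<bar>?Fy r - ?Fz r\<bar> \<le> l * norm (y r - ?z r)"
          using lip_f[OF yy z[OF r] rT rT controlsD(1)[OF u(1)], of r] lip_F[OF yy z[OF r] rT rT controlsD(1)[OF u(1)], of r]
          by (simp_all add: l_def)
      qed
      have cross: "\<bar>m\<bar> * v \<le> q * d * (l * k / \<delta> * d)" if "v \<le> l * (k * d)" "0 \<le> v" for v
      proof -
        have "\<bar>m\<bar> * v \<le> (q * d / \<delta>) * (l * (k * d))" using m that by (intro mult_mono) auto
        then show ?thesis by (simp add: mult_ac)
      qed
      have y_primitive: "primitive_on \<sigma> T ?g y"
        unfolding y_def
        by (intro primitive_on_linear_combination stretched_flow_primitive \<sigma>' \<tau>' u)
      have y_start: "y \<sigma> = x"
        using stretched_flow_start[of \<sigma> \<tau>0 u x0] stretched_flow_start[of \<sigma> \<tau>1 u x1] \<sigma>' \<tau>' u(1) by (simp add: y_def x_def)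
      have yz: "norm (y r - ?z r) \<le> q * d * (W \<omega>f d * D * E)" if r: "r \<in> {\<sigma>..T}" for r
      proof -
        have "norm (y r - ?z r) \<le> (norm (y \<sigma> - ?z \<sigma>) + (q * d * W \<omega>f d) * (T - \<sigma>)) * exp (l * (T - \<sigma>))"
        proof (rule gronwall_difference[OF y_primitive flow_solves[OF \<sigma>T u(1) order_refl order_refl] _ _ nn(1) r])
          show "0 \<le> q * d * W \<omega>f d" using q d W(1)[OF modulus_f d] by simp
          fix r assume r: "r \<in> {\<sigma>..T}"
          have "?g r - ?fz r
              = (a *\<^sub>R ?f0 r + (1 - a) *\<^sub>R ?f1 r - ?fy r) + (?fy r - ?fz r) + m *\<^sub>R (?f0 r - ?f1 r)"
            unfolding scaleR_scaleR m1 m2 by (simp add: algebra_simps)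
          then have "norm (?g r - ?fz r)
            \<le> norm (a *\<^sub>R ?f0 r + (1 - a) *\<^sub>R ?f1 r - ?fy r) + norm (?fy r - ?fz r) + norm (m *\<^sub>R (?f0 r - ?f1 r))"
            by (metis norm_triangle_mono norm_triangle_ineq order_refl)
          also have "\<dots> \<le> q * d * (k * \<omega>f (R + 1) (k * d)) + l * norm (y r - ?z r) + q * d * (l * k / \<delta> * d)"
            unfolding norm_scaleR by (intro add_mono pt[OF r] cross norm_ge_zero)
          also have "\<dots> = q * d * W \<omega>f d + l * norm (y r - ?z r)" by (simp add: W_def algebra_simps)
          finally show "norm (?g r - ?fz r)
              \<le> q * d * W \<omega>f d + l * norm (y r - ?z r)" .
        qed
        also have "\<dots> = (q * d * W \<omega>f d) * ((T - \<sigma>) * exp (l * (T - \<sigma>)))"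
          by (simp add: y_start flow_start[OF \<sigma>T u(1)] mult_ac)
        also have "\<dots> \<le> (q * d * W \<omega>f d) * (D * E)"
          using q d W(1)[OF modulus_f d] \<sigma>' nn unfolding E_def
          by (intro mult_left_mono mult_mono mult_nonneg_nonneg) (auto simp: D_def intro!: mult_left_mono)
        finally show ?thesis by (simp add: mult_ac)
      qed
      let ?J0 = "cost \<tau>0 (u \<circ> stretch \<tau>0 \<sigma>) x0" and ?J1 = "cost \<tau>1 (u \<circ> stretch \<tau>1 \<sigma>) x1"
      let ?B = "q * d * (W \<omega>F d + l * (W \<omega>f d * D * E))"
      have B: "?B \<ge> 0"
        using q d nn W(1)[OF modulus_f d] W(1)[OF modulus_F d] by (intro mult_nonneg_nonneg add_nonneg_nonneg)
      have "((\<lambda>r. ?Fz r) has_integral cost \<sigma> u x) {\<sigma>..T}"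
        unfolding cost_def using flow_cost_integrable[OF \<sigma>T u(1), of \<sigma> T] by (intro integrable_integral) auto
      then have "((\<lambda>r. ?G r - ?Fz r)
          has_integral (a * ?J0 + (1 - a) * ?J1 - cost \<sigma> u x)) {\<sigma>..T}"
        by (intro has_integral_diff has_integral_add has_integral_mult_right stretched_cost_has_integral \<sigma>' \<tau>' u)
      then have "a * ?J0 + (1 - a) * ?J1 - cost \<sigma> u x \<le> (T - \<sigma>) *\<^sub>R ?B"
      proof (rule has_integral_le)
        show "((\<lambda>_. ?B) has_integral (T - \<sigma>) *\<^sub>R ?B) {\<sigma>..T}"
          using has_integral_const_real[of ?B \<sigma> T] \<sigma>' by simp
        fix r assume r: "r \<in> {\<sigma>..T}"
        have "?G r - ?Fz r
            = (a * ?F0 r + (1 - a) * ?F1 r - ?Fy r) + (?Fy r - ?Fz r) + m * (?F0 r - ?F1 r)"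
          unfolding mult.assoc[symmetric] m1 m2 by (simp add: algebra_simps)
        also have "\<dots> \<le> q * d * (k * \<omega>F (R + 1) (k * d)) + l * (q * d * (W \<omega>f d * D * E)) + q * d * (l * k / \<delta> * d)"
        proof (intro add_mono pt(2)[OF r])
          have "?Fy r - ?Fz r \<le> l * norm (y r - ?z r)" using pt(6)[OF r] by simp
          also have "\<dots> \<le> l * (q * d * (W \<omega>f d * D * E))" using yz[OF r] nn by (intro mult_left_mono)
          finally show "?Fy r - ?Fz r \<le> l * (q * d * (W \<omega>f d * D * E))" .
          have "m * (?F0 r - ?F1 r) \<le> \<bar>m\<bar> * \<bar>?F0 r - ?F1 r\<bar>" by (metis abs_ge_self abs_mult)
          also have "\<dots> \<le> q * d * (l * k / \<delta> * d)" by (intro cross pt(4)[OF r] abs_ge_zero)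
          finally show "m * (?F0 r - ?F1 r) \<le> q * d * (l * k / \<delta> * d)" .
        qed
        also have "\<dots> = ?B" by (simp add: W_def algebra_simps)
        finally show "?G r - ?Fz r \<le> ?B" .
      qed
      also have "\<dots> \<le> D * ?B" using B \<sigma>' by (auto simp: D_def intro!: mult_right_mono)
      also have "\<dots> = q * d * \<Omega> d" by (simp add: \<Omega>_def mult_ac)
      finally have "a * ?J0 + (1 - a) * ?J1 \<le> cost \<sigma> u x + q * d * \<Omega> d" by simp
      moreover have "V x0 \<tau>0 \<le> ?J0" "V x1 \<tau>1 \<le> ?J1"
        using \<sigma>' \<tau>' u(1) by (auto intro!: V_le_cost stretched_control)
      then have "a * V x0 \<tau>0 + (1 - a) * V x1 \<tau>1 \<le> a * ?J0 + (1 - a) * ?J1"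
        using a by (intro add_mono mult_left_mono) auto
      ultimately show "V x0 \<tau>0 * a + V x1 \<tau>1 * (1 - a) \<le> V x \<sigma> + q * d * \<Omega> d + e"
        using u(2) by (simp add: mult.commute)
    qed
    then show "a * V x0 \<tau>0 + (1 - a) * V x1 \<tau>1 - V (a *\<^sub>R x0 + (1 - a) *\<^sub>R x1) (a * \<tau>0 + (1 - a) * \<tau>1)
      \<le> a * (1 - a) * gap \<tau>0 x0 \<tau>1 x1 * \<Omega> (gap \<tau>0 x0 \<tau>1 x1)"
      by (simp add: x_def \<sigma>_def d_def q_def mult.commute)
  qed
qed

end

section \<open>The Hamilton-Jacobi-Bellman equation\<close>

lemma le_of_small_error:
  fixes X Y c h0 :: real
  assumes "h0 > 0" and le: "\<And>h. 0 < h \<Longrightarrow> h \<le> h0 \<Longrightarrow> X \<le> Y + c * h"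
  shows "X \<le> Y"
proof -
  have "((\<lambda>h. Y + c * h) \<longlongrightarrow> Y + c * 0) (at_right 0)" by (intro tendsto_intros)
  moreover have "\<forall>\<^sub>F h in at_right 0. X \<le> Y + c * h"
    using eventually_at_right[of 0 1 "\<lambda>h. X \<le> Y + c * h"] \<open>h0 > 0\<close> le by (auto intro!: exI[of _ h0])
  ultimately show ?thesis by (intro tendsto_lowerbound[of _ Y]) auto
qed

lemma Limsup_nonpos:
  fixes g :: "'a \<Rightarrow> real"
  assumes "\<And>e. e > 0 \<Longrightarrow> \<forall>\<^sub>F y in A. g y \<le> e"
  shows "Limsup A (\<lambda>y. ereal (g y)) \<le> 0"
  unfolding Limsup_le_iff
proof (intro allI impI)
  fix z :: ereal assume "z > 0"
  then obtain e :: real where e: "0 < ereal e" "ereal e < z" using ereal_dense2 by blast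
  then have "\<forall>\<^sub>F y in A. g y \<le> e" using assms by simp
  then show "\<forall>\<^sub>F y in A. ereal (g y) < z"
    by eventually_elim (use e(2) in \<open>metis ereal_less_eq(3) le_less_trans\<close>)
qed

lemma hamiltonian_inner: "hamiltonian f F x p u t = p \<bullet> f x u t - F x u t"
  by (simp add: hamiltonian_def inner_vec_def)

context control_system
begin

text \<open>Before the terminal time \<open>V\<close> is locally Lipschitz; near \<open>T\<close> it is squeezed to \<open>0\<close> by the length of the remaining
time interval.\<close>

theorem V_continuous: "continuous_on (UNIV \<times> {t0..T}) (\<lambda>(x, \<tau>). V x \<tau>)"
  unfolding continuous_on_iff
proof (intro ballI allI impI, clarify)
  fix x :: "real^'n" and \<tau> e :: real assume \<tau>: "\<tau> \<in> {t0..T}" and "e > 0"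
  define N where "N = norm x + 1"
  have near: "norm y \<le> N" "\<bar>s - \<tau>\<bar> \<le> dist (y, s) (x, \<tau>)" "norm (y - x) \<le> dist (y, s) (x, \<tau>)"
    if "dist (y, s) (x, \<tau>) \<le> 1" for y s
  proof -
    show "\<bar>s - \<tau>\<bar> \<le> dist (y, s) (x, \<tau>)" using dist_snd_le[of "(y, s)" "(x, \<tau>)"] by (simp add: dist_real_def)
    show "norm (y - x) \<le> dist (y, s) (x, \<tau>)" using dist_fst_le[of "(y, s)" "(x, \<tau>)"] by (simp add: dist_norm)
    with that norm_triangle_sub[of y x] show "norm y \<le> N" by (simp add: N_def)
  qed
  have "\<exists>d>0. \<forall>y. \<forall>s\<in>{t0..T}. dist (y, s) (x, \<tau>) < d \<longrightarrow> \<bar>V y s - V x \<tau>\<bar> < e"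
  proof (cases "\<tau> = T")
    case True
    obtain C where C: "C \<ge> 0" "\<And>x \<tau>. norm x \<le> N \<Longrightarrow> \<tau> \<in> {t0..T} \<Longrightarrow> \<bar>V x \<tau>\<bar> \<le> C * (T - \<tau>)"
      using V_bound by metis
    have "\<bar>V y s - V x \<tau>\<bar> < e" if s: "s \<in> {t0..T}" and d: "dist (y, s) (x, \<tau>) < min 1 (e / (C + 1))" for y s
    proof -
      have "\<bar>V y s\<bar> \<le> C * (T - s)" using C(2)[of y s] near(1)[of y s] d s by simp
      also have "\<dots> \<le> C * dist (y, s) (x, \<tau>)" using near(2)[of y s] d C True by (intro mult_left_mono) auto
      also have "\<dots> \<le> (C + 1) * dist (y, s) (x, \<tau>)" by (intro mult_right_mono) auto
      also have "\<dots> < e" using d C(1) by (simp add: pos_less_divide_eq mult.commute)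
      finally show ?thesis by (simp add: True V_terminal)
    qed
    then show ?thesis using C(1) \<open>e > 0\<close> by (intro exI[of _ "min 1 (e / (C + 1))"]) auto
  next
    case False
    define \<delta> where "\<delta> = (T - \<tau>) / 2"
    have \<delta>: "\<delta> > 0" "\<tau> + \<delta> = T - \<delta>" using False \<tau> by (auto simp: \<delta>_def field_simps)
    obtain K where K: "K \<ge> 0" "\<And>\<tau>0 \<tau>1 x0 x1. \<tau>0 \<in> {t0..T - \<delta>} \<Longrightarrow> \<tau>1 \<in> {t0..T - \<delta>} \<Longrightarrow>
       norm x0 \<le> N \<Longrightarrow> norm x1 \<le> N \<Longrightarrow> \<bar>V x0 \<tau>0 - V x1 \<tau>1\<bar> \<le> K * gap \<tau>0 x0 \<tau>1 x1"
      using V_lipschitz[OF \<delta>(1)] by metis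
    have "\<bar>V y s - V x \<tau>\<bar> < e" if s: "s \<in> {t0..T}" and d: "dist (y, s) (x, \<tau>) < min (min 1 \<delta>) (e / (2 * K + 1))" for y s
    proof -
      have d1: "dist (y, s) (x, \<tau>) \<le> 1" "dist (y, s) (x, \<tau>) < \<delta>" using d by auto
      have "\<bar>V y s - V x \<tau>\<bar> \<le> K * gap s y \<tau> x"
        using near[OF d1(1)] d1(2) \<delta> \<tau> s by (intro K(2)) (auto simp: N_def)
      also have "\<dots> \<le> K * (2 * dist (y, s) (x, \<tau>))" using near[OF d1(1)] K(1) by (intro mult_left_mono) auto
      also have "\<dots> \<le> (2 * K + 1) * dist (y, s) (x, \<tau>)" by (simp add: algebra_simps)
      also have "\<dots> < e" using d K(1) by (simp add: pos_less_divide_eq mult.commute)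
      finally show ?thesis .
    qed
    then show ?thesis using K(1) \<open>e > 0\<close> \<delta>(1) by (intro exI[of _ "min (min 1 \<delta>) (e / (2 * K + 1))"]) auto
  qed
  then show "\<exists>d>0. \<forall>z\<in>UNIV \<times> {t0..T}. dist z (x, \<tau>) < d \<longrightarrow> dist (case z of (x, \<tau>) \<Rightarrow> V x \<tau>) (V x \<tau>) < e"
    by (auto simp: dist_real_def)
qed

lemma hamiltonian_tendsto:
  assumes "xs \<longlonglongrightarrow> x" "ps \<longlonglongrightarrow> p" "us \<longlonglongrightarrow> u" "ts \<longlonglongrightarrow> t"
    "\<And>n. us n \<in> U" "u \<in> U" "\<And>n. ts n \<in> {t0..T}" "t \<in> {t0..T}"
  shows "(\<lambda>n. H (xs n) (ps n) (us n) (ts n)) \<longlonglongrightarrow> H x p u t"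
proof -
  have lim: "(\<lambda>n. (xs n, us n, ts n)) \<longlonglongrightarrow> (x, u, t)" by (intro tendsto_intros assms)
  have "(\<lambda>n. f (xs n) (us n) (ts n)) \<longlonglongrightarrow> f x u t"
    using continuous_on_tendsto_compose[OF continuous_f lim] assms by auto
  moreover have "(\<lambda>n. F (xs n) (us n) (ts n)) \<longlonglongrightarrow> F x u t"
    using continuous_on_tendsto_compose[OF continuous_F lim] assms by auto
  ultimately show ?thesis unfolding hamiltonian_inner by (intro tendsto_intros assms)
qed

lemma hamiltonian_maximizer:
  assumes "t \<in> {t0..T}"
  obtains u where "u \<in> U" "\<And>v. v \<in> U \<Longrightarrow> H x p v t \<le> H x p u t"
proof -
  have c: "continuous_on U (\<lambda>u. (x, u, t))" by (intro continuous_intros)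
  have "continuous_on U (\<lambda>u. f x u t)" "continuous_on U (\<lambda>u. F x u t)"
    using continuous_on_compose2[OF continuous_f c] continuous_on_compose2[OF continuous_F c] assms
    by (auto simp: image_subset_iff)
  then have "continuous_on U (\<lambda>u. H x p u t)"
    unfolding hamiltonian_inner by (intro continuous_intros)
  then show thesis using continuous_attains_sup[OF compact_U U_nonempty] that by metis
qed

text \<open>First-order expansion of a running cost plus a linear functional of the displacement, along all controls at once. Since the
data are Lipschitz in \<open>(x, t)\<close>, the integrand stays close to minus the Hamiltonian at \<open>(y, s)\<close>, with the control value
at the current time. The constants \<open>C\<close> and \<open>A\<close> are the same for all controls and initial times.\<close>

definition short_time_bounds :: "real^'n \<Rightarrow> real^'n \<Rightarrow> real \<Rightarrow> real \<Rightarrow> bool" where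
  "short_time_bounds y p C A \<longleftrightarrow> 0 \<le> C \<and> 0 \<le> A \<and>
     (\<forall>s u h. s \<in> {t0..T} \<and> u \<in> controls \<and> 0 \<le> h \<and> s + h \<le> T \<longrightarrow>
        norm (flow s u y (s + h) - y) \<le> C * h \<and>
        (\<forall>m. (\<forall>r. H y (- p) (u r) s \<le> m) \<longrightarrow>
          - m * h - A * h\<^sup>2 \<le> integral {s..s + h} (\<lambda>r. F (flow s u y r) (u r) r) + p \<bullet> (flow s u y (s + h) - y)) \<and>
        (\<forall>m. (\<forall>r. m \<le> H y (- p) (u r) s) \<longrightarrow>
          integral {s..s + h} (\<lambda>r. F (flow s u y r) (u r) r) + p \<bullet> (flow s u y (s + h) - y) \<le> - m * h + A * h\<^sup>2))"

lemma short_time_boundsD: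
  assumes "short_time_bounds y p C A"
  shows "C \<ge> 0" "A \<ge> 0"
    and "s \<in> {t0..T} \<Longrightarrow> u \<in> controls \<Longrightarrow> 0 \<le> h \<Longrightarrow> s + h \<le> T \<Longrightarrow> norm (flow s u y (s + h) - y) \<le> C * h"
    and "s \<in> {t0..T} \<Longrightarrow> u \<in> controls \<Longrightarrow> 0 \<le> h \<Longrightarrow> s + h \<le> T \<Longrightarrow>
      (\<And>r. H y (- p) (u r) s \<le> m) \<Longrightarrow>
      - m * h - A * h\<^sup>2 \<le> integral {s..s + h} (\<lambda>r. F (flow s u y r) (u r) r) + p \<bullet> (flow s u y (s + h) - y)"
    and "s \<in> {t0..T} \<Longrightarrow> u \<in> controls \<Longrightarrow> 0 \<le> h \<Longrightarrow> s + h \<le> T \<Longrightarrow>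
      (\<And>r. m \<le> H y (- p) (u r) s) \<Longrightarrow>
      integral {s..s + h} (\<lambda>r. F (flow s u y r) (u r) r) + p \<bullet> (flow s u y (s + h) - y) \<le> - m * h + A * h\<^sup>2"
  using assms unfolding short_time_bounds_def by blast+

lemma short_time_bounds_exist:
  obtains C A where "short_time_bounds y p C A"
proof -
  define R where "R = radius (norm y)"
  note R = radius[where N = "norm y", folded R_def]
  obtain C where C: "C > 0" "\<And>x u t. norm x \<le> R \<Longrightarrow> u \<in> U \<Longrightarrow> t \<in> {t0..T} \<Longrightarrow> norm (f x u t) \<le> C"
    using data_bounded[of R] by metis
  define l where "l = lip R"
  have l: "l \<ge> 0" using lip_nonneg[OF R(1)] by (simp add: l_def)
  define A where "A = (1 + norm p) * (l * (1 + C))"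
  have A: "A \<ge> 0" using l C(1) by (simp add: A_def)
  have move: "norm (flow s u y r - y) \<le> C * (r - s)"
    if s: "s \<in> {t0..T}" and u: "u \<in> controls" and r: "r \<in> {s..T}" for s u r
  proof -
    have "norm (flow s u y r - flow s u y s) \<le> C * (r - s)"
    proof (rule primitive_on_norm_diff_le[OF flow_solves[OF s u order_refl order_refl]])
      show "norm (f (flow s u y r') (u r') r') \<le> C" if "r' \<in> {s..r}" for r'
        using R(2)[of y s u r'] that r s u controlsD(1)[OF u] by (intro C(2)) auto
    qed (use r in auto)
    then show ?thesis by (simp add: flow_start[OF s u])
  qed
  have pt: "\<bar>F (flow s u y r) (u r) r + p \<bullet> f (flow s u y r) (u r) r + H y (- p) (u r) s\<bar> \<le> A * h"
    if s: "s \<in> {t0..T}" and u: "u \<in> controls" and h: "s + h \<le> T" and r: "r \<in> {s..s + h}" for s u r h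
  proof -
    let ?z = "flow s u y r"
    have z: "norm ?z \<le> R" "norm y \<le> R"
      using R(2)[of y s u r] R(2)[of y s u s] flow_start[OF s u, of y] s u r h by auto
    have rT: "r \<in> {t0..T}" using r s h by auto
    have "l * gap r ?z s y \<le> l * ((1 + C) * h)"
    proof (intro mult_left_mono l)
      have "C * (r - s) \<le> C * h" using r C(1) by (intro mult_left_mono) auto
      then show "gap r ?z s y \<le> (1 + C) * h"
        using move[OF s u, of r] r h by (auto simp: algebra_simps)
    qed
    then have d: "norm (f ?z (u r) r - f y (u r) s) \<le> l * ((1 + C) * h)" "\<bar>F ?z (u r) r - F y (u r) s\<bar> \<le> l * ((1 + C) * h)"
      using lip_f[OF z rT s controlsD(1)[OF u], of r] lip_F[OF z rT s controlsD(1)[OF u], of r] by (auto simp: l_def)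
    have "\<bar>p \<bullet> (f ?z (u r) r - f y (u r) s)\<bar> \<le> norm p * (l * ((1 + C) * h))"
      using Cauchy_Schwarz_ineq2[of p] d(1) by (meson mult_left_mono norm_ge_zero order_trans)
    then have "\<bar>(F ?z (u r) r - F y (u r) s) + p \<bullet> (f ?z (u r) r - f y (u r) s)\<bar> \<le> l * ((1 + C) * h) + norm p * (l * ((1 + C) * h))"
      using d(2) by linarith
    also have "\<dots> = A * h" by (simp add: A_def algebra_simps)
    finally show ?thesis by (simp add: hamiltonian_inner inner_diff_right algebra_simps)
  qed
  have int: "((\<lambda>r. F (flow s u y r) (u r) r + p \<bullet> f (flow s u y r) (u r) r) has_integral
      (integral {s..s + h} (\<lambda>r. F (flow s u y r) (u r) r) + p \<bullet> (flow s u y (s + h) - y))) {s..s + h}"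
    if s: "s \<in> {t0..T}" and u: "u \<in> controls" and h: "0 \<le> h" "s + h \<le> T" for s u h
  proof (intro has_integral_add)
    show "((\<lambda>r. F (flow s u y r) (u r) r) has_integral integral {s..s + h} (\<lambda>r. F (flow s u y r) (u r) r)) {s..s + h}"
      using flow_cost_integrable[OF s u, of s "s + h"] h by (intro integrable_integral) auto
    have "((\<lambda>r. f (flow s u y r) (u r) r) has_integral (flow s u y (s + h) - flow s u y s)) {s..s + h}"
      by (rule primitive_onD[OF flow_solves[OF s u order_refl order_refl]]) (use h in auto)
    from has_integral_linear[OF this bounded_linear_inner_right[of p]]
    show "((\<lambda>r. p \<bullet> f (flow s u y r) (u r) r) has_integral p \<bullet> (flow s u y (s + h) - y)) {s..s + h}"
      by (simp add: comp_def flow_start[OF s u])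
  qed
  have "short_time_bounds y p C A"
    unfolding short_time_bounds_def
  proof (intro conjI allI impI; (elim conjE)?)
    fix s u h assume s: "s \<in> {t0..T}" and u: "u \<in> controls" and h: "0 \<le> h" "s + h \<le> T"
    let ?I = "integral {s..s + h} (\<lambda>r. F (flow s u y r) (u r) r) + p \<bullet> (flow s u y (s + h) - y)"
    show "norm (flow s u y (s + h) - y) \<le> C * h" using move[OF s u, of "s + h"] h by simp
    have const: "((\<lambda>_. k) has_integral (k * h)) {s..s + h}" for k :: real
      using has_integral_const_real[of k s "s + h"] h by (simp add: mult.commute)
    show "- m * h - A * h\<^sup>2 \<le> ?I"
      if m: "\<forall>r. H y (- p) (u r) s \<le> m" for m
    proof -
      have "(- m - A * h) * h \<le> ?I"
      proof (rule has_integral_le[OF const int[OF s u h]])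
        show "- m - A * h \<le> F (flow s u y r) (u r) r + p \<bullet> f (flow s u y r) (u r) r" if "r \<in> {s..s + h}" for r
          using pt[OF s u h(2) that] m[rule_format, of r] by linarith
      qed
      then show ?thesis by (simp add: power2_eq_square algebra_simps)
    qed
    show "?I \<le> - m * h + A * h\<^sup>2"
      if m: "\<forall>r. m \<le> H y (- p) (u r) s" for m
    proof -
      have "?I \<le> (- m + A * h) * h"
      proof (rule has_integral_le[OF int[OF s u h] const])
        show "F (flow s u y r) (u r) r + p \<bullet> f (flow s u y r) (u r) r \<le> - m + A * h" if "r \<in> {s..s + h}" for r
          using pt[OF s u h(2) that] m[rule_format, of r] by linarith
      qed
      then show ?thesis by (simp add: power2_eq_square algebra_simps)
    qed
  qed (use C A in auto)
  then show thesis using that by blast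
qed

text \<open>The quadratic remainder makes these subgradients stable along trajectories of bounded
speed: a displacement of size \<open>O(h)\<close> in time \<open>h\<close> costs only \<open>O(h\<^sup>2)\<close>.\<close>

definition proximal_subgradient :: "real^'n \<Rightarrow> real \<Rightarrow> real^'n \<Rightarrow> real \<Rightarrow> bool" where
  "proximal_subgradient y s p q \<longleftrightarrow> (\<exists>\<kappa>\<ge>0. \<exists>\<rho>>0. \<forall>y' s'. norm (y' - y) \<le> \<rho> \<longrightarrow> \<bar>s' - s\<bar> \<le> \<rho> \<longrightarrow>
     V y s + p \<bullet> (y' - y) + q * (s' - s) - \<kappa> * ((norm (y' - y))\<^sup>2 + (s' - s)\<^sup>2) \<le> V y' s')"

text \<open>Minimise \<open>V\<close> plus \<open>\<kappa>\<close> times the squared distance to \<open>(x, \<tau>)\<close> over a small box. If \<open>\<kappa>\<close> is large, the minimiser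
lies in the interior, and there the derivative of the quadratic, with the opposite sign, is a subgradient of \<open>V\<close>.\<close>

lemma proximal_subgradient_dense:
  assumes \<tau>: "t0 < \<tau>" "\<tau> < T" and "e > 0"
  obtains y s p q where "norm (y - x) \<le> e" "\<bar>s - \<tau>\<bar> \<le> e" "t0 < s" "s < T" "proximal_subgradient y s p q"
proof -
  define \<rho> where "\<rho> = min e (min ((\<tau> - t0) / 2) ((T - \<tau>) / 2))"
  have \<rho>: "\<rho> > 0" "\<rho> \<le> e" "\<rho> < \<tau> - t0" "\<rho> < T - \<tau>" using assms by (auto simp: \<rho>_def min_def)
  let ?B = "cball x \<rho> \<times> {\<tau> - \<rho>..\<tau> + \<rho>}"
  have B: "compact ?B" "?B \<subseteq> UNIV \<times> {t0..T}" "(x, \<tau>) \<in> ?B" using \<rho> by (auto intro!: compact_Times)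
  have contV: "continuous_on ?B (\<lambda>(y, s). V y s)" using continuous_on_subset[OF V_continuous B(2)] .
  have "bounded ((\<lambda>(y, s). V y s) ` ?B)" by (intro compact_imp_bounded compact_continuous_image contV B)
  then obtain C where C: "C > 0" "\<And>y s. (y, s) \<in> ?B \<Longrightarrow> \<bar>V y s\<bar> \<le> C"
    unfolding bounded_pos by (metis (no_types, lifting) case_prod_conv image_eqI real_norm_def)
  \<comment> \<open>With this choice the quadratic exceeds the oscillation of \<open>V\<close> on the boundary of the box.\<close>
  define \<kappa> where "\<kappa> = (2 * C + 1) / \<rho>\<^sup>2"
  have \<kappa>: "\<kappa> \<ge> 0" "\<kappa> * \<rho>\<^sup>2 = 2 * C + 1" using C \<rho> by (auto simp: \<kappa>_def)
  define \<phi> where "\<phi> = (\<lambda>(y, s). V y s + \<kappa> * ((norm (y - x))\<^sup>2 + (s - \<tau>)\<^sup>2))"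
  have "continuous_on ?B \<phi>"
  proof -
    have "continuous_on ?B (\<lambda>z. (case z of (y, s) \<Rightarrow> V y s) + \<kappa> * ((norm (fst z - x))\<^sup>2 + (snd z - \<tau>)\<^sup>2))"
      by (intro continuous_intros contV)
    then show ?thesis by (simp add: \<phi>_def split_def)
  qed
  then obtain z where z: "z \<in> ?B" "\<And>z'. z' \<in> ?B \<Longrightarrow> \<phi> z \<le> \<phi> z'"
    using continuous_attains_inf[OF B(1), of \<phi>] B(3) by blast
  obtain y s where ys: "z = (y, s)" by (cases z)
  have "\<phi> z \<le> C" using z(2)[OF B(3)] C(2)[OF B(3)] by (simp add: \<phi>_def)
  moreover have "- C \<le> V y s" using C(2)[of y s] z(1) ys by auto
  ultimately have small: "\<kappa> * ((norm (y - x))\<^sup>2 + (s - \<tau>)\<^sup>2) < \<kappa> * \<rho>\<^sup>2" using \<kappa>(2) by (simp add: \<phi>_def ys)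
  then have "(norm (y - x))\<^sup>2 + (s - \<tau>)\<^sup>2 < \<rho>\<^sup>2" using \<kappa>(1) by (simp add: mult_less_cancel_left)
  then have "(norm (y - x))\<^sup>2 < \<rho>\<^sup>2" "\<bar>s - \<tau>\<bar>\<^sup>2 < \<rho>\<^sup>2"
    using zero_le_power2[of "norm (y - x)"] zero_le_power2[of "s - \<tau>"] unfolding power2_abs by linarith+
  then have int: "norm (y - x) < \<rho>" "\<bar>s - \<tau>\<bar> < \<rho>" using \<rho>(1) by (auto intro: power2_less_imp_less)
  let ?p = "- (2 * \<kappa>) *\<^sub>R (y - x)" and ?q = "- (2 * \<kappa>) * (s - \<tau>)"
  have "proximal_subgradient y s ?p ?q"
    unfolding proximal_subgradient_def
  proof (intro exI conjI allI impI)
    show "\<kappa> \<ge> 0" by (rule \<kappa>)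
    show "0 < min (\<rho> - norm (y - x)) (\<rho> - \<bar>s - \<tau>\<bar>)" using int by simp
    fix y' s' assume y': "norm (y' - y) \<le> min (\<rho> - norm (y - x)) (\<rho> - \<bar>s - \<tau>\<bar>)"
      and s': "\<bar>s' - s\<bar> \<le> min (\<rho> - norm (y - x)) (\<rho> - \<bar>s - \<tau>\<bar>)"
    have "norm (y' - x) \<le> \<rho>" using norm_triangle_ineq[of "y' - y" "y - x"] y' by simp
    then have "(y', s') \<in> ?B" using s' by (auto simp: dist_norm norm_minus_commute)
    from z(2)[OF this]
    have "V y s + \<kappa> * ((norm (y - x))\<^sup>2 + (s - \<tau>)\<^sup>2) \<le> V y' s' + \<kappa> * ((norm (y' - x))\<^sup>2 + (s' - \<tau>)\<^sup>2)"
      by (simp add: \<phi>_def ys)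
    moreover have "(norm (y' - x))\<^sup>2 = (norm (y - x))\<^sup>2 + 2 * ((y - x) \<bullet> (y' - y)) + (norm (y' - y))\<^sup>2"
      unfolding power2_norm_eq_inner by (simp add: inner_diff_left inner_diff_right inner_commute)
    moreover have "(s' - \<tau>)\<^sup>2 = (s - \<tau>)\<^sup>2 + 2 * ((s - \<tau>) * (s' - s)) + (s' - s)\<^sup>2"
      by (simp add: power2_eq_square algebra_simps)
    ultimately show "V y s + ?p \<bullet> (y' - y) + ?q * (s' - s) - \<kappa> * ((norm (y' - y))\<^sup>2 + (s' - s)\<^sup>2) \<le> V y' s'"
      unfolding inner_scaleR_left by (simp add: algebra_simps)
  qed
  then show thesis using that[of y s ?p ?q] int \<rho> by (auto simp: abs_le_iff abs_less_iff)
qed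

text \<open>Insert a control that is optimal up to \<open>h\<^sup>2\<close> into the dynamic programming inequality on \<open>[s, s + h]\<close>, bound
\<open>V\<close> at time \<open>s + h\<close> from below by the subgradient, divide by \<open>h\<close> and let \<open>h\<close> tend to \<open>0\<close>.\<close>

lemma proximal_subgradient_supersolution:
  assumes prox: "proximal_subgradient y s p q" and s: "t0 \<le> s" "s < T"
  obtains u where "u \<in> U" "q \<le> H y (- p) u s"
proof -
  obtain \<kappa> \<rho> where \<kappa>: "\<kappa> \<ge> 0" "\<rho> > 0" "\<And>y' s'. norm (y' - y) \<le> \<rho> \<Longrightarrow> \<bar>s' - s\<bar> \<le> \<rho> \<Longrightarrow>
     V y s + p \<bullet> (y' - y) + q * (s' - s) - \<kappa> * ((norm (y' - y))\<^sup>2 + (s' - s)\<^sup>2) \<le> V y' s'"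
    using prox unfolding proximal_subgradient_def by metis
  obtain C A where bounds: "short_time_bounds y p C A" using short_time_bounds_exist by blast
  note C = short_time_boundsD(1)[OF bounds] and move = short_time_boundsD(3)[OF bounds] and lower = short_time_boundsD(4)[OF bounds]
  have s': "s \<in> {t0..T}" using s by simp
  obtain v where v: "v \<in> U" "\<And>w. w \<in> U \<Longrightarrow> H y (- p) w s \<le> H y (- p) v s"
    using hamiltonian_maximizer[OF s'] by metis
  define h0 where "h0 = min (T - s) (\<rho> / (C + 1))"
  have "q \<le> H y (- p) v s"
  proof (rule le_of_small_error)
    show "h0 > 0" using s \<kappa> C by (simp add: h0_def)
    fix h assume h: "0 < h" "h \<le> h0"
    have hT: "s + h \<le> T" using h by (simp add: h0_def)
    have "h \<le> \<rho> / (C + 1)" using h by (simp add: h0_def)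
    then have h\<rho>: "h \<le> \<rho>" "C * h \<le> \<rho>" using C h(1) by (auto simp: pos_le_divide_eq algebra_simps intro: order_trans[rotated])
    obtain u where u: "u \<in> controls" "cost s u y < V y s + h\<^sup>2"
      using near_optimal_control[OF s', of "h\<^sup>2" y] h by (metis zero_less_power)
    let ?z = "flow s u y (s + h)" and ?I = "integral {s..s + h} (\<lambda>r. F (flow s u y r) (u r) r)"
    have z: "norm (?z - y) \<le> C * h" using move[OF s' u(1)] h hT by simp
    have "V y s + p \<bullet> (?z - y) + q * h - \<kappa> * ((norm (?z - y))\<^sup>2 + h\<^sup>2) \<le> V ?z (s + h)"
      using \<kappa>(3)[of ?z "s + h"] z h\<rho> h by simp
    moreover have "?I + V ?z (s + h) \<le> cost s u y"
      using V_dynamic_lower[OF s' u(1), of "s + h"] h hT by simp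
    moreover have "- H y (- p) v s * h - A * h\<^sup>2 \<le> ?I + p \<bullet> (?z - y)"
      using lower[OF s' u(1) _ hT v(2)[OF controlsD(1)[OF u(1)]]] h by simp
    moreover have "\<kappa> * ((norm (?z - y))\<^sup>2 + h\<^sup>2) \<le> \<kappa> * ((C * h)\<^sup>2 + h\<^sup>2)"
      using z \<kappa>(1) h C by (intro mult_left_mono add_mono power_mono) auto
    ultimately have "q * h \<le> H y (- p) v s * h + (1 + A + \<kappa> * (C\<^sup>2 + 1)) * h\<^sup>2"
      using u(2) by (simp add: algebra_simps power_mult_distrib)
    then have "q * h \<le> (H y (- p) v s + (1 + A + \<kappa> * (C\<^sup>2 + 1)) * h) * h"
      by (simp add: algebra_simps power2_eq_square)
    then show "q \<le> H y (- p) v s + (1 + A + \<kappa> * (C\<^sup>2 + 1)) * h"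
      using h by simp
  qed
  then show thesis using that v(1) by blast
qed

text \<open>The same computation with the constant control \<open>v\<close>, for which dynamic programming bounds \<open>V y s\<close> from above. The
argument \<open>2 d\<close> of \<open>\<Omega>\<close> anticipates the form in which supergradients are obtained below.\<close>

lemma supergradient_subsolution:
  assumes super: "\<And>y' s'. norm (y' - y) \<le> \<rho> \<Longrightarrow> s' \<in> {s..s + \<rho>} \<Longrightarrow>
      V y' s' \<le> V y s + p \<bullet> (y' - y) + q * (s' - s) + gap s' y' s y * \<Omega> (2 * gap s' y' s y)"
    and \<Omega>: "\<And>d D. 0 \<le> d \<Longrightarrow> d \<le> D \<Longrightarrow> \<Omega> d \<le> \<Omega> D" "(\<Omega> \<longlongrightarrow> 0) (at_right (0::real))" "\<And>d. 0 \<le> d \<Longrightarrow> 0 \<le> \<Omega> d"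
    and "\<rho> > 0" and s: "t0 \<le> s" "s < T" and v: "v \<in> U"
  shows "H y (- p) v s \<le> q"
proof -
  obtain C A where bounds: "short_time_bounds y p C A" using short_time_bounds_exist by blast
  note C = short_time_boundsD(1)[OF bounds] and move = short_time_boundsD(3)[OF bounds] and upper = short_time_boundsD(5)[OF bounds]
  have s': "s \<in> {t0..T}" using s by simp
  note u = const_control[OF v]
  let ?H = "H y (- p) v s"
  define h0 where "h0 = min (T - s) (\<rho> / (C + 1))"
  have h0: "h0 > 0" using s \<open>\<rho> > 0\<close> C by (simp add: h0_def)
  define k where "k = 2 * (1 + C)"
  have "?H \<le> q + A * h + (1 + C) * \<Omega> (k * h)" if h: "0 < h" "h < h0" for h
  proof -
    have hT: "s + h \<le> T" using h by (simp add: h0_def)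
    have "h \<le> \<rho> / (C + 1)" using h by (simp add: h0_def)
    then have h\<rho>: "h \<le> \<rho>" "C * h \<le> \<rho>" using C h(1) by (auto simp: pos_le_divide_eq algebra_simps intro: order_trans[rotated])
    let ?z = "flow s (\<lambda>_. v) y (s + h)" and ?I = "integral {s..s + h} (\<lambda>r. F (flow s (\<lambda>_. v) y r) v r)"
    have z: "norm (?z - y) \<le> C * h" using move[OF s' u] h hT by simp
    have d: "h + norm (?z - y) \<le> (1 + C) * h" using z by (simp add: algebra_simps)
    have "V y s \<le> ?I + V ?z (s + h)" using V_dynamic_upper[OF s' u, of "s + h"] h hT by simp
    moreover have "V ?z (s + h) \<le> V y s + p \<bullet> (?z - y) + q * h + (h + norm (?z - y)) * \<Omega> (2 * (h + norm (?z - y)))"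
      using super[of ?z "s + h"] z h\<rho> h by simp
    moreover have "(h + norm (?z - y)) * \<Omega> (2 * (h + norm (?z - y))) \<le> ((1 + C) * h) * \<Omega> (k * h)"
    proof (intro mult_mono[OF d])
      show "\<Omega> (2 * (h + norm (?z - y))) \<le> \<Omega> (k * h)"
        using d h by (intro \<Omega>(1)) (auto simp: k_def algebra_simps)
    qed (use h C in \<open>auto intro: \<Omega>(3)\<close>)
    moreover have "?I + p \<bullet> (?z - y) \<le> - ?H * h + A * h\<^sup>2"
      using upper[OF s' u _ hT, of ?H] h by simp
    ultimately have "?H * h \<le> q * h + A * h\<^sup>2 + (1 + C) * h * \<Omega> (k * h)" by simp
    then have "?H * h \<le> (q + A * h + (1 + C) * \<Omega> (k * h)) * h" by (simp add: algebra_simps power2_eq_square)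
    then show ?thesis using h by simp
  qed
  then have "\<forall>\<^sub>F h in at_right 0. ?H \<le> q + A * h + (1 + C) * \<Omega> (k * h)"
    using eventually_at_right[of 0 1 "\<lambda>h. ?H \<le> q + A * h + (1 + C) * \<Omega> (k * h)"] h0 by (auto intro!: exI[of _ h0])
  moreover have "((\<lambda>h. q + A * h + (1 + C) * \<Omega> (k * h)) \<longlongrightarrow> q + A * 0 + (1 + C) * 0) (at_right 0)"
  proof (intro tendsto_intros)
    have "k > 0" using C by (simp add: k_def)
    from filterlim_compose[OF \<Omega>(2) filterlim_scale_at_right_0[OF this]] show "((\<lambda>h. \<Omega> (k * h)) \<longlongrightarrow> 0) (at_right 0)" .
  qed
  ultimately show ?thesis by (intro tendsto_lowerbound[of _ q]) auto
qed

text \<open>A maximiser of the Hamiltonian with \<open>p = 0\<close> minimises \<open>F x u T\<close> over \<open>u\<close>. Used as a constant control from time \<open>t\<close> on, it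
bounds \<open>V x t\<close> by \<open>(T - t) F x u T\<close> up to an error of second order.\<close>

lemma extended_solution_at_terminal_time:
  obtains u where "u \<in> U" "\<And>v. v \<in> U \<Longrightarrow> H x 0 v T \<le> H x 0 u T"
    "0 \<in> superdiff_x V x T" "H x 0 u T \<in> superdiff_t t0 T V x T"
proof -
  have TT: "T \<in> {t0..T}" using t0_less_T by simp
  obtain u where u: "u \<in> U" "\<And>v. v \<in> U \<Longrightarrow> H x 0 v T \<le> H x 0 u T"
    using hamiltonian_maximizer[OF TT] by metis
  obtain C A where bounds: "short_time_bounds x 0 C A" using short_time_bounds_exist by blast
  note A = short_time_boundsD(2)[OF bounds] and upper = short_time_boundsD(5)[OF bounds]
  define l where "l = lip (norm x)"
  have l: "l \<ge> 0" by (simp add: l_def lip_nonneg)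
  let ?q = "H x 0 u T"
  have est: "V x t \<le> - ?q * (T - t) + (l + A) * (T - t)\<^sup>2" if t: "t \<in> {t0..T}" for t
  proof -
    have "\<bar>F x u t - F x u T\<bar> \<le> l * (T - t)"
      using lip_F[of x "norm x" x t T u] t TT u by (simp add: l_def)
    then have "?q - l * (T - t) \<le> H x 0 u t" by (simp add: hamiltonian_inner)
    then have "integral {t..T} (\<lambda>r. F (flow t (\<lambda>_. u) x r) u r) \<le> - (?q - l * (T - t)) * (T - t) + A * (T - t)\<^sup>2"
      using upper[OF t const_control[OF u(1)], of "T - t" "?q - l * (T - t)"] t by simp
    moreover have "V x t \<le> integral {t..T} (\<lambda>r. F (flow t (\<lambda>_. u) x r) u r)"
      using V_dynamic_upper[OF t const_control[OF u(1)], of T x] t by (simp add: V_terminal)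
    ultimately show ?thesis by (simp add: algebra_simps power2_eq_square)
  qed
  have "0 \<in> superdiff_x V x T"
    unfolding superdiff_x_def by (auto intro!: Limsup_nonpos simp: V_terminal)
  moreover have "?q \<in> superdiff_t t0 T V x T"
    unfolding superdiff_t_def
  proof (rule CollectI, rule Limsup_nonpos)
    fix e :: real assume "e > 0"
    have "\<forall>\<^sub>F t in at T within {t0..T}. t \<in> {t0..T} \<and> t \<noteq> T \<and> dist t T < e / (l + A + 1)"
      using l A(1) \<open>e > 0\<close> by (auto simp: eventually_at intro!: exI[of _ "e / (l + A + 1)"])
    then show "\<forall>\<^sub>F t in at T within {t0..T}. (V x t - V x T - ?q * (t - T)) / \<bar>t - T\<bar> \<le> e"
    proof eventually_elim
      case (elim t)
      then have h: "T - t > 0" "T - t < e / (l + A + 1)" by (auto simp: dist_real_def)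
      have "V x t - V x T - ?q * (t - T) \<le> (l + A) * (T - t) * (T - t)"
        using est[of t] elim by (simp add: V_terminal algebra_simps power2_eq_square)
      also have "\<dots> \<le> e * (T - t)"
      proof (intro mult_right_mono)
        have "(l + A) * (T - t) \<le> (l + A + 1) * (T - t)" using h by (intro mult_right_mono) auto
        also have "\<dots> \<le> e" using h l A(1) by (simp add: pos_less_divide_eq mult.commute)
        finally show "(l + A) * (T - t) \<le> e" .
      qed (use h in simp)
      finally show ?case using h by (simp add: pos_divide_le_eq)
    qed
  qed
  ultimately show thesis using that u by blast
qed

end

context semiconcave_control_system
begin

text \<open>Write \<open>(y, s)\<close> as a convex combination of \<open>(x, \<tau>)\<close> and its mirror image in \<open>(y, s)\<close>, scaled by \<open>h\<close>. Semiconcavity bounds the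
weighted mean of the two values from above, while the subgradient bounds the value at the mirror image from below. Solving
for \<open>V x \<tau>\<close> leaves an error \<open>O(h)\<close> besides the semiconcavity defect, whose argument \<open>(1 + h) d\<close> is at most \<open>2 d\<close>.\<close>

lemma proximal_subgradient_is_supergradient:
  assumes prox: "proximal_subgradient y s p q" and semi: "semiconcave_V N T' \<Omega>"
    and y: "norm y < N" and s: "t0 < s" "s < T'" and x: "norm x \<le> N" and \<tau>: "\<tau> \<in> {t0..T'}"
  shows "V x \<tau> \<le> V y s + p \<bullet> (x - y) + q * (\<tau> - s) + gap \<tau> x s y * \<Omega> (2 * gap \<tau> x s y)"
proof -
  obtain \<kappa> \<rho> where \<kappa>: "\<kappa> \<ge> 0" "\<rho> > 0" "\<And>y' s'. norm (y' - y) \<le> \<rho> \<Longrightarrow> \<bar>s' - s\<bar> \<le> \<rho> \<Longrightarrow>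
     V y s + p \<bullet> (y' - y) + q * (s' - s) - \<kappa> * ((norm (y' - y))\<^sup>2 + (s' - s)\<^sup>2) \<le> V y' s'"
    using prox unfolding proximal_subgradient_def by metis
  define d where "d = gap \<tau> x s y"
  have d: "d \<ge> 0" "\<bar>\<tau> - s\<bar> \<le> d" "norm (x - y) \<le> d" by (auto simp: d_def)
  have \<Omega>: "\<Omega> d \<le> \<Omega> D" if "0 \<le> d" "d \<le> D" for d D using semi that unfolding semiconcave_V_def by blast
  define \<eta> where "\<eta> = min \<rho> (min (N - norm y) (min (s - t0) (T' - s)))"
  have \<eta>: "\<eta> > 0" "\<eta> \<le> \<rho>" "\<eta> \<le> N - norm y" "\<eta> \<le> s - t0" "\<eta> \<le> T' - s" using \<kappa> y s by (auto simp: \<eta>_def)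
  define h0 where "h0 = min 1 (\<eta> / (d + 1))"
  let ?c = "\<kappa> * ((norm (x - y))\<^sup>2 + (\<tau> - s)\<^sup>2)"
  have "V x \<tau> \<le> (V y s + p \<bullet> (x - y) + q * (\<tau> - s) + d * \<Omega> (2 * d))"
  proof (rule le_of_small_error)
    show "h0 > 0" using \<eta>(1) d by (simp add: h0_def)
    fix h assume h: "0 < h" "h \<le> h0"
    have h1: "h \<le> 1" using h by (simp add: h0_def)
    have "h \<le> \<eta> / (d + 1)" using h by (simp add: h0_def)
    then have "h * d + h \<le> \<eta>" using d by (simp add: pos_le_divide_eq algebra_simps)
    then have hd: "h * d \<le> \<eta>" using h by simp
    define y1 where "y1 = y - h *\<^sub>R (x - y)"
    define s1 where "s1 = s - h * (\<tau> - s)"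
    have n1: "norm (y1 - y) \<le> \<eta>" "\<bar>s1 - s\<bar> \<le> \<eta>"
      using order_trans[OF mult_left_mono[OF d(3), of h] hd] order_trans[OF mult_left_mono[OF d(2), of h] hd] h
      by (auto simp: y1_def s1_def abs_mult)
    define a where "a = h / (1 + h)"
    have a: "a \<in> {0..1}" "a * (1 + h) = h" "(1 - a) * (1 + h) = 1" using h by (auto simp: a_def divide_simps)
    have e1: "a *\<^sub>R x + (1 - a) *\<^sub>R y1 = y"
    proof -
      have "a *\<^sub>R x + (1 - a) *\<^sub>R y1 = (a - (1 - a) * h) *\<^sub>R x + ((1 - a) * (1 + h)) *\<^sub>R y"
        by (simp add: y1_def algebra_simps)
      moreover have "a - (1 - a) * h = 0" using a(2) by (simp add: algebra_simps)
      ultimately show ?thesis by (simp add: a(3))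
    qed
    have e2: "a * \<tau> + (1 - a) * s1 = s"
    proof -
      have "a * \<tau> + (1 - a) * s1 = (a - (1 - a) * h) * \<tau> + ((1 - a) * (1 + h)) * s"
        by (simp add: s1_def algebra_simps)
      moreover have "a - (1 - a) * h = 0" using a(2) by (simp add: algebra_simps)
      ultimately show ?thesis by (simp add: a(3))
    qed
    have d': "gap \<tau> x s1 y1 = (1 + h) * d"
    proof -
      have "\<tau> - s1 = (1 + h) * (\<tau> - s)" "x - y1 = (1 + h) *\<^sub>R (x - y)" by (simp_all add: s1_def y1_def algebra_simps)
      then show ?thesis using h by (simp add: abs_mult d_def distrib_left)
    qed
    have "norm y1 \<le> N" using norm_triangle_sub[of y1 y] n1 \<eta> by simp
    moreover have "s1 \<in> {t0..T'}" using n1 \<eta> by (auto simp: abs_le_iff)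
    ultimately have "a * V x \<tau> + (1 - a) * V y1 s1 - V y s \<le> a * (1 - a) * ((1 + h) * d) * \<Omega> ((1 + h) * d)"
      using semi[unfolded semiconcave_V_def] a(1) \<tau> x by (metis d' e1 e2)
    then have "(1 + h) * (a * V x \<tau> + (1 - a) * V y1 s1 - V y s) \<le> (1 + h) * (a * (1 - a) * ((1 + h) * d) * \<Omega> ((1 + h) * d))"
      using h by (intro mult_left_mono) auto
    also have "\<dots> = (a * (1 + h)) * ((1 - a) * (1 + h)) * (d * \<Omega> ((1 + h) * d))" by (simp add: mult_ac)
    also have "\<dots> = h * (d * \<Omega> ((1 + h) * d))" by (simp add: a)
    also have "\<dots> \<le> h * (d * \<Omega> (2 * d))"
      using h h1 d by (intro mult_left_mono \<Omega>) (auto intro: mult_right_mono)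
    also have "(1 + h) * (a * V x \<tau> + (1 - a) * V y1 s1 - V y s) =
        (a * (1 + h)) * V x \<tau> + ((1 - a) * (1 + h)) * V y1 s1 - (1 + h) * V y s" by (simp add: algebra_simps)
    finally have le: "h * V x \<tau> + V y1 s1 - (1 + h) * V y s \<le> h * (d * \<Omega> (2 * d))" by (simp add: a)
    have "V y s + p \<bullet> (y1 - y) + q * (s1 - s) - \<kappa> * ((norm (y1 - y))\<^sup>2 + (s1 - s)\<^sup>2) \<le> V y1 s1"
      using \<kappa>(3) n1 \<eta> by (meson order_trans)
    moreover have "p \<bullet> (y1 - y) = - (h * (p \<bullet> (x - y)))" by (simp add: y1_def)
    moreover have "q * (s1 - s) = - (h * (q * (\<tau> - s)))" by (simp add: s1_def)
    moreover have "\<kappa> * ((norm (y1 - y))\<^sup>2 + (s1 - s)\<^sup>2) = ?c * h * h"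
    proof -
      have "norm (y1 - y) = h * norm (x - y)" "s1 - s = - (h * (\<tau> - s))"
        using h by (simp_all add: y1_def s1_def)
      then show ?thesis by (simp add: power_mult_distrib power2_eq_square distrib_left mult_ac)
    qed
    ultimately have "h * V x \<tau> \<le> h * V y s + h * (p \<bullet> (x - y)) + h * (q * (\<tau> - s)) + h * (d * \<Omega> (2 * d)) + ?c * h * h"
      using le by (simp add: algebra_simps)
    then have "h * V x \<tau> \<le> h * ((V y s + p \<bullet> (x - y) + q * (\<tau> - s) + d * \<Omega> (2 * d)) + ?c * h)"
      by (simp add: algebra_simps)
    then show "V x \<tau> \<le> (V y s + p \<bullet> (x - y) + q * (\<tau> - s) + d * \<Omega> (2 * d)) + ?c * h"
      using h by simp
  qed
  then show ?thesis by (simp add: d_def)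
qed

text \<open>The points \<open>(y n, s n)\<close> carry proximal subgradients and converge to \<open>(x, \<tau>)\<close>; they are chosen to the right of \<open>\<tau>\<close>, so that \<open>\<tau> = t0\<close> is
included. The supergradient inequality, tested at distance \<open>1\<close> from \<open>y n\<close> in the direction of \<open>- p n\<close>, bounds \<open>p n\<close>, and the
equation then bounds \<open>q n\<close>. Along a convergent subsequence the supergradient inequality becomes \<open>upper\<close>, which contains
both partial superdifferentials at \<open>(x, \<tau>)\<close>, and the two inequalities for the Hamiltonian become the maximum condition
together with the equation.\<close>

theorem extended_solution_before_terminal_time:
  assumes \<tau>: "\<tau> \<in> {t0..<T}"
  obtains p u where "u \<in> U" "p \<in> superdiff_x V x \<tau>"
    "\<And>v. v \<in> U \<Longrightarrow> H x (- p) v \<tau> \<le> H x (- p) u \<tau>"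
    "H x (- p) u \<tau> \<in> superdiff_t t0 T V x \<tau>"
proof -
  define \<delta> where "\<delta> = (T - \<tau>) / 2"
  have \<delta>: "\<delta> > 0" "T - \<delta> = \<tau> + \<delta>" using \<tau> by (auto simp: \<delta>_def field_simps)
  \<comment> \<open>The ball has to contain, besides the points near \<open>x\<close>, all points at distance \<open>1\<close> from them.\<close>
  define N where "N = norm x + 3"
  define T' where "T' = T - \<delta>"
  obtain \<Omega> where semi: "semiconcave_V N T' \<Omega>"
    unfolding T'_def using V_semiconcave[OF \<delta>(1), of N] by metis
  then have \<Omega>: "\<And>d. 0 \<le> d \<Longrightarrow> 0 \<le> \<Omega> d" "\<And>d D. 0 \<le> d \<Longrightarrow> d \<le> D \<Longrightarrow> \<Omega> d \<le> \<Omega> D" "(\<Omega> \<longlongrightarrow> 0) (at_right 0)"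
    unfolding semiconcave_V_def by blast+
  \<comment> \<open>For these \<open>e n\<close> the interval of radius \<open>e n / 2\<close> around \<open>\<tau> + e n\<close> lies between \<open>t0\<close> and \<open>T'\<close>.\<close>
  define e where "e n = min 1 (\<delta> / 4) * inverse (real (Suc n))" for n
  have e: "e n > 0" "e n \<le> 1" "e n \<le> \<delta> / 4" for n
  proof -
    have i: "0 < inverse (real (Suc n))" "inverse (real (Suc n)) \<le> 1" by (auto simp: divide_simps)
    show "e n > 0" using i \<delta> by (simp add: e_def)
    have "e n \<le> min 1 (\<delta> / 4) * 1" unfolding e_def using i \<delta> by (intro mult_left_mono) auto
    then show "e n \<le> 1" "e n \<le> \<delta> / 4" by auto
  qed
  have e_lim: "e \<longlonglongrightarrow> 0"
    unfolding e_def using tendsto_mult_right_zero[OF LIMSEQ_inverse_real_of_nat] by simp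
  have "\<exists>y s p q. norm (y - x) \<le> e n \<and> \<bar>s - \<tau>\<bar> \<le> 2 * e n \<and> t0 < s \<and> s < T' \<and> proximal_subgradient y s p q" for n
  proof -
    have "t0 < \<tau> + e n" "\<tau> + e n < T" using e[of n] \<tau> \<delta> by auto
    then obtain y s p q where *: "norm (y - x) \<le> e n / 2" "\<bar>s - (\<tau> + e n)\<bar> \<le> e n / 2" "proximal_subgradient y s p q"
      using proximal_subgradient_dense[of "\<tau> + e n" "e n / 2" x] e(1)[of n] by (metis half_gt_zero)
    have s: "\<tau> + e n / 2 \<le> s" "s \<le> \<tau> + e n + e n / 2" using abs_le_D1[OF *(2)] abs_le_D2[OF *(2)] by (simp_all add: field_simps)
    have "norm (y - x) \<le> e n" "\<bar>s - \<tau>\<bar> \<le> 2 * e n" using *(1) s e(1)[of n] by (auto simp: abs_le_iff)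
    moreover have "t0 < s" using s e(1)[of n] \<tau> by auto
    moreover have "s < T'" using s e(1,3)[of n] \<delta> unfolding T'_def by linarith
    ultimately show ?thesis using *(3) by blast
  qed
  then obtain y s p q where ys: "\<And>n. norm (y n - x) \<le> e n" "\<And>n. \<bar>s n - \<tau>\<bar> \<le> 2 * e n" "\<And>n. t0 < s n" "\<And>n. s n < T'"
    and prox: "\<And>n. proximal_subgradient (y n) (s n) (p n) (q n)" by metis
  have sT: "s n < T" "s n \<in> {t0..T}" for n using ys(3,4)[of n] \<delta> by (auto simp: T'_def)
  have yn: "norm (y n) \<le> norm x + 1" "norm (y n) < N" for n
    using norm_triangle_sub[of "y n" x] ys(1)[of n] e(2)[of n] by (auto simp: N_def)
  have super: "V x' \<tau>' \<le> V (y n) (s n) + p n \<bullet> (x' - y n) + q n * (\<tau>' - s n)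
      + gap \<tau>' x' (s n) (y n) * \<Omega> (2 * gap \<tau>' x' (s n) (y n))"
    if "norm x' \<le> N" "\<tau>' \<in> {t0..T'}" for n x' \<tau>'
    by (rule proximal_subgradient_is_supergradient[OF prox semi yn(2) ys(3,4) that])
  have "\<exists>u. u \<in> U \<and> q n \<le> H (y n) (- p n) u (s n)" for n
    using proximal_subgradient_supersolution[OF prox _ sT(1), of n] ys(3)[of n] by (metis less_imp_le)
  then obtain u where u: "\<And>n. u n \<in> U" "\<And>n. q n \<le> H (y n) (- p n) (u n) (s n)" by metis
  have sub: "H (y n) (- p n) v (s n) \<le> q n" if v: "v \<in> U" for n v
  proof (rule supergradient_subsolution[where \<rho> = "min 1 (T' - s n)" and \<Omega> = \<Omega>])
    fix y' s' assume "norm (y' - y n) \<le> min 1 (T' - s n)" "s' \<in> {s n..s n + min 1 (T' - s n)}"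
    then have "norm y' \<le> N" "s' \<in> {t0..T'}"
      using norm_triangle_sub[of y' "y n"] yn(1)[of n] ys(3)[of n] by (auto simp: N_def)
    then show "V y' s' \<le> V (y n) (s n) + p n \<bullet> (y' - y n) + q n * (s' - s n)
      + gap s' y' (s n) (y n) * \<Omega> (2 * gap s' y' (s n) (y n))" by (rule super)
  qed (use \<Omega> ys(3,4)[of n] sT(1)[of n] v in auto)
  obtain C' where C': "C' \<ge> 0" "\<And>x \<tau>. norm x \<le> N \<Longrightarrow> \<tau> \<in> {t0..T} \<Longrightarrow> \<bar>V x \<tau>\<bar> \<le> C' * (T - \<tau>)"
    using V_bound by metis
  obtain C where C: "C > 0" "\<And>x u t. norm x \<le> N \<Longrightarrow> u \<in> U \<Longrightarrow> t \<in> {t0..T} \<Longrightarrow> norm (f x u t) \<le> C \<and> \<bar>F x u t\<bar> \<le> C"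
    using data_bounded by metis
  define P where "P = 2 * (C' * (T - t0)) + \<Omega> 2"
  have p_bound: "norm (p n) \<le> P" for n
  proof (cases "p n = 0")
    case True
    then show ?thesis using C'(1) \<Omega>(1)[of 2] t0_less_T by (simp add: P_def)
  next
    case False
    let ?x = "y n - (1 / norm (p n)) *\<^sub>R p n"
    have n1: "norm (?x - y n) = 1" using False by simp
    then have xN: "norm ?x \<le> N" using norm_triangle_sub[of ?x "y n"] yn(1)[of n] by (simp add: N_def)
    have "p n \<bullet> (?x - y n) = - norm (p n)"
      using False by (simp add: power2_norm_eq_inner[symmetric] power2_eq_square)
    then have "V ?x (s n) \<le> V (y n) (s n) - norm (p n) + \<Omega> 2"
      using super[OF xN, of "s n" n] ys(3,4)[of n] n1 by simp
    moreover have V: "\<bar>V z (s n)\<bar> \<le> C' * (T - t0)" if "norm z \<le> N" for z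
    proof -
      have "\<bar>V z (s n)\<bar> \<le> C' * (T - s n)" using C'(2)[OF that sT(2)] .
      also have "\<dots> \<le> C' * (T - t0)" using ys(3)[of n] C'(1) by (intro mult_left_mono) auto
      finally show ?thesis .
    qed
    ultimately show ?thesis using V[OF xN] V[OF less_imp_le[OF yn(2)], of n] by (simp add: P_def)
  qed
  have "P \<ge> 0" using p_bound[of 0] norm_ge_zero order_trans by blast
  have H_bound: "\<bar>H (y n) (- p n) v (s n)\<bar> \<le> P * C + C" if "v \<in> U" for n v
  proof -
    have b: "norm (f (y n) v (s n)) \<le> C" "\<bar>F (y n) v (s n)\<bar> \<le> C"
      using C(2)[OF less_imp_le[OF yn(2)] that sT(2)] by auto
    have "\<bar>(- p n) \<bullet> f (y n) v (s n)\<bar> \<le> norm (- p n) * norm (f (y n) v (s n))" by (rule Cauchy_Schwarz_ineq2)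
    also have "\<dots> \<le> P * C" using p_bound[of n] b(1) \<open>P \<ge> 0\<close> by (intro mult_mono) auto
    finally show ?thesis using b(2) unfolding hamiltonian_inner by linarith
  qed
  have q_bound: "\<bar>q n\<bar> \<le> P * C + C" for n
    using u(2)[of n] sub[OF u(1), of n n] H_bound[OF u(1), of n n] by linarith
  have K: "compact (cball (0::real^'n) P \<times> cball (0::real) (P * C + C) \<times> U)"
    by (intro compact_Times compact_cball compact_U)
  have inK: "(p n, q n, u n) \<in> cball 0 P \<times> cball 0 (P * C + C) \<times> U" for n
    using p_bound q_bound u(1) by simp
  obtain lim r where lim: "lim \<in> cball 0 P \<times> cball 0 (P * C + C) \<times> U" "strict_mono (r :: nat \<Rightarrow> nat)"
    "((\<lambda>n. (p n, q n, u n)) \<circ> r) \<longlonglongrightarrow> lim"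
    using K[unfolded compact_def, rule_format, of "\<lambda>n. (p n, q n, u n)"] inK by blast
  obtain p' q' u' where l: "lim = (p', q', u')" by (cases lim)
  have u': "u' \<in> U" using lim(1) l by simp
  have limp: "(\<lambda>n. p (r n)) \<longlonglongrightarrow> p'" and limq: "(\<lambda>n. q (r n)) \<longlonglongrightarrow> q'" and limu: "(\<lambda>n. u (r n)) \<longlonglongrightarrow> u'"
    using tendsto_fst[OF lim(3)] tendsto_fst[OF tendsto_snd[OF lim(3)]] tendsto_snd[OF tendsto_snd[OF lim(3)]]
    by (simp_all add: l comp_def)
  have er: "(\<lambda>n. e (r n)) \<longlonglongrightarrow> 0" using LIMSEQ_subseq_LIMSEQ[OF e_lim lim(2)] by (simp add: comp_def)
  have limy: "(\<lambda>n. y (r n)) \<longlonglongrightarrow> x"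
    by (rule LIM_zero_cancel, rule Lim_null_comparison[OF _ er]) (use ys(1) in auto)
  have er2: "(\<lambda>n. 2 * e (r n)) \<longlonglongrightarrow> 0" using tendsto_mult_right_zero[OF er] .
  have lims: "(\<lambda>n. s (r n)) \<longlonglongrightarrow> \<tau>"
    by (rule LIM_zero_cancel, rule Lim_null_comparison[OF _ er2]) (use ys(2) in auto)
  have \<tau>T: "\<tau> \<in> {t0..T}" using \<tau> by auto
  have Hv: "H x (- p') v \<tau> \<le> q'" if v: "v \<in> U" for v
  proof (rule LIMSEQ_le[OF _ limq])
    show "(\<lambda>n. H (y (r n)) (- p (r n)) v (s (r n))) \<longlonglongrightarrow> H x (- p') v \<tau>"
      by (intro hamiltonian_tendsto limy tendsto_minus limp tendsto_const lims v sT(2) \<tau>T)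
  qed (use sub[OF v] in auto)
  have Hu: "q' \<le> H x (- p') u' \<tau>"
  proof (rule LIMSEQ_le[OF limq])
    show "(\<lambda>n. H (y (r n)) (- p (r n)) (u (r n)) (s (r n))) \<longlonglongrightarrow> H x (- p') u' \<tau>"
      by (intro hamiltonian_tendsto limy tendsto_minus limp limu lims u(1) u' sT(2) \<tau>T)
  qed (use u(2) in auto)
  have limV: "(\<lambda>n. V (y (r n)) (s (r n))) \<longlonglongrightarrow> V x \<tau>"
    using continuous_on_tendsto_compose[OF V_continuous tendsto_Pair[OF limy lims]] sT(2) \<tau>T by auto
  have upper: "V x' \<tau>' \<le> V x \<tau> + p' \<bullet> (x' - x) + q' * (\<tau>' - \<tau>) + gap \<tau>' x' \<tau> x * \<Omega> (4 * gap \<tau>' x' \<tau> x)"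
    if x': "norm x' \<le> N" "\<tau>' \<in> {t0..T'}" and ne: "gap \<tau>' x' \<tau> x > 0" for x' \<tau>'
  proof (rule LIMSEQ_le[OF tendsto_const])
    let ?d = "gap \<tau>' x' \<tau> x"
    let ?dn = "\<lambda>n. gap \<tau>' x' (s (r n)) (y (r n))"
    have limd: "?dn \<longlonglongrightarrow> ?d" by (intro tendsto_intros limy lims)
    show "(\<lambda>n. V (y (r n)) (s (r n)) + p (r n) \<bullet> (x' - y (r n)) + q (r n) * (\<tau>' - s (r n)) + ?dn n * \<Omega> (4 * ?d))
        \<longlonglongrightarrow> V x \<tau> + p' \<bullet> (x' - x) + q' * (\<tau>' - \<tau>) + ?d * \<Omega> (4 * ?d)"
      by (intro tendsto_intros limV limp limy limq lims)
    have "\<forall>\<^sub>F n in sequentially. ?dn n < 2 * ?d" using order_tendstoD(2)[OF limd, of "2 * ?d"] ne by simp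
    then have "\<forall>\<^sub>F n in sequentially. V x' \<tau>' \<le> V (y (r n)) (s (r n)) + p (r n) \<bullet> (x' - y (r n)) + q (r n) * (\<tau>' - s (r n)) + ?dn n * \<Omega> (4 * ?d)"
    proof eventually_elim
      case (elim n)
      have "?dn n * \<Omega> (2 * ?dn n) \<le> ?dn n * \<Omega> (4 * ?d)"
        using elim by (intro mult_left_mono \<Omega>(2)) auto
      then show ?case using super[OF x', of "r n"] by linarith
    qed
    then show "\<exists>N. \<forall>n\<ge>N. V x' \<tau>' \<le> V (y (r n)) (s (r n)) + p (r n) \<bullet> (x' - y (r n)) + q (r n) * (\<tau>' - s (r n)) + ?dn n * \<Omega> (4 * ?d)"
      unfolding eventually_sequentially .
  qed
  have small: "\<exists>d>0. \<forall>z. 0 < z \<and> z < d \<longrightarrow> \<Omega> (4 * z) \<le> \<epsilon>" if "\<epsilon> > 0" for \<epsilon>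
  proof -
    have "\<forall>\<^sub>F d in at_right 0. \<Omega> d < \<epsilon>" using order_tendstoD(2)[OF \<Omega>(3) that] .
    then obtain b where b: "b > 0" "\<And>z. 0 < z \<Longrightarrow> z < b \<Longrightarrow> \<Omega> z < \<epsilon>"
      unfolding eventually_at_right[OF zero_less_one] by auto
    then show ?thesis by (intro exI[of _ "b / 4"]) (auto intro: less_imp_le)
  qed
  have "p' \<in> superdiff_x V x \<tau>"
    unfolding superdiff_x_def
  proof (rule CollectI, rule Limsup_nonpos)
    fix \<epsilon> :: real assume "\<epsilon> > 0"
    then obtain d where d: "d > 0" "\<And>z. 0 < z \<Longrightarrow> z < d \<Longrightarrow> \<Omega> (4 * z) \<le> \<epsilon>" using small by blast
    have "\<forall>\<^sub>F x' in at x. x' \<noteq> x \<and> dist x' x < min 1 d" using d(1) by (auto simp: eventually_at intro!: exI[of _ "min 1 d"])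
    then show "\<forall>\<^sub>F x' in at x. (V x' \<tau> - V x \<tau> - p' \<bullet> (x' - x)) / norm (x' - x) \<le> \<epsilon>"
    proof eventually_elim
      case (elim x')
      then have n: "norm (x' - x) < 1" "norm (x' - x) < d" "norm (x' - x) > 0" by (auto simp: dist_norm)
      have "norm x' \<le> N" using norm_triangle_sub[of x' x] n by (simp add: N_def)
      then have "V x' \<tau> - V x \<tau> - p' \<bullet> (x' - x) \<le> norm (x' - x) * \<Omega> (4 * norm (x' - x))"
        using upper[of x' \<tau>] \<tau> \<delta> n by (simp add: T'_def)
      also have "\<dots> \<le> norm (x' - x) * \<epsilon>" using d(2) n by (intro mult_left_mono) auto
      finally show ?case using n by (simp add: pos_divide_le_eq mult.commute)
    qed
  qed
  moreover have "q' \<in> superdiff_t t0 T V x \<tau>"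
    unfolding superdiff_t_def
  proof (rule CollectI, rule Limsup_nonpos)
    fix \<epsilon> :: real assume "\<epsilon> > 0"
    then obtain d where d: "d > 0" "\<And>z. 0 < z \<Longrightarrow> z < d \<Longrightarrow> \<Omega> (4 * z) \<le> \<epsilon>" using small by blast
    have "\<forall>\<^sub>F t in at \<tau> within {t0..T}. t \<in> {t0..T} \<and> t \<noteq> \<tau> \<and> dist t \<tau> < min \<delta> d"
      using d(1) \<delta> by (auto simp: eventually_at intro!: exI[of _ "min \<delta> d"])
    then show "\<forall>\<^sub>F t in at \<tau> within {t0..T}. (V x t - V x \<tau> - q' * (t - \<tau>)) / \<bar>t - \<tau>\<bar> \<le> \<epsilon>"
    proof eventually_elim
      case (elim t)
      then have n: "\<bar>t - \<tau>\<bar> < \<delta>" "\<bar>t - \<tau>\<bar> < d" "\<bar>t - \<tau>\<bar> > 0" by (auto simp: dist_real_def)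
      have "t \<in> {t0..T'}" using n elim \<delta> by (auto simp: T'_def)
      then have "V x t - V x \<tau> - q' * (t - \<tau>) \<le> \<bar>t - \<tau>\<bar> * \<Omega> (4 * \<bar>t - \<tau>\<bar>)"
        using upper[of x t] n by (simp add: N_def)
      also have "\<dots> \<le> \<bar>t - \<tau>\<bar> * \<epsilon>" using d(2) n by (intro mult_left_mono) auto
      finally show ?case using n by (simp add: pos_divide_le_eq mult.commute)
    qed
  qed
  moreover have "q' = H x (- p') u' \<tau>" using Hv[OF u'] Hu by simp
  ultimately show thesis using that[of u' p'] u' Hv by simp
qed

theorem value_function_extended_solution: "extended_solution f F U t0 T V"
  unfolding extended_solution_def
proof (intro conjI allI ballI)
  fix x :: "real^'n" and \<tau> assume \<tau>: "\<tau> \<in> {t0..T}"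
  show "\<exists>p. \<exists>u\<in>U. - p \<in> superdiff_x V x \<tau> \<and>
        (\<forall>v\<in>U. H x p v \<tau> \<le> H x p u \<tau>) \<and>
        H x p u \<tau> \<in> superdiff_t t0 T V x \<tau>"
  proof (cases "\<tau> = T")
    case True
    then show ?thesis
      using extended_solution_at_terminal_time[of x] by (metis minus_zero)
  next
    case False
    then obtain p u where "u \<in> U" "p \<in> superdiff_x V x \<tau>"
      "\<And>v. v \<in> U \<Longrightarrow> H x (- p) v \<tau> \<le> H x (- p) u \<tau>"
      "H x (- p) u \<tau> \<in> superdiff_t t0 T V x \<tau>"
      using extended_solution_before_terminal_time[of \<tau> x] \<tau> by (metis atLeastAtMost_iff atLeastLessThan_iff order_le_less)
    then show ?thesis by (intro exI[of _ "- p"] bexI[of _ u]) auto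
  qed
qed (rule V_continuous V_terminal)+

end

theorem theorem2p1:
  fixes t0 T :: real
    and U :: "(real^'m) set"
    and f :: "real^'n \<Rightarrow> real^'m \<Rightarrow> real \<Rightarrow> real^'n"
    and F :: "real^'n \<Rightarrow> real^'m \<Rightarrow> real \<Rightarrow> real"
  assumes "t0 < T"
    and "U \<noteq> {}"
    and unique_trajectory: "\<And>x0 \<tau> u. \<tau> \<in> {t0..T} \<Longrightarrow> u \<in> admissible_controls U T \<tau> \<Longrightarrow>
          \<exists>x. trajectory f T x0 \<tau> u x \<and>
              (\<forall>y. trajectory f T x0 \<tau> u y \<longrightarrow> (\<forall>t\<in>{\<tau>..T}. y t = x t))"
    and i_f: "continuous_on (UNIV \<times> U \<times> {t0..T}) (\<lambda>(x, u, t). f x u t)"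
    and i_F: "continuous_on (UNIV \<times> U \<times> {t0..T}) (\<lambda>(x, u, t). F x u t)"
    and i_bound: "\<exists>M>0. \<forall>u\<in>U. \<forall>t\<in>{t0..T}. norm (f 0 u t) \<le> M \<and> \<bar>F 0 u t\<bar> \<le> M"
    and ii: "\<exists>L :: real \<Rightarrow> real. mono_on {0..} L \<and> (\<forall>r\<ge>0. 0 \<le> L r) \<and>
          (\<forall>R>0. \<forall>x\<in>ball 0 R. \<forall>y\<in>ball 0 R. \<forall>t\<in>{t0..T}. \<forall>s\<in>{t0..T}. \<forall>u\<in>U.
             norm (f x u t - f y u s) \<le> L R * (\<bar>t - s\<bar> + norm (x - y)) \<and>
             \<bar>F x u t - F y u s\<bar> \<le> L R * (\<bar>t - s\<bar> + norm (x - y)))"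
    and iii: "\<exists>\<omega>. modulus \<omega> \<and>
          (\<forall>R>0. \<forall>c\<in>{0..1}. \<forall>x\<in>ball 0 R. \<forall>y\<in>ball 0 R. \<forall>t\<in>{t0..T}. \<forall>s\<in>{t0..T}. \<forall>u\<in>U.
             norm (c *\<^sub>R f x u t + (1 - c) *\<^sub>R f y u s
                   - f (c *\<^sub>R x + (1 - c) *\<^sub>R y) u (c * t + (1 - c) * s))
             \<le> c * (1 - c) * (\<bar>t - s\<bar> + norm (x - y)) * \<omega> R (\<bar>t - s\<bar> + norm (x - y)))"
    and iv: "\<exists>\<omega>. modulus \<omega> \<and>
          (\<forall>R>0. \<forall>c\<in>{0..1}. \<forall>x\<in>ball 0 R. \<forall>y\<in>ball 0 R. \<forall>t\<in>{t0..T}. \<forall>s\<in>{t0..T}. \<forall>u\<in>U.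
             c * F x u t + (1 - c) * F y u s
                   - F (c *\<^sub>R x + (1 - c) *\<^sub>R y) u (c * t + (1 - c) * s)
             \<le> c * (1 - c) * (\<bar>t - s\<bar> + norm (x - y)) * \<omega> R (\<bar>t - s\<bar> + norm (x - y)))"
    and "compact U"
  shows "(\<forall>x0. \<forall>\<tau>\<in>{t0..T}. bdd_below (costs f F U T x0 \<tau>)) \<and>
         extended_solution f F U t0 T (value_function f F U T)"
  using ii iii iv
proof (elim exE conjE, goal_cases)
  case (1 L \<omega>f \<omega>F)
  interpret semiconcave_control_system t0 T U f F L \<omega>f \<omega>F
  proof unfold_locales
    show "\<exists>x. trajectory f T x0 \<tau> u x" if "\<tau> \<in> {t0..T}" "u \<in> admissible_controls U T \<tau>" for x0 \<tau> u
      using unique_trajectory[OF that] by blast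
  qed (use 1 assms(1,2,4,5,9) \<open>compact U\<close> in \<open>simp_all add: Ball_def\<close>)
  show ?case
    by (simp add: costs_bdd_below value_function_extended_solution)
qed

end
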